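(* Let $\Gamma$ be a finitely generated group with finite generating system $Q$, let $Z\subset\mathrm{Sub}(\Gamma)$ be a uniformly recurrent subgroup and let $H\in Z$ be such that the Schreier graph $S^Q_\Gamma(H)$ has Local Property A. Then the $C^*$-algebra $C^*_r(Z)$ is nuclear.
   Context: $\mathrm{Sub}(\Gamma)$ is the compact space of subgroups of $\Gamma$, with $\Gamma$ acting by conjugation. A uniformly recurrent subgroup (URS) is a nonempty closed invariant $Z\subset\mathrm{Sub}(\Gamma)$ on which the action is minimal. Let $Q=\{\gamma_1,\dots,\gamma_n\}$. For $H\in\mathrm{Sub}(\Gamma)$ the Schreier graph $S=S^Q_\Gamma(H)$ has vertex set $V(S)=\Gamma/H$, with a directed edge labeled $\gamma_i$ connecting $aH$ and $bH$ whenever $\gamma_i aH=bH$ (and one labeled $\gamma_i^{-1}$ if $\gamma_i bH=aH$); $d_S$ is the shortest path metric and $B_r(S,x)$ is the $r$-ball around $x$, as a rooted edge-labeled graph. Local Property A: $S$ has Local Property A if there is a sequence of maps $\varsigma^n:V(S)\to\ell^2(V(S))$, $x\mapsto\varsigma^n_x$ ($n\ge1$), such that: each $\varsigma^n_x$ has norm $1$; if $d_S(x,y)\le n$ then $\|\varsigma^n_x-\varsigma^n_y\|\le\frac1n$; for each $n$ there is $R_n>0$ such that $\varsigma^n_x$ is supported in $B_{R_n}(S,x)$ for all $x$; and for each $n$ there is $S_n>R_n$ such that whenever $B_{S_n}(S,x)$ and $B_{S_n}(S,y)$ are rooted-labeled isomorphic under a map $\theta:B_{S_n}(S,x)\to B_{S_n}(S,y)$,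 then $\varsigma^n_y=\theta(\varsigma^n_x)$ (the vector $\varsigma^n_x$ transported by $\theta$). Fix $H\in Z$ and $S=S^Q_\Gamma(H)$. A local kernel is a function $K:\Gamma/H\times\Gamma/H\to\mathbb{C}$ for which there is an integer $R>0$ such that (1) $K(x,y)=0$ if $d_S(x,y)>R$; (2) if $\theta:B_R(S,y)\to B_R(S,z)$ is a rooted-labeled isomorphism, then $K(y,w)=K(z,\theta(w))$ for all $w\in B_R(S,y)$. Local kernels form a unital $*$-algebra $\mathbb{C}Z$ with pointwise addition, $KL(x,y)=\sum_{z}K(x,z)L(z,y)$, and $K^*(x,y)=\overline{K(y,x)}$. It acts by bounded operators on $\ell^2(\Gamma/H)$ by $(Kf)(x)=\sum_y K(x,y)f(y)$, and $C^*_r(Z)$ is the norm closure of $\mathbb{C}Z$ in $B(\ell^2(\Gamma/H))$. (Up to canonical isomorphism this does not depend on the choice of $H\in Z$ or of $Q$.) *)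

theory Defs
  imports "HOL-Analysis.Analysis" "HOL-Algebra.Left_Coset" "HOL-Algebra.Generated_Groups"
    "HOL-Library.Nonpos_Ints"
begin

section \<open>Uniformly recurrent subgroups\<close>

text \<open>The topology on the set of subgroups induced from \<open>{0,1}\<^sup>\<Gamma>\<close> via indicator functions.\<close>

definition Sub :: "('a, 'b) monoid_scheme \<Rightarrow> 'a set topology" where
  "Sub G = pullback_topology {H. subgroup H G} (\<lambda>H. \<lambda>g\<in>carrier G. g \<in> H)
     (product_topology (\<lambda>_. discrete_topology (UNIV :: bool set)) (carrier G))"

definition conj_subgroup :: "('a, 'b) monoid_scheme \<Rightarrow> 'a \<Rightarrow> 'a set \<Rightarrow> 'a set" where
  "conj_subgroup G g H = (\<lambda>h. g \<otimes>\<^bsub>G\<^esub> h \<otimes>\<^bsub>G\<^esub> inv\<^bsub>G\<^esub> g) ` H"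

definition closed_invariant :: "('a, 'b) monoid_scheme \<Rightarrow> 'a set set \<Rightarrow> bool" where
  "closed_invariant G Z \<longleftrightarrow>
     closedin (Sub G) Z \<and> (\<forall>g\<in>carrier G. \<forall>H\<in>Z. conj_subgroup G g H \<in> Z)"

definition URS :: "('a, 'b) monoid_scheme \<Rightarrow> 'a set set \<Rightarrow> bool" where
  "URS G Z \<longleftrightarrow> Z \<noteq> {} \<and> closed_invariant G Z \<and>
     (\<forall>Y. Y \<noteq> {} \<longrightarrow> Y \<subseteq> Z \<longrightarrow> closed_invariant G Y \<longrightarrow> Y = Z)"


section \<open>Schreier graphs\<close>

text \<open>The vertex set is \<open>lcosets\<^bsub>G\<^esub> H\<close>.  Only the edges labeled by generators \<open>\<gamma> \<in> Q\<close> are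
  recorded: the edges labeled \<open>\<gamma>\<close>-inverse are exactly the reversed ones, so they yield no further
  adjacencies and are preserved by every bijection that preserves the former in both directions.\<close>

definition schreier_edge ::
  "('a, 'b) monoid_scheme \<Rightarrow> 'a set \<Rightarrow> 'a \<Rightarrow> 'a set \<Rightarrow> 'a set \<Rightarrow> bool" where
  "schreier_edge G H \<gamma> x y \<longleftrightarrow>
     x \<in> lcosets\<^bsub>G\<^esub> H \<and> y \<in> lcosets\<^bsub>G\<^esub> H \<and> \<gamma> <#\<^bsub>G\<^esub> x = y"

definition schreier_adj ::
  "('a, 'b) monoid_scheme \<Rightarrow> 'a set \<Rightarrow> 'a set \<Rightarrow> ('a set \<times> 'a set) set" where
  "schreier_adj G Q H = {(x, y). \<exists>\<gamma>\<in>Q. schreier_edge G H \<gamma> x y \<or> schreier_edge G H \<gamma> y x}"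

text \<open>If \<open>Q\<close> generates \<open>G\<close>, the graph is connected and the \<open>LEAST\<close> below ranges over a
  nonempty set.\<close>

definition schreier_dist ::
  "('a, 'b) monoid_scheme \<Rightarrow> 'a set \<Rightarrow> 'a set \<Rightarrow> 'a set \<Rightarrow> 'a set \<Rightarrow> nat" where
  "schreier_dist G Q H x y = (LEAST n. (x, y) \<in> schreier_adj G Q H ^^ n)"

definition schreier_ball ::
  "('a, 'b) monoid_scheme \<Rightarrow> 'a set \<Rightarrow> 'a set \<Rightarrow> nat \<Rightarrow> 'a set \<Rightarrow> 'a set set" where
  "schreier_ball G Q H r x = {y \<in> lcosets\<^bsub>G\<^esub> H. schreier_dist G Q H x y \<le> r}"

text \<open>Balls are regarded as induced labeled subgraphs.\<close>

definition ball_iso ::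
  "('a, 'b) monoid_scheme \<Rightarrow> 'a set \<Rightarrow> 'a set \<Rightarrow> nat \<Rightarrow> 'a set \<Rightarrow> 'a set \<Rightarrow>
     ('a set \<Rightarrow> 'a set) \<Rightarrow> bool" where
  "ball_iso G Q H r x y \<theta> \<longleftrightarrow>
     bij_betw \<theta> (schreier_ball G Q H r x) (schreier_ball G Q H r y) \<and> \<theta> x = y \<and>
     (\<forall>u\<in>schreier_ball G Q H r x. \<forall>v\<in>schreier_ball G Q H r x. \<forall>\<gamma>\<in>Q.
        schreier_edge G H \<gamma> u v \<longleftrightarrow> schreier_edge G H \<gamma> (\<theta> u) (\<theta> v))"


section \<open>The Hilbert space of square-summable functions on a set and its bounded operators\<close>

text \<open>Elements vanish outside of \<open>V\<close>, so that equality of vectors is equality of functions.\<close>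

definition ell2 :: "'v set \<Rightarrow> ('v \<Rightarrow> complex) set" where
  "ell2 V = {f. (\<forall>x. x \<notin> V \<longrightarrow> f x = 0) \<and> (\<lambda>x. (cmod (f x))\<^sup>2) summable_on V}"

definition ell2_inner :: "'v set \<Rightarrow> ('v \<Rightarrow> complex) \<Rightarrow> ('v \<Rightarrow> complex) \<Rightarrow> complex" where
  "ell2_inner V f g = (\<Sum>\<^sub>\<infinity>x\<in>V. f x * cnj (g x))"

definition ell2_norm :: "'v set \<Rightarrow> ('v \<Rightarrow> complex) \<Rightarrow> real" where
  "ell2_norm V f = sqrt (\<Sum>\<^sub>\<infinity>x\<in>V. (cmod (f x))\<^sup>2)"

type_synonym 'v operator = "('v \<Rightarrow> complex) \<Rightarrow> ('v \<Rightarrow> complex)"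

text \<open>Operators on \<open>ell2 V\<close> are extended by zero to functions outside of \<open>ell2 V\<close>, so that
  equality of operators is equality of functions.\<close>

definition bounded_ops :: "'v set \<Rightarrow> 'v operator set" where
  "bounded_ops V = {T.
     (\<forall>f\<in>ell2 V. T f \<in> ell2 V) \<and>
     (\<forall>f. f \<notin> ell2 V \<longrightarrow> T f = (\<lambda>_. 0)) \<and>
     (\<forall>f\<in>ell2 V. \<forall>g\<in>ell2 V. T (\<lambda>x. f x + g x) = (\<lambda>x. T f x + T g x)) \<and>
     (\<forall>c. \<forall>f\<in>ell2 V. T (\<lambda>x. c * f x) = (\<lambda>x. c * T f x)) \<and>
     (\<exists>C. \<forall>f\<in>ell2 V. ell2_norm V (T f) \<le> C * ell2_norm V f)}"

definition op_add :: "'v operator \<Rightarrow> 'v operator \<Rightarrow> 'v operator" where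
  "op_add S T = (\<lambda>f x. S f x + T f x)"

definition op_diff :: "'v operator \<Rightarrow> 'v operator \<Rightarrow> 'v operator" where
  "op_diff S T = (\<lambda>f x. S f x - T f x)"

definition op_scale :: "complex \<Rightarrow> 'v operator \<Rightarrow> 'v operator" where
  "op_scale c T = (\<lambda>f x. c * T f x)"

definition op_norm :: "'v set \<Rightarrow> 'v operator \<Rightarrow> real" where
  "op_norm V T = (SUP f\<in>{f \<in> ell2 V. ell2_norm V f \<le> 1}. ell2_norm V (T f))"

definition is_op_adjoint :: "'v set \<Rightarrow> 'v operator \<Rightarrow> 'v operator \<Rightarrow> bool" where
  "is_op_adjoint V T S \<longleftrightarrow>
     (\<forall>f\<in>ell2 V. \<forall>g\<in>ell2 V. ell2_inner V (T f) g = ell2_inner V f (S g))"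

definition op_closure :: "'v set \<Rightarrow> 'v operator set \<Rightarrow> 'v operator set" where
  "op_closure V A = {T \<in> bounded_ops V. \<forall>e>0. \<exists>S\<in>A. op_norm V (op_diff T S) < e}"

definition cstar_subalgebra :: "'v set \<Rightarrow> 'v operator set \<Rightarrow> bool" where
  "cstar_subalgebra V A \<longleftrightarrow>
     A \<subseteq> bounded_ops V \<and> A \<noteq> {} \<and>
     (\<forall>S\<in>A. \<forall>T\<in>A. op_add S T \<in> A \<and> S \<circ> T \<in> A) \<and>
     (\<forall>c. \<forall>T\<in>A. op_scale c T \<in> A) \<and>
     (\<forall>T\<in>A. \<exists>S\<in>A. is_op_adjoint V T S) \<and>
     op_closure V A \<subseteq> A"


section \<open>Nuclearity\<close>

text \<open>Positivity of an \<open>n \<times> n\<close> operator matrix, acting on the \<open>n\<close>-fold direct sum of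
  \<open>ell2 V\<close>.\<close>

definition positive_op_matrix :: "'v set \<Rightarrow> nat \<Rightarrow> (nat \<Rightarrow> nat \<Rightarrow> 'v operator) \<Rightarrow> bool" where
  "positive_op_matrix V n a \<longleftrightarrow>
     (\<forall>\<xi>. (\<forall>i<n. \<xi> i \<in> ell2 V) \<longrightarrow>
        (\<Sum>i<n. \<Sum>j<n. ell2_inner V (a i j (\<xi> j)) (\<xi> i)) \<in> \<real>\<^sub>\<ge>\<^sub>0)"

definition completely_positive ::
  "'v set \<Rightarrow> 'v operator set \<Rightarrow> 'w set \<Rightarrow> ('v operator \<Rightarrow> 'w operator) \<Rightarrow> bool" where
  "completely_positive V A W \<phi> \<longleftrightarrow>
     (\<forall>n a. (\<forall>i<n. \<forall>j<n. a i j \<in> A) \<longrightarrow> positive_op_matrix V n a \<longrightarrow>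
        positive_op_matrix W n (\<lambda>i j. \<phi> (a i j)))"

text \<open>Contractive completely positive linear maps from \<open>A \<subseteq> B(ell2 V)\<close> to \<open>B \<subseteq> B(ell2 W)\<close>.\<close>

definition ccp_map ::
  "'v set \<Rightarrow> 'v operator set \<Rightarrow> 'w set \<Rightarrow> 'w operator set \<Rightarrow>
     ('v operator \<Rightarrow> 'w operator) \<Rightarrow> bool" where
  "ccp_map V A W B \<phi> \<longleftrightarrow>
     \<phi> ` A \<subseteq> B \<and>
     (\<forall>S\<in>A. \<forall>T\<in>A. \<phi> (op_add S T) = op_add (\<phi> S) (\<phi> T)) \<and>
     (\<forall>c. \<forall>T\<in>A. \<phi> (op_scale c T) = op_scale c (\<phi> T)) \<and>
     completely_positive V A W \<phi> \<and>
     (\<forall>T\<in>A. op_norm W (\<phi> T) \<le> op_norm V T)"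

text \<open>Nuclearity as in Brown and Ozawa, Definition 2.3.1: the identity map is a point-norm limit of
  contractive completely positive maps factoring through matrix algebras.  The matrix algebra
  of size \<open>k\<close> is the algebra of all operators on the \<open>k\<close>-dimensional Hilbert space
  \<open>ell2 {..<k}\<close>.  Positivity in matrices over a \<open>C\<^sup>*\<close>-subalgebra of \<open>B(ell2 V)\<close>, and hence
  nuclearity, does not depend on the representation.\<close>

definition nuclear :: "'v set \<Rightarrow> 'v operator set \<Rightarrow> bool" where
  "nuclear V A \<longleftrightarrow> cstar_subalgebra V A \<and>
     (\<forall>F e. finite F \<longrightarrow> F \<subseteq> A \<longrightarrow> e > 0 \<longrightarrow>
        (\<exists>(k::nat) \<phi> \<psi>.
           ccp_map V A {..<k} (bounded_ops {..<k}) \<phi> \<and>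
           ccp_map {..<k} (bounded_ops {..<k}) V A \<psi> \<and>
           (\<forall>T\<in>F. op_norm V (op_diff (\<psi> (\<phi> T)) T) < e)))"


section \<open>Local Property A and the algebra of local kernels\<close>

definition transport :: "('v \<Rightarrow> 'v) \<Rightarrow> 'v set \<Rightarrow> ('v \<Rightarrow> complex) \<Rightarrow> 'v \<Rightarrow> complex" where
  "transport \<theta> B f = (\<lambda>v. if v \<in> \<theta> ` B then f (inv_into B \<theta> v) else 0)"

definition local_property_A :: "('a, 'b) monoid_scheme \<Rightarrow> 'a set \<Rightarrow> 'a set \<Rightarrow> bool" where
  "local_property_A G Q H \<longleftrightarrow>
     (\<exists>\<sigma> :: nat \<Rightarrow> 'a set \<Rightarrow> 'a set \<Rightarrow> complex. \<forall>n\<ge>1.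
        (\<forall>x\<in>lcosets\<^bsub>G\<^esub> H. \<sigma> n x \<in> ell2 (lcosets\<^bsub>G\<^esub> H) \<and> ell2_norm (lcosets\<^bsub>G\<^esub> H) (\<sigma> n x) = 1) \<and>
        (\<forall>x\<in>lcosets\<^bsub>G\<^esub> H. \<forall>y\<in>lcosets\<^bsub>G\<^esub> H. schreier_dist G Q H x y \<le> n \<longrightarrow>
           ell2_norm (lcosets\<^bsub>G\<^esub> H) (\<lambda>v. \<sigma> n x v - \<sigma> n y v) \<le> 1 / real n) \<and>
        (\<exists>R>0.
           (\<forall>x\<in>lcosets\<^bsub>G\<^esub> H. \<forall>v. v \<notin> schreier_ball G Q H R x \<longrightarrow> \<sigma> n x v = 0) \<and>
           (\<exists>S>R. \<forall>x\<in>lcosets\<^bsub>G\<^esub> H. \<forall>y\<in>lcosets\<^bsub>G\<^esub> H. \<forall>\<theta>. ball_iso G Q H S x y \<theta> \<longrightarrow>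
              \<sigma> n y = transport \<theta> (schreier_ball G Q H S x) (\<sigma> n x))))"

text \<open>Kernels are extended by zero outside of the vertex set.\<close>

definition local_kernel ::
  "('a, 'b) monoid_scheme \<Rightarrow> 'a set \<Rightarrow> 'a set \<Rightarrow> ('a set \<Rightarrow> 'a set \<Rightarrow> complex) \<Rightarrow> bool" where
  "local_kernel G Q H K \<longleftrightarrow>
     (\<forall>x y. x \<notin> lcosets\<^bsub>G\<^esub> H \<or> y \<notin> lcosets\<^bsub>G\<^esub> H \<longrightarrow> K x y = 0) \<and>
     (\<exists>R>0.
        (\<forall>x\<in>lcosets\<^bsub>G\<^esub> H. \<forall>y\<in>lcosets\<^bsub>G\<^esub> H. schreier_dist G Q H x y > R \<longrightarrow> K x y = 0) \<and>
        (\<forall>y\<in>lcosets\<^bsub>G\<^esub> H. \<forall>z\<in>lcosets\<^bsub>G\<^esub> H. \<forall>\<theta>. ball_iso G Q H R y z \<theta> \<longrightarrow>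
           (\<forall>w\<in>schreier_ball G Q H R y. K y w = K z (\<theta> w))))"

definition kernel_op :: "'v set \<Rightarrow> ('v \<Rightarrow> 'v \<Rightarrow> complex) \<Rightarrow> 'v operator" where
  "kernel_op V K = (\<lambda>f x. if f \<in> ell2 V \<and> x \<in> V then \<Sum>\<^sub>\<infinity>y\<in>V. K x y * f y else 0)"

text \<open>The reduced algebra of a uniformly recurrent subgroup, realised on \<open>\<Gamma>/H\<close> for a chosen
  member \<open>H\<close>.\<close>

definition reduced_cstar ::
  "('a, 'b) monoid_scheme \<Rightarrow> 'a set \<Rightarrow> 'a set \<Rightarrow> 'a set operator set" where
  "reduced_cstar G Q H =
     op_closure (lcosets\<^bsub>G\<^esub> H) (kernel_op (lcosets\<^bsub>G\<^esub> H) ` {K. local_kernel G Q H K})"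

end

theory Submission
  imports Defs
begin

text \<open>
  Encode a finite ball of the Schreier graph by the stabilisers of its vertices: a function on
  \<open>\<Gamma>/H\<close> depends only on the isomorphism type of some \<open>r\<close>-ball iff its value at \<open>x\<close> is determined
  by which elements of a fixed finite subset of \<open>\<Gamma>\<close> fix \<open>x\<close>.  Local kernels and Local Property A
  then only involve the action of \<open>\<Gamma>\<close> on \<open>\<Gamma>/H\<close>.

  Let \<open>\<sigma>\<close> be as in Local Property A, with supports in \<open>R\<close>-neighbourhoods.  Choose finitely many
  representatives \<open>rep x\<close> of vertices up to isomorphism of sufficiently large balls, with
  isomorphisms \<open>\<theta>\<^sub>x\<close> from the \<open>R\<close>-ball of \<open>x\<close> to that of \<open>rep x\<close>.  Compress an operator to
  the finite union of the \<open>R\<close>-balls of the representatives, and send a matrix \<open>M\<close> to the local kernel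
  \<open>(y, w) \<mapsto> (\<Sum>x. \<sigma>\<^sub>y(x) cnj(\<sigma>\<^sub>w(x)) M(\<theta>\<^sub>x y, \<theta>\<^sub>x w))\<close>.  Since \<open>\<Sum>x. |\<sigma>\<^sub>y(x)|\<^sup>2 = 1\<close>, the latter is the
  compression of a diagonal operator by an isometry, hence completely positive and contractive.  On
  a local kernel \<open>K\<close> the composition is the Schur multiplier \<open>K(y, w) \<langle>\<sigma>\<^sub>y, \<sigma>\<^sub>w\<rangle>\<close>, which is close to
  \<open>K\<close> because \<open>\<sigma>\<close> varies slowly.
\<close>

section \<open>Square-summable functions and bounded operators\<close>

text \<open>The delicate point is that the map out of the matrices must land in the algebra itself,
  not merely in the bounded operators. Compressing to every R-ball separately would need infinitely
  many blocks and arbitrary identifications. Two facts prevent this. A fixed finite set of group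
  elements produces only finitely many patterns of coincidences among the points g x, so one finite
  union of balls serves all vertices. And a rooted labelled isomorphism is forced to send g x to g
  y, so matching a ball with that of its representative involves no choice. Hence the coefficients
  of the output kernel depend on local data only; the last clause of Local Property A provides this
  for the factors \<open>\<sigma>\<close>.

  The kernels to be approximated enter the choice of representatives: x and \<open>rep x\<close>
  must also agree on their entries inside the R-ball, so that every x near y and w returns the same
  value K(y, w). The order of choices is therefore: kernels, their common range P and bound c, the
  tolerance, then \<open>\<sigma>\<close> and R, and last the representatives. As P precedes the
  tolerance, the crude bound \<open>c * \<epsilon> * card P\<close> suffices.\<close>

lemma ell2_finite_L2_le:
  assumes "f \<in> ell2 V" "finite E" "E \<subseteq> V"
  shows "L2_set (\<lambda>x. cmod (f x)) E \<le> ell2_norm V f"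
  using assms unfolding L2_set_def ell2_norm_def ell2_def
  by (auto intro!: real_sqrt_le_mono finite_sum_le_infsum)

text \<open>Inequalities are proved on finite sets, where those for \<open>L2_set\<close> apply, and
  passed to the limit here; one uniform bound yields both summability and the norm estimate.\<close>

lemma ell2_I_finite_L2:
  assumes "\<And>x. x \<notin> V \<Longrightarrow> f x = 0" "0 \<le> B"
    and "\<And>E. finite E \<Longrightarrow> E \<subseteq> V \<Longrightarrow> L2_set (\<lambda>x. cmod (f x)) E \<le> B"
  shows "f \<in> ell2 V \<and> ell2_norm V f \<le> B"
proof -
  have fin: "(\<Sum>x\<in>E. (cmod (f x))\<^sup>2) \<le> B\<^sup>2" if "finite E" "E \<subseteq> V" for E
    using assms(3)[OF that] assms(2) unfolding L2_set_def by (simp add: real_le_lsqrt sqrt_le_D)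
  have sm: "(\<lambda>x. (cmod (f x))\<^sup>2) summable_on V"
    by (rule nonneg_bdd_above_summable_on) (auto intro!: bdd_aboveI2[where M="B\<^sup>2"] fin)
  moreover have "(\<Sum>\<^sub>\<infinity>x\<in>V. (cmod (f x))\<^sup>2) \<le> B\<^sup>2"
    by (rule infsum_le_finite_sums[OF sm fin])
  ultimately show ?thesis
    using assms(1,2) unfolding ell2_def ell2_norm_def
    by (auto intro: real_le_lsqrt infsum_nonneg)
qed

lemma ell2_norm_nonneg [simp]: "0 \<le> ell2_norm V f"
  unfolding ell2_norm_def by (simp add: infsum_nonneg)

lemma ell2_dominated:
  assumes "f \<in> ell2 V" "\<And>x. x \<notin> V \<Longrightarrow> g x = 0" "\<And>x. x \<in> V \<Longrightarrow> cmod (g x) \<le> cmod (f x)"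
  shows "g \<in> ell2 V" and "ell2_norm V g \<le> ell2_norm V f"
proof -
  have "g \<in> ell2 V \<and> ell2_norm V g \<le> ell2_norm V f"
  proof (rule ell2_I_finite_L2)
    fix E assume "finite E" "E \<subseteq> V"
    then have "L2_set (\<lambda>x. cmod (g x)) E \<le> L2_set (\<lambda>x. cmod (f x)) E"
      using assms by (intro L2_set_mono) auto
    also have "\<dots> \<le> ell2_norm V f"
      using \<open>finite E\<close> \<open>E \<subseteq> V\<close> assms(1) by (rule ell2_finite_L2_le[rotated])
    finally show "L2_set (\<lambda>x. cmod (g x)) E \<le> ell2_norm V f" .
  qed (use assms in auto)
  then show "g \<in> ell2 V" "ell2_norm V g \<le> ell2_norm V f" by auto
qed

lemma ell2_add:
  assumes "f \<in> ell2 V" "g \<in> ell2 V"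
  shows "(\<lambda>x. f x + g x) \<in> ell2 V"
    and "ell2_norm V (\<lambda>x. f x + g x) \<le> ell2_norm V f + ell2_norm V g"
proof -
  have "(\<lambda>x. f x + g x) \<in> ell2 V \<and> ell2_norm V (\<lambda>x. f x + g x) \<le> ell2_norm V f + ell2_norm V g"
  proof (rule ell2_I_finite_L2)
    fix E assume E: "finite E" "E \<subseteq> V"
    have "L2_set (\<lambda>x. cmod (f x + g x)) E \<le> L2_set (\<lambda>x. cmod (f x) + cmod (g x)) E"
      by (intro L2_set_mono norm_triangle_ineq) auto
    also have "\<dots> \<le> L2_set (\<lambda>x. cmod (f x)) E + L2_set (\<lambda>x. cmod (g x)) E"
      by (rule L2_set_triangle_ineq)
    also have "\<dots> \<le> ell2_norm V f + ell2_norm V g"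
      using assms E by (intro add_mono ell2_finite_L2_le)
    finally show "L2_set (\<lambda>x. cmod (f x + g x)) E \<le> ell2_norm V f + ell2_norm V g" .
  qed (use assms in \<open>auto simp: ell2_def\<close>)
  then show "(\<lambda>x. f x + g x) \<in> ell2 V"
    "ell2_norm V (\<lambda>x. f x + g x) \<le> ell2_norm V f + ell2_norm V g" by auto
qed

lemma ell2_scale:
  assumes "f \<in> ell2 V"
  shows "(\<lambda>x. c * f x) \<in> ell2 V"
  using assms unfolding ell2_def by (auto simp: norm_mult power_mult_distrib intro: summable_on_cmult_right)

lemma ell2_norm_scale: "ell2_norm V (\<lambda>x. c * f x) = cmod c * ell2_norm V f"
  unfolding ell2_norm_def
  by (simp add: norm_mult power_mult_distrib infsum_cmult_right' real_sqrt_mult)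

lemma ell2_norm_minus_commute: "ell2_norm V (\<lambda>x. f x - g x) = ell2_norm V (\<lambda>x. g x - f x)"
  unfolding ell2_norm_def by (simp add: norm_minus_commute)

lemma ell2_diff:
  assumes "f \<in> ell2 V" "g \<in> ell2 V"
  shows "(\<lambda>x. f x - g x) \<in> ell2 V"
    and "ell2_norm V (\<lambda>x. f x - g x) \<le> ell2_norm V f + ell2_norm V g"
  using ell2_add[OF assms(1) ell2_scale[OF assms(2), of "-1"]] ell2_norm_scale[of V "-1" g] by simp_all

lemma ell2_zero [simp]: "(\<lambda>_. 0) \<in> ell2 V" "ell2_norm V (\<lambda>_. 0) = 0"
  unfolding ell2_def ell2_norm_def by auto

lemma ell2_sum:
  assumes "\<And>i. i \<in> I \<Longrightarrow> f i \<in> ell2 V"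
  shows "(\<lambda>x. \<Sum>i\<in>I. f i x) \<in> ell2 V \<and> ell2_norm V (\<lambda>x. \<Sum>i\<in>I. f i x) \<le> (\<Sum>i\<in>I. ell2_norm V (f i))"
  using assms
proof (induction I rule: infinite_finite_induct)
  case (insert i I)
  then show ?case using ell2_add[of "f i" V "\<lambda>x. \<Sum>i\<in>I. f i x"] by auto
qed auto

lemma ell2_finite [simp]: "finite V \<Longrightarrow> f \<in> ell2 V \<longleftrightarrow> (\<forall>x. x \<notin> V \<longrightarrow> f x = 0)"
  unfolding ell2_def by auto

lemma ell2_norm_eq_0:
  assumes "f \<in> ell2 V" "ell2_norm V f = 0"
  shows "f = (\<lambda>_. 0)"
proof
  fix x show "f x = 0"
  proof (cases "x \<in> V")
    case True
    then have "L2_set (\<lambda>x. cmod (f x)) {x} \<le> 0" using ell2_finite_L2_le[of f V "{x}"] assms by auto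
    then show ?thesis by (simp add: L2_set_def)
  qed (use assms in \<open>auto simp: ell2_def\<close>)
qed

lemma ell2_reindex:
  assumes "bij_betw p V V" "f \<in> ell2 V"
  shows "(\<lambda>x. if x \<in> V then f (p x) else 0) \<in> ell2 V"
    and "ell2_norm V (\<lambda>x. if x \<in> V then f (p x) else 0) = ell2_norm V f"
proof -
  have "(\<lambda>x. (cmod (f (p x)))\<^sup>2) summable_on V"
    using summable_on_reindex_bij_betw[OF assms(1), of "\<lambda>x. (cmod (f x))\<^sup>2"] assms(2)
    by (simp add: ell2_def)
  then show "(\<lambda>x. if x \<in> V then f (p x) else 0) \<in> ell2 V"
    by (simp add: ell2_def cong: summable_on_cong)
  show "ell2_norm V (\<lambda>x. if x \<in> V then f (p x) else 0) = ell2_norm V f"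
    using infsum_reindex_bij_betw[OF assms(1), of "\<lambda>x. (cmod (f x))\<^sup>2"]
    by (simp add: ell2_norm_def cong: infsum_cong)
qed

lemma ell2_product_summable:
  assumes "f \<in> ell2 V" "g \<in> ell2 V"
  shows "(\<lambda>x. cmod (f x) * cmod (g x)) summable_on V"
    and "(\<Sum>\<^sub>\<infinity>x\<in>V. cmod (f x) * cmod (g x)) \<le> ell2_norm V f * ell2_norm V g"
proof -
  have fin: "(\<Sum>x\<in>E. cmod (f x) * cmod (g x)) \<le> ell2_norm V f * ell2_norm V g"
    if E: "finite E" "E \<subseteq> V" for E
  proof -
    have "(\<Sum>x\<in>E. cmod (f x) * cmod (g x)) \<le> L2_set (\<lambda>x. cmod (f x)) E * L2_set (\<lambda>x. cmod (g x)) E"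
      using L2_set_mult_ineq[of "\<lambda>x. cmod (f x)" "\<lambda>x. cmod (g x)" E] by simp
    also have "\<dots> \<le> ell2_norm V f * ell2_norm V g"
      using assms E by (intro mult_mono ell2_finite_L2_le) auto
    finally show ?thesis .
  qed
  show sm: "(\<lambda>x. cmod (f x) * cmod (g x)) summable_on V"
    by (rule nonneg_bdd_above_summable_on)
      (auto intro!: bdd_aboveI2[where M="ell2_norm V f * ell2_norm V g"] fin)
  show "(\<Sum>\<^sub>\<infinity>x\<in>V. cmod (f x) * cmod (g x)) \<le> ell2_norm V f * ell2_norm V g"
    by (rule infsum_le_finite_sums[OF sm fin])
qed

lemma ell2_inner_abs_summable:
  assumes "f \<in> ell2 V" "g \<in> ell2 V"
  shows "(\<lambda>x. norm (f x * cnj (g x))) summable_on V"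
  using ell2_product_summable(1)[OF assms] by (simp add: norm_mult)

lemma ell2_inner_has_sum:
  assumes "f \<in> ell2 V" "g \<in> ell2 V"
  shows "((\<lambda>x. f x * cnj (g x)) has_sum ell2_inner V f g) V"
  unfolding ell2_inner_def
  by (rule has_sum_infsum[OF abs_summable_summable[OF ell2_inner_abs_summable[OF assms]]])

lemma ell2_Cauchy_Schwarz:
  assumes "f \<in> ell2 V" "g \<in> ell2 V"
  shows "cmod (ell2_inner V f g) \<le> ell2_norm V f * ell2_norm V g"
proof -
  have "cmod (ell2_inner V f g) \<le> (\<Sum>\<^sub>\<infinity>x\<in>V. cmod (f x * cnj (g x)))"
    unfolding ell2_inner_def by (rule norm_infsum_bound[OF ell2_inner_abs_summable[OF assms]])
  also have "\<dots> \<le> ell2_norm V f * ell2_norm V g"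
    using ell2_product_summable(2)[OF assms] by (simp add: norm_mult)
  finally show ?thesis .
qed

lemma ell2_inner_add_left:
  assumes "f \<in> ell2 V" "g \<in> ell2 V" "h \<in> ell2 V"
  shows "ell2_inner V (\<lambda>x. f x + g x) h = ell2_inner V f h + ell2_inner V g h"
  using has_sum_add[OF ell2_inner_has_sum[OF assms(1,3)] ell2_inner_has_sum[OF assms(2,3)]]
  by (auto simp: ell2_inner_def distrib_right dest: infsumI)

lemma ell2_inner_commute: "ell2_inner V g f = cnj (ell2_inner V f g)"
  unfolding ell2_inner_def by (simp flip: infsum_cnj add: mult.commute)

lemma ell2_inner_scale_left: "ell2_inner V (\<lambda>x. c * f x) h = c * ell2_inner V f h"
  unfolding ell2_inner_def by (simp add: infsum_cmult_right' mult.assoc)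

lemma ell2_inner_diff_left:
  assumes "f \<in> ell2 V" "g \<in> ell2 V" "h \<in> ell2 V"
  shows "ell2_inner V (\<lambda>x. f x - g x) h = ell2_inner V f h - ell2_inner V g h"
  using ell2_inner_add_left[OF assms(1) ell2_scale[OF assms(2), of "-1"] assms(3)]
    ell2_inner_scale_left[of V "-1" g h] by simp

lemma ell2_inner_diff_right:
  assumes "f \<in> ell2 V" "g \<in> ell2 V" "h \<in> ell2 V"
  shows "ell2_inner V h (\<lambda>x. f x - g x) = ell2_inner V h f - ell2_inner V h g"
  by (subst (1 2 3) ell2_inner_commute) (simp add: ell2_inner_diff_left[OF assms])

lemma ell2_norm_square: "(ell2_norm V f)\<^sup>2 = (\<Sum>\<^sub>\<infinity>x\<in>V. (cmod (f x))\<^sup>2)"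
  unfolding ell2_norm_def by (simp add: infsum_nonneg)

lemma ell2_inner_self:
  assumes "f \<in> ell2 V"
  shows "ell2_inner V f f = of_real ((ell2_norm V f)\<^sup>2)"
proof -
  have "((\<lambda>x. (cmod (f x))\<^sup>2) has_sum (ell2_norm V f)\<^sup>2) V"
    unfolding ell2_norm_square using assms by (simp add: ell2_def)
  then have "((\<lambda>x. complex_of_real ((cmod (f x))\<^sup>2)) has_sum of_real ((ell2_norm V f)\<^sup>2)) V"
    by (rule has_sum_of_real)
  then show ?thesis
    unfolding ell2_inner_def complex_norm_square by (rule infsumI)
qed

section \<open>Bounded operators and the operator norm\<close>

lemma bounded_opsD:
  assumes "T \<in> bounded_ops V"
  shows "f \<in> ell2 V \<Longrightarrow> T f \<in> ell2 V"
    and "f \<notin> ell2 V \<Longrightarrow> T f = (\<lambda>_. 0)"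
    and "f \<in> ell2 V \<Longrightarrow> g \<in> ell2 V \<Longrightarrow> T (\<lambda>x. f x + g x) = (\<lambda>x. T f x + T g x)"
    and "f \<in> ell2 V \<Longrightarrow> T (\<lambda>x. c * f x) = (\<lambda>x. c * T f x)"
  using assms unfolding bounded_ops_def by blast+

lemma bounded_ops_diff:
  assumes "T \<in> bounded_ops V" "f \<in> ell2 V" "g \<in> ell2 V"
  shows "T (\<lambda>x. f x - g x) = (\<lambda>x. T f x - T g x)"
  using bounded_opsD(3)[OF assms(1,2) ell2_scale[OF assms(3), of "-1"]]
    bounded_opsD(4)[OF assms(1,3), of "-1"] by simp

lemma bounded_ops_sum:
  assumes T: "T \<in> bounded_ops V" and "\<And>i. i \<in> I \<Longrightarrow> f i \<in> ell2 V"
  shows "T (\<lambda>x. \<Sum>i\<in>I. f i x) = (\<lambda>x. \<Sum>i\<in>I. T (f i) x)"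
  using assms(2)
proof (induction I rule: infinite_finite_induct)
  case (insert i I)
  then show ?case using bounded_opsD(3)[OF T, of "f i" "\<lambda>x. \<Sum>i\<in>I. f i x"] ell2_sum[of I f V] by auto
qed (use bounded_opsD(4)[OF T ell2_zero(1), of 0] in auto)

lemma bounded_ops_bounded:
  assumes "T \<in> bounded_ops V"
  shows "\<exists>C\<ge>0. \<forall>f\<in>ell2 V. ell2_norm V (T f) \<le> C * ell2_norm V f"
proof -
  obtain C where "\<forall>f\<in>ell2 V. ell2_norm V (T f) \<le> C * ell2_norm V f"
    using assms unfolding bounded_ops_def by blast
  then have "ell2_norm V (T f) \<le> max 0 C * ell2_norm V f" if "f \<in> ell2 V" for f
    using that by (meson ell2_norm_nonneg max.cobounded2 mult_right_mono order_trans)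
  then show ?thesis by (intro exI[of _ "max 0 C"]) simp
qed

lemma op_norm_bdd_above:
  assumes "T \<in> bounded_ops V"
  shows "bdd_above ((\<lambda>f. ell2_norm V (T f)) ` {f \<in> ell2 V. ell2_norm V f \<le> 1})"
proof -
  obtain C where C: "0 \<le> C" "\<And>f. f \<in> ell2 V \<Longrightarrow> ell2_norm V (T f) \<le> C * ell2_norm V f"
    using bounded_ops_bounded[OF assms] by blast
  have "ell2_norm V (T f) \<le> C" if "f \<in> ell2 V" "ell2_norm V f \<le> 1" for f
    using C(2)[OF that(1)] mult_left_mono[OF that(2) C(1)] by simp
  then show ?thesis by (auto intro!: bdd_aboveI2)
qed

lemma op_norm_nonneg:
  assumes "T \<in> bounded_ops V"
  shows "0 \<le> op_norm V T"
proof -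
  have "ell2_norm V (T (\<lambda>_. 0)) \<le> op_norm V T"
    unfolding op_norm_def by (rule cSUP_upper[OF _ op_norm_bdd_above[OF assms]]) simp
  then show ?thesis using ell2_norm_nonneg order_trans by blast
qed

lemma op_norm_bound:
  assumes "T \<in> bounded_ops V" "f \<in> ell2 V"
  shows "ell2_norm V (T f) \<le> op_norm V T * ell2_norm V f"
proof (cases "ell2_norm V f = 0")
  case True
  then have "f = (\<lambda>_. 0)" using ell2_norm_eq_0[OF assms(2)] by simp
  then show ?thesis using bounded_opsD(4)[OF assms(1) ell2_zero(1), of 0] by simp
next
  case False
  then have pos: "ell2_norm V f > 0" using ell2_norm_nonneg[of V f] by linarith
  let ?c = "complex_of_real (1 / ell2_norm V f)"
  let ?g = "\<lambda>x. ?c * f x"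
  have c: "cmod ?c = 1 / ell2_norm V f" using pos by (simp only: norm_of_real) simp
  have g: "?g \<in> ell2 V" "ell2_norm V ?g \<le> 1"
    using ell2_scale[OF assms(2), of ?c] ell2_norm_scale[of V ?c f] pos unfolding c by simp_all
  have "ell2_norm V (T ?g) \<le> op_norm V T"
    unfolding op_norm_def by (rule cSUP_upper[OF _ op_norm_bdd_above[OF assms(1)]]) (use g in simp)
  also have "T ?g = (\<lambda>x. ?c * T f x)" by (rule bounded_opsD(4)[OF assms])
  finally show ?thesis
    unfolding ell2_norm_scale c using pos by (simp add: field_simps)
qed

lemma op_norm_le:
  assumes "0 \<le> C" "\<And>f. f \<in> ell2 V \<Longrightarrow> ell2_norm V (T f) \<le> C * ell2_norm V f"
  shows "op_norm V T \<le> C"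
  unfolding op_norm_def
proof (rule cSUP_least)
  show "{f \<in> ell2 V. ell2_norm V f \<le> 1} \<noteq> {}" using ell2_zero[of V] by (auto intro!: exI[of _ "\<lambda>_. 0"])
  fix f assume "f \<in> {f \<in> ell2 V. ell2_norm V f \<le> 1}"
  then show "ell2_norm V (T f) \<le> C"
    using assms(2)[of f] mult_left_mono[OF _ assms(1), of "ell2_norm V f" 1] by simp
qed

lemma bounded_opsI:
  assumes "\<And>f. f \<in> ell2 V \<Longrightarrow> T f \<in> ell2 V"
    and "\<And>f. f \<notin> ell2 V \<Longrightarrow> T f = (\<lambda>_. 0)"
    and "\<And>f g. f \<in> ell2 V \<Longrightarrow> g \<in> ell2 V \<Longrightarrow> T (\<lambda>x. f x + g x) = (\<lambda>x. T f x + T g x)"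
    and "\<And>f c. f \<in> ell2 V \<Longrightarrow> T (\<lambda>x. c * f x) = (\<lambda>x. c * T f x)"
    and "\<And>f. f \<in> ell2 V \<Longrightarrow> ell2_norm V (T f) \<le> C * ell2_norm V f"
  shows "T \<in> bounded_ops V"
  using assms unfolding bounded_ops_def by blast

lemma op_scale_bounded:
  assumes T: "T \<in> bounded_ops V"
  shows "op_scale c T \<in> bounded_ops V" and "op_norm V (op_scale c T) \<le> cmod c * op_norm V T"
proof -
  have b: "ell2_norm V (op_scale c T f) \<le> (cmod c * op_norm V T) * ell2_norm V f" if "f \<in> ell2 V" for f
    unfolding op_scale_def ell2_norm_scale
    using op_norm_bound[OF T that] by (simp add: mult.assoc mult_left_mono)
  show "op_scale c T \<in> bounded_ops V"
    by (rule bounded_opsI[OF _ _ _ _ b])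
      (simp_all add: op_scale_def bounded_opsD[OF T] ell2_scale algebra_simps)
  show "op_norm V (op_scale c T) \<le> cmod c * op_norm V T"
    by (rule op_norm_le[OF _ b]) (simp_all add: op_norm_nonneg[OF T])
qed

lemma op_add_bounded:
  assumes S: "S \<in> bounded_ops V" and T: "T \<in> bounded_ops V"
  shows "op_add S T \<in> bounded_ops V" and "op_norm V (op_add S T) \<le> op_norm V S + op_norm V T"
proof -
  have b: "ell2_norm V (op_add S T f) \<le> (op_norm V S + op_norm V T) * ell2_norm V f" if "f \<in> ell2 V" for f
    unfolding op_add_def
    using ell2_add(2)[OF bounded_opsD(1)[OF S that] bounded_opsD(1)[OF T that]]
      op_norm_bound[OF S that] op_norm_bound[OF T that] by (simp add: distrib_right)
  show "op_add S T \<in> bounded_ops V"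
    by (rule bounded_opsI[OF _ _ _ _ b])
      (simp_all add: op_add_def bounded_opsD[OF T] bounded_opsD[OF S] ell2_add algebra_simps)
  show "op_norm V (op_add S T) \<le> op_norm V S + op_norm V T"
    by (rule op_norm_le[OF _ b]) (simp_all add: op_norm_nonneg S T)
qed

lemma op_diff_eq: "op_diff S T = op_add S (op_scale (-1) T)"
  by (simp add: op_diff_def op_add_def op_scale_def)

lemma op_diff_bounded:
  assumes S: "S \<in> bounded_ops V" and T: "T \<in> bounded_ops V"
  shows "op_diff S T \<in> bounded_ops V"
  unfolding op_diff_eq using assms by (intro op_add_bounded op_scale_bounded)

lemma op_norm_diff_commute: "op_norm V (op_diff S T) = op_norm V (op_diff T S)"
  unfolding op_norm_def op_diff_def by (subst ell2_norm_minus_commute) (rule refl)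

lemma op_norm_diff_triangle:
  assumes "R \<in> bounded_ops V" "S \<in> bounded_ops V" "T \<in> bounded_ops V"
  shows "op_norm V (op_diff R T) \<le> op_norm V (op_diff R S) + op_norm V (op_diff S T)"
proof -
  have "op_diff R T = op_add (op_diff R S) (op_diff S T)"
    by (simp add: op_diff_def op_add_def)
  then show ?thesis using op_add_bounded(2) op_diff_bounded assms by metis
qed

lemma op_comp_bounded:
  assumes S: "S \<in> bounded_ops V" and T: "T \<in> bounded_ops V"
  shows "S \<circ> T \<in> bounded_ops V" and "op_norm V (S \<circ> T) \<le> op_norm V S * op_norm V T"
proof -
  have b: "ell2_norm V ((S \<circ> T) f) \<le> (op_norm V S * op_norm V T) * ell2_norm V f" if "f \<in> ell2 V" for f
  proof -
    have "ell2_norm V (S (T f)) \<le> op_norm V S * ell2_norm V (T f)"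
      by (rule op_norm_bound[OF S bounded_opsD(1)[OF T that]])
    also have "\<dots> \<le> op_norm V S * (op_norm V T * ell2_norm V f)"
      by (intro mult_left_mono op_norm_bound op_norm_nonneg that S T)
    finally show ?thesis by (simp add: mult.assoc)
  qed
  have "S (\<lambda>_. 0) = (\<lambda>_. 0)" using bounded_opsD(4)[OF S ell2_zero(1), of 0] by simp
  then show "S \<circ> T \<in> bounded_ops V"
    by (intro bounded_opsI[OF _ _ _ _ b])
      (simp_all add: bounded_opsD[OF T] bounded_opsD[OF S])
  show "op_norm V (S \<circ> T) \<le> op_norm V S * op_norm V T"
    by (rule op_norm_le[OF _ b]) (simp_all add: op_norm_nonneg S T)
qed

section \<open>Basis vectors, finite truncations and adjoints\<close>

definition ket :: "'v \<Rightarrow> 'v \<Rightarrow> complex" where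
  "ket x = (\<lambda>v. if v = x then 1 else 0)"

lemma ket_ell2: "x \<in> V \<Longrightarrow> ket x \<in> ell2 V"
proof -
  assume x: "x \<in> V"
  have "(\<lambda>v. (cmod (ket x v))\<^sup>2) summable_on V"
  proof (subst summable_on_cong_neutral[where T="{x}" and g="\<lambda>v. (cmod (ket x v))\<^sup>2"])
    show "(\<lambda>v. (cmod (ket x v))\<^sup>2) summable_on {x}" by simp
  qed (use x in \<open>auto simp: ket_def\<close>)
  then show ?thesis using x by (auto simp: ell2_def ket_def)
qed

lemma ell2_restrict:
  assumes "f \<in> ell2 V"
  shows "(\<lambda>x. if x \<in> E then f x else 0) \<in> ell2 V"
    and "ell2_norm V (\<lambda>x. if x \<in> E then f x else 0) \<le> ell2_norm V f"
  by (rule ell2_dominated[OF assms]; use assms in \<open>auto simp: ell2_def\<close>)+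

lemma ket_expansion:
  "finite E \<Longrightarrow> (\<lambda>v. if v \<in> E then f v else 0) = (\<lambda>v. \<Sum>x\<in>E. f x * ket x v)"
  by (auto simp: ket_def if_distrib[of "(*) _"] sum.delta' cong: if_cong)

lemma ell2_restrict_finite:
  assumes "finite E" "E \<subseteq> V"
  shows "(\<lambda>v. if v \<in> E then f v else 0) \<in> ell2 V"
    and "ell2_norm V (\<lambda>v. if v \<in> E then f v else 0) = L2_set (\<lambda>x. cmod (f x)) E"
proof -
  show "(\<lambda>v. if v \<in> E then f v else 0) \<in> ell2 V"
    unfolding ket_expansion[OF assms(1)]
    by (rule ell2_sum[THEN conjunct1]) (use assms in \<open>auto intro!: ell2_scale ket_ell2\<close>)
  have "(\<Sum>\<^sub>\<infinity>x\<in>V. (cmod (if x \<in> E then f x else 0))\<^sup>2) = (\<Sum>\<^sub>\<infinity>x\<in>E. (cmod (f x))\<^sup>2)"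
    using assms by (intro infsum_cong_neutral) auto
  then show "ell2_norm V (\<lambda>v. if v \<in> E then f v else 0) = L2_set (\<lambda>x. cmod (f x)) E"
    using assms unfolding ell2_norm_def L2_set_def by simp
qed

lemma bounded_ops_restrict_finite:
  assumes T: "T \<in> bounded_ops V" and "finite E" "E \<subseteq> V"
  shows "T (\<lambda>v. if v \<in> E then f v else 0) = (\<lambda>v. \<Sum>x\<in>E. f x * T (ket x) v)"
proof -
  have "T (\<lambda>v. if v \<in> E then f v else 0) = (\<lambda>v. \<Sum>x\<in>E. T (\<lambda>v. f x * ket x v) v)"
    unfolding ket_expansion[OF assms(2)]
    by (rule bounded_ops_sum[OF T]) (use assms in \<open>auto intro!: ell2_scale ket_ell2\<close>)
  also have "\<dots> = (\<lambda>v. \<Sum>x\<in>E. f x * T (ket x) v)"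
    using assms by (intro ext sum.cong refl) (auto simp: bounded_opsD(4)[OF T ket_ell2])
  finally show ?thesis .
qed

lemma ell2_inner_sum_left:
  assumes "\<And>i. i \<in> I \<Longrightarrow> f i \<in> ell2 V" "g \<in> ell2 V"
  shows "ell2_inner V (\<lambda>x. \<Sum>i\<in>I. f i x) g = (\<Sum>i\<in>I. ell2_inner V (f i) g)"
  using assms(1)
proof (induction I rule: infinite_finite_induct)
  case (insert i I)
  then show ?case
    using ell2_inner_add_left[of "f i" V "\<lambda>x. \<Sum>i\<in>I. f i x" g] ell2_sum[of I f V] assms(2) by auto
qed (auto simp: ell2_inner_def)

text \<open>Finite truncations converge in norm, so an identity verified on finitely supported
  vectors extends by continuity; \<open>op_adjoint_exists\<close> uses it this way.\<close>

lemma ell2_tail_tendsto_0: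
  assumes "f \<in> ell2 V"
  shows "((\<lambda>E. ell2_norm V (\<lambda>x. f x - (if x \<in> E then f x else 0))) \<longlongrightarrow> 0) (finite_subsets_at_top V)"
proof -
  let ?s = "\<lambda>x. (cmod (f x))\<^sup>2"
  have sm: "?s summable_on V" using assms by (simp add: ell2_def)
  have eq: "ell2_norm V (\<lambda>x. f x - (if x \<in> E then f x else 0)) = sqrt (infsum ?s V - sum ?s E)"
    if "finite E" "E \<subseteq> V" for E
  proof -
    have "(\<Sum>\<^sub>\<infinity>x\<in>V. (cmod (f x - (if x \<in> E then f x else 0)))\<^sup>2) = infsum ?s (V - E)"
      by (intro infsum_cong_neutral) auto
    also have "\<dots> = infsum ?s V - infsum ?s E"
      by (rule infsum_Diff) (use that sm in auto)
    finally show ?thesis using that unfolding ell2_norm_def by simp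
  qed
  have "(sum ?s \<longlongrightarrow> infsum ?s V) (finite_subsets_at_top V)"
    using has_sum_infsum[OF sm] by (simp add: has_sum_def)
  then have "((\<lambda>E. sqrt (infsum ?s V - sum ?s E)) \<longlongrightarrow> sqrt (infsum ?s V - infsum ?s V))
      (finite_subsets_at_top V)"
    by (intro tendsto_intros)
  then have lim: "((\<lambda>E. sqrt (infsum ?s V - sum ?s E)) \<longlongrightarrow> 0) (finite_subsets_at_top V)" by simp
  show ?thesis
    by (rule Lim_transform_eventually[OF lim eventually_finite_subsets_at_top_weakI]) (rule eq[symmetric])
qed

text \<open>The adjoint is written down from the matrix coefficients of T. The adjoint relation
  holds for finitely supported f by linearity and for all f because T is bounded on the tail of f.
  Existence is needed for norm limits of local kernels, whose adjoints are not given by a kernel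
  formula.\<close>

lemma op_adjoint_exists:
  assumes T: "T \<in> bounded_ops V"
  obtains S where "S \<in> bounded_ops V" "is_op_adjoint V T S"
proof -
  define S where "S g = (\<lambda>x. if g \<in> ell2 V \<and> x \<in> V then ell2_inner V g (T (ket x)) else 0)" for g
  obtain C where C: "0 \<le> C" "\<And>f. f \<in> ell2 V \<Longrightarrow> ell2_norm V (T f) \<le> C * ell2_norm V f"
    using bounded_ops_bounded[OF T] by blast
  have Tk: "T (ket x) \<in> ell2 V" if "x \<in> V" for x using bounded_opsD(1)[OF T ket_ell2[OF that]] .
  have fin: "ell2_inner V (T (\<lambda>v. if v \<in> E then f v else 0)) g = (\<Sum>x\<in>E. f x * cnj (S g x))"
    if E: "finite E" "E \<subseteq> V" and g: "g \<in> ell2 V" for E f g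
  proof -
    have "ell2_inner V (T (\<lambda>v. if v \<in> E then f v else 0)) g
        = ell2_inner V (\<lambda>v. \<Sum>x\<in>E. f x * T (ket x) v) g"
      by (simp only: bounded_ops_restrict_finite[OF T E])
    also have "\<dots> = (\<Sum>x\<in>E. ell2_inner V (\<lambda>v. f x * T (ket x) v) g)"
      using E by (intro ell2_inner_sum_left[OF _ g]) (auto intro!: ell2_scale Tk)
    also have "\<dots> = (\<Sum>x\<in>E. f x * ell2_inner V (T (ket x)) g)"
      by (simp only: ell2_inner_scale_left)
    also have "\<dots> = (\<Sum>x\<in>E. f x * cnj (S g x))"
      using E g by (auto intro!: sum.cong simp: S_def simp flip: ell2_inner_commute)
    finally show ?thesis .
  qed
  have Sg: "S g \<in> ell2 V \<and> ell2_norm V (S g) \<le> C * ell2_norm V g" if g: "g \<in> ell2 V" for g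
  proof (rule ell2_I_finite_L2)
    fix E assume E: "finite E" "E \<subseteq> V"
    \<comment> \<open>The truncation of \<open>S g\<close> serves as its own test vector: its
      squared norm is the pairing of \<open>T ?h\<close> with g, at most C times the norms of
      \<open>?h\<close> and g, and one factor cancels.\<close>
    let ?h = "\<lambda>v. if v \<in> E then S g v else 0"
    let ?l = "L2_set (\<lambda>x. cmod (S g x)) E"
    note h = ell2_restrict_finite[OF E, of "S g"]
    have "complex_of_real (?l\<^sup>2) = (\<Sum>x\<in>E. S g x * cnj (S g x))"
      by (simp add: L2_set_def sum_nonneg flip: complex_norm_square of_real_power)
    also have "\<dots> = ell2_inner V (T ?h) g" using fin[OF E g] by simp
    finally have "complex_of_real (?l\<^sup>2) = ell2_inner V (T ?h) g" .
    then have "\<bar>?l\<^sup>2\<bar> = cmod (ell2_inner V (T ?h) g)" by (metis norm_of_real)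
    then have "?l\<^sup>2 \<le> ell2_norm V (T ?h) * ell2_norm V g"
      using ell2_Cauchy_Schwarz[OF bounded_opsD(1)[OF T h(1)] g] by simp
    also have "\<dots> \<le> (C * ?l) * ell2_norm V g"
      using C(2)[OF h(1)] unfolding h(2) by (intro mult_right_mono) auto
    finally have "?l * ?l \<le> ?l * (C * ell2_norm V g)" by (simp add: power2_eq_square algebra_simps)
    then show "?l \<le> C * ell2_norm V g"
      using C(1) L2_set_nonneg[of "\<lambda>x. cmod (S g x)" E]
      by (cases "?l = 0") (auto simp: mult_le_cancel_left)
  qed (use C in \<open>auto simp: S_def\<close>)
  have "S \<in> bounded_ops V"
  proof (rule bounded_opsI)
    fix f g c assume f: "f \<in> ell2 V"
    show "S f \<in> ell2 V" "ell2_norm V (S f) \<le> C * ell2_norm V f" using Sg[OF f] by auto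
    show "S (\<lambda>x. c * f x) = (\<lambda>x. c * S f x)"
      using f by (auto simp: S_def ell2_scale ell2_inner_scale_left)
    assume g: "g \<in> ell2 V"
    show "S (\<lambda>x. f x + g x) = (\<lambda>x. S f x + S g x)"
      using f g by (auto simp: S_def ell2_add ell2_inner_add_left Tk)
  qed (auto simp: S_def)
  moreover have "is_op_adjoint V T S"
    unfolding is_op_adjoint_def
  proof (intro ballI)
    fix f g assume f: "f \<in> ell2 V" and g: "g \<in> ell2 V"
    let ?r = "\<lambda>E v. if v \<in> E then f v else 0"
    have bd: "cmod (ell2_inner V (T f) g - (\<Sum>x\<in>E. f x * cnj (S g x)))
        \<le> ell2_norm V (\<lambda>x. f x - ?r E x) * (C * ell2_norm V g)" if E: "finite E" "E \<subseteq> V" for E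
    proof -
      note r = ell2_restrict_finite(1)[OF E, of f]
      note d = ell2_diff(1)[OF f r]
      have "ell2_inner V (T f) g - (\<Sum>x\<in>E. f x * cnj (S g x)) = ell2_inner V (T (\<lambda>x. f x - ?r E x)) g"
        unfolding bounded_ops_diff[OF T f r]
        by (simp add: ell2_inner_diff_left bounded_opsD(1)[OF T] f r g fin[OF E g])
      then have "cmod (ell2_inner V (T f) g - (\<Sum>x\<in>E. f x * cnj (S g x)))
          \<le> ell2_norm V (T (\<lambda>x. f x - ?r E x)) * ell2_norm V g"
        using ell2_Cauchy_Schwarz[OF bounded_opsD(1)[OF T d] g] by simp
      also have "\<dots> \<le> (C * ell2_norm V (\<lambda>x. f x - ?r E x)) * ell2_norm V g"
        by (intro mult_right_mono C(2)[OF d]) auto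
      finally show ?thesis by (simp add: algebra_simps)
    qed
    have "((\<lambda>E. ell2_norm V (\<lambda>x. f x - ?r E x) * (C * ell2_norm V g)) \<longlongrightarrow> 0) (finite_subsets_at_top V)"
      using tendsto_mult_right[OF ell2_tail_tendsto_0[OF f], of "C * ell2_norm V g"] by simp
    then have "((\<lambda>E. ell2_inner V (T f) g - (\<Sum>x\<in>E. f x * cnj (S g x))) \<longlongrightarrow> 0) (finite_subsets_at_top V)"
      by (rule Lim_null_comparison[rotated]) (intro eventually_finite_subsets_at_top_weakI bd)
    then have "((\<lambda>E. \<Sum>x\<in>E. f x * cnj (S g x)) \<longlongrightarrow> ell2_inner V (T f) g) (finite_subsets_at_top V)"
      using tendsto_diff[OF tendsto_const[of "ell2_inner V (T f) g"]] by fastforce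
    then have "((\<lambda>x. f x * cnj (S g x)) has_sum ell2_inner V (T f) g) V"
      by (simp add: has_sum_def)
    then show "ell2_inner V (T f) g = ell2_inner V f (S g)"
      unfolding ell2_inner_def by (simp add: infsumI)
  qed
  ultimately show ?thesis using that by blast
qed

text \<open>The squared norm of \<open>S f\<close> is the inner product of \<open>T (S f)\<close>
  with f; Cauchy-Schwarz and cancelling one factor give the bound. Applied to differences, it turns
  an approximation of an operator into one of its adjoint.\<close>

lemma op_norm_adjoint_le:
  assumes T: "T \<in> bounded_ops V" and S: "S \<in> bounded_ops V" and a: "is_op_adjoint V T S"
  shows "op_norm V S \<le> op_norm V T"
proof (rule op_norm_le[OF op_norm_nonneg[OF T]])
  fix f assume f: "f \<in> ell2 V"
  note Sf = bounded_opsD(1)[OF S f]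
  let ?n = "ell2_norm V (S f)"
  have "complex_of_real (?n\<^sup>2) = ell2_inner V (T (S f)) f"
    using a f Sf unfolding is_op_adjoint_def by (metis ell2_inner_self)
  then have "\<bar>?n\<^sup>2\<bar> = cmod (ell2_inner V (T (S f)) f)" by (metis norm_of_real)
  then have "?n\<^sup>2 \<le> ell2_norm V (T (S f)) * ell2_norm V f"
    using ell2_Cauchy_Schwarz[OF bounded_opsD(1)[OF T Sf] f] by simp
  also have "\<dots> \<le> (op_norm V T * ?n) * ell2_norm V f"
    by (intro mult_right_mono op_norm_bound[OF T Sf]) auto
  finally have "?n * ?n \<le> ?n * (op_norm V T * ell2_norm V f)" by (simp add: power2_eq_square algebra_simps)
  then show "?n \<le> op_norm V T * ell2_norm V f"
    using op_norm_nonneg[OF T] ell2_norm_nonneg[of V "S f"]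
    by (cases "?n = 0") (auto simp: mult_le_cancel_left)
qed

section \<open>Norm closures of operator algebras\<close>

lemma op_adjoint_diff:
  assumes "S \<in> bounded_ops V" "S' \<in> bounded_ops V" "T \<in> bounded_ops V" "T' \<in> bounded_ops V"
    and "is_op_adjoint V S S'" "is_op_adjoint V T T'"
  shows "is_op_adjoint V (op_diff S T) (op_diff S' T')"
  using assms unfolding is_op_adjoint_def op_diff_def
  by (simp add: ell2_inner_diff_left ell2_inner_diff_right bounded_opsD(1))

lemma op_closure_subset: "A \<subseteq> bounded_ops V \<Longrightarrow> A \<subseteq> op_closure V A"
proof
  fix T assume "A \<subseteq> bounded_ops V" "T \<in> A"
  moreover have "op_norm V (op_diff T T) = 0"
    using op_norm_le[of 0 V "op_diff T T"] \<open>A \<subseteq> bounded_ops V\<close> \<open>T \<in> A\<close> 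
      op_norm_nonneg[OF op_diff_bounded, of T V T] by (force simp: op_diff_def)
  ultimately show "T \<in> op_closure V A" unfolding op_closure_def by force
qed

lemma op_closure_cstar_subalgebra:
  assumes A: "A \<subseteq> bounded_ops V" "A \<noteq> {}"
    and add: "\<And>S T. S \<in> A \<Longrightarrow> T \<in> A \<Longrightarrow> op_add S T \<in> A"
    and comp: "\<And>S T. S \<in> A \<Longrightarrow> T \<in> A \<Longrightarrow> S \<circ> T \<in> A"
    and scale: "\<And>c T. T \<in> A \<Longrightarrow> op_scale c T \<in> A"
    and adj: "\<And>T. T \<in> A \<Longrightarrow> \<exists>S\<in>A. is_op_adjoint V T S"
  shows "cstar_subalgebra V (op_closure V A)"
proof -
  let ?B = "op_closure V A"
  have bd: "T \<in> bounded_ops V" if "T \<in> ?B" for T using that by (simp add: op_closure_def)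
  have bA: "T \<in> bounded_ops V" if "T \<in> A" for T using that A by auto
  have approx: "\<exists>S\<in>A. op_norm V (op_diff T S) < e" if "T \<in> ?B" "e > 0" for T e
    using that by (simp add: op_closure_def)
  have BI: "T \<in> ?B" if "T \<in> bounded_ops V" "\<And>e. e > 0 \<Longrightarrow> \<exists>S\<in>A. op_norm V (op_diff T S) < e" for T
    using that by (simp add: op_closure_def)
  have closure_add: "op_add S T \<in> ?B" if S: "S \<in> ?B" and T: "T \<in> ?B" for S T
  proof (rule BI)
    show "op_add S T \<in> bounded_ops V" using bd S T by (intro op_add_bounded)
    fix e :: real assume "e > 0"
    then obtain S' T' where *: "S' \<in> A" "op_norm V (op_diff S S') < e/2" "T' \<in> A" "op_norm V (op_diff T T') < e/2"
      using approx[OF S, of "e/2"] approx[OF T, of "e/2"] by auto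
    have eq: "op_diff (op_add S T) (op_add S' T') = op_add (op_diff S S') (op_diff T T')"
      by (simp add: op_diff_def op_add_def algebra_simps)
    have "op_norm V (op_diff (op_add S T) (op_add S' T')) \<le> op_norm V (op_diff S S') + op_norm V (op_diff T T')"
      unfolding eq by (intro op_add_bounded op_diff_bounded) (use bd bA S T * in auto)
    then show "\<exists>R\<in>A. op_norm V (op_diff (op_add S T) R) < e" using * add by force
  qed
  have closure_comp: "S \<circ> T \<in> ?B" if S: "S \<in> ?B" and T: "T \<in> ?B" for S T
  proof (rule BI)
    note Sb = bd[OF S] and Tb = bd[OF T]
    show "S \<circ> T \<in> bounded_ops V" using Sb Tb by (intro op_comp_bounded)
    fix e :: real assume e: "e > 0"
    define N where "N = op_norm V S + op_norm V T + 1"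
    have N: "N \<ge> 1" "op_norm V S \<le> N" "op_norm V T + 1 \<le> N"
      using op_norm_nonneg[OF Sb] op_norm_nonneg[OF Tb] by (auto simp: N_def)
    \<comment> \<open>The bound 1 keeps the norm of the approximant T' below N; the bound e / (2 N)
      makes each of the two telescoped error terms smaller than e / 2.\<close>
    define d where "d = min 1 (e / (2 * N))"
    have d: "0 < d" "d \<le> 1" "2 * N * d \<le> e"
      using e N by (auto simp: d_def min_def field_simps)
    obtain T' where T': "T' \<in> A" "op_norm V (op_diff T T') < d" using approx[OF T d(1)] by auto
    obtain S' where S': "S' \<in> A" "op_norm V (op_diff S S') < d" using approx[OF S d(1)] by auto
    note T'b = bA[OF T'(1)] and S'b = bA[OF S'(1)]
    have "T' = op_add T (op_diff T' T)" by (simp add: op_add_def op_diff_def)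
    then have "op_norm V T' \<le> op_norm V T + op_norm V (op_diff T' T)"
      using op_add_bounded(2)[OF Tb op_diff_bounded[OF T'b Tb]] by simp
    then have nT': "op_norm V T' \<le> N" using T' N d by (simp add: op_norm_diff_commute[of V T'])
    \<comment> \<open>Telescoping: ST - S'T' = S(T - T') + (S - S')T'. Operators are total
      functions, so vectors outside \<open>ell2 V\<close> need a separate check, resting on T and T'
      vanishing there and S fixing zero.\<close>
    have "op_diff (S \<circ> T) (S' \<circ> T') f = op_add (S \<circ> op_diff T T') (op_diff S S' \<circ> T') f" for f
    proof (cases "f \<in> ell2 V")
      case True
      then show ?thesis
        using bounded_ops_diff[OF Sb bounded_opsD(1)[OF Tb True] bounded_opsD(1)[OF T'b True]]
        by (simp add: op_add_def op_diff_def)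
    next
      case False
      have "S (\<lambda>_. 0) = (\<lambda>_. 0)" using bounded_opsD(4)[OF Sb ell2_zero(1), of 0] by simp
      with False show ?thesis
        by (simp add: op_add_def op_diff_def bounded_opsD(2)[OF Tb] bounded_opsD(2)[OF T'b])
    qed
    then have "op_diff (S \<circ> T) (S' \<circ> T') = op_add (S \<circ> op_diff T T') (op_diff S S' \<circ> T')" by blast
    then have "op_norm V (op_diff (S \<circ> T) (S' \<circ> T'))
        \<le> op_norm V (S \<circ> op_diff T T') + op_norm V (op_diff S S' \<circ> T')"
      using op_add_bounded(2)[OF op_comp_bounded(1)[OF Sb op_diff_bounded[OF Tb T'b]]
          op_comp_bounded(1)[OF op_diff_bounded[OF Sb S'b] T'b]] by simp
    also have "\<dots> \<le> op_norm V S * op_norm V (op_diff T T') + op_norm V (op_diff S S') * op_norm V T'"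
      by (intro add_mono op_comp_bounded op_diff_bounded Sb Tb S'b T'b)
    also have "\<dots> \<le> N * op_norm V (op_diff T T') + op_norm V (op_diff S S') * N"
      using N nT' by (intro add_mono mult_left_mono mult_right_mono op_norm_nonneg op_diff_bounded Sb Tb S'b T'b) auto
    also have "\<dots> < N * d + d * N"
      using N T' S' by (intro add_strict_mono mult_strict_left_mono mult_strict_right_mono) auto
    also have "\<dots> \<le> e" using d by (simp add: algebra_simps)
    finally show "\<exists>R\<in>A. op_norm V (op_diff (S \<circ> T) R) < e" using comp[OF S'(1) T'(1)] by blast
  qed
  have closure_scale: "op_scale c T \<in> ?B" if T: "T \<in> ?B" for c T
  proof (rule BI)
    show "op_scale c T \<in> bounded_ops V" using bd T by (intro op_scale_bounded)
    fix e :: real assume e: "e > 0"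
    \<comment> \<open>The summand 1 in the denominator covers c = 0.\<close>
    then obtain S where S: "S \<in> A" "op_norm V (op_diff T S) < e / (cmod c + 1)"
      using approx[OF T, of "e / (cmod c + 1)"] by (auto simp: field_simps add_pos_nonneg)
    have eq: "op_diff (op_scale c T) (op_scale c S) = op_scale c (op_diff T S)"
      by (simp add: op_diff_def op_scale_def algebra_simps)
    have TS: "op_diff T S \<in> bounded_ops V" using bd T bA S by (intro op_diff_bounded) auto
    have "op_norm V (op_diff (op_scale c T) (op_scale c S)) \<le> cmod c * op_norm V (op_diff T S)"
      unfolding eq by (intro op_scale_bounded TS)
    also have "\<dots> \<le> (cmod c + 1) * op_norm V (op_diff T S)"
      by (intro mult_right_mono op_norm_nonneg[OF TS]) auto
    also have "\<dots> < e" using S(2) by (simp add: field_simps add_pos_nonneg)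
    finally show "\<exists>R\<in>A. op_norm V (op_diff (op_scale c T) R) < e" using S scale by blast
  qed
  have closure_adj: "\<exists>S\<in>?B. is_op_adjoint V T S" if T: "T \<in> ?B" for T
  proof -
    obtain S where S: "S \<in> bounded_ops V" "is_op_adjoint V T S"
      using op_adjoint_exists[OF bd[OF T]] .
    have "S \<in> ?B"
    proof (rule BI[OF S(1)])
      fix e :: real assume "e > 0"
      then obtain R where R: "R \<in> A" "op_norm V (op_diff T R) < e" using approx[OF T] by auto
      obtain R' where R': "R' \<in> A" "is_op_adjoint V R R'" using adj[OF R(1)] by auto
      have "op_norm V (op_diff S R') \<le> op_norm V (op_diff T R)"
        by (intro op_norm_adjoint_le op_adjoint_diff op_diff_bounded bd bA T R R' S)
      then show "\<exists>R\<in>A. op_norm V (op_diff S R) < e" using R R' by force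
    qed
    then show ?thesis using S by blast
  qed
  have closure_closed: "op_closure V ?B \<subseteq> ?B"
  proof
    fix T assume T: "T \<in> op_closure V ?B"
    then have Tb: "T \<in> bounded_ops V" by (simp add: op_closure_def)
    show "T \<in> ?B"
    proof (rule BI[OF Tb])
      fix e :: real assume "e > 0"
      then obtain S where S: "S \<in> ?B" "op_norm V (op_diff T S) < e/2"
        using T unfolding op_closure_def[of V ?B] by (auto elim!: allE[of _ "e/2"])
      obtain R where R: "R \<in> A" "op_norm V (op_diff S R) < e/2"
        using approx[OF S(1), of "e/2"] \<open>e > 0\<close> by auto
      have "op_norm V (op_diff T R) < e"
        using op_norm_diff_triangle[OF Tb bd[OF S(1)] bA[OF R(1)]] S R by linarith
      then show "\<exists>R\<in>A. op_norm V (op_diff T R) < e" using R by blast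
    qed
  qed
  have closure_sub: "?B \<subseteq> bounded_ops V" "?B \<noteq> {}" using bd op_closure_subset[OF A(1)] A(2) by auto
  show ?thesis unfolding cstar_subalgebra_def
    by (intro conjI ballI allI closure_sub closure_add closure_comp closure_scale closure_adj
        closure_closed; assumption)
qed

section \<open>Evaluation at basis vectors and exchange of finite with infinite sums\<close>

lemma infsum_nonneg_Reals:
  fixes f :: "'x \<Rightarrow> complex"
  assumes "f summable_on A" "\<And>x. x \<in> A \<Longrightarrow> f x \<in> \<real>\<^sub>\<ge>\<^sub>0"
  shows "infsum f A \<in> \<real>\<^sub>\<ge>\<^sub>0"
  using assms by (auto simp: complex_nonneg_Reals_iff simp flip: infsum_Re infsum_Im intro!: infsum_nonneg infsum_0)

lemma ell2_point_le: "f \<in> ell2 V \<Longrightarrow> x \<in> V \<Longrightarrow> cmod (f x) \<le> ell2_norm V f"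
  using ell2_finite_L2_le[of f V "{x}"] by (simp add: L2_set_def)

lemma ell2_norm_finite: "finite V \<Longrightarrow> ell2_norm V f = L2_set (\<lambda>x. cmod (f x)) V"
  by (simp add: ell2_norm_def L2_set_def)

lemma ell2_inner_finite: "finite V \<Longrightarrow> ell2_inner V f g = (\<Sum>x\<in>V. f x * cnj (g x))"
  by (simp add: ell2_inner_def)

lemma ell2_norm_ket: "x \<in> V \<Longrightarrow> ell2_norm V (ket x) = 1"
  using ell2_restrict_finite(2)[of "{x}" V "ket x"] by (simp add: ket_def L2_set_def cong: if_cong)

lemma ell2_inner_ket:
  assumes "x \<in> V"
  shows "ell2_inner V f (ket x) = f x"
proof -
  have "ell2_inner V f (ket x) = (\<Sum>\<^sub>\<infinity>y\<in>{x}. f x)"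
    unfolding ell2_inner_def using assms by (intro infsum_cong_neutral) (auto simp: ket_def)
  then show ?thesis by simp
qed

lemma kernel_op_ket:
  assumes "x \<in> V" "y \<in> V"
  shows "kernel_op V K (ket y) x = K x y"
proof -
  have "(\<Sum>\<^sub>\<infinity>z\<in>V. K x z * ket y z) = (\<Sum>\<^sub>\<infinity>z\<in>{y}. K x y)"
    using assms by (intro infsum_cong_neutral) (auto simp: ket_def)
  then show ?thesis using assms by (simp add: kernel_op_def ket_ell2)
qed

lemma has_sum_finite_sum:
  fixes f :: "'i \<Rightarrow> 'x \<Rightarrow> 'c::topological_comm_monoid_add"
  assumes "\<And>i. i \<in> I \<Longrightarrow> (f i has_sum s i) A"
  shows "((\<lambda>x. \<Sum>i\<in>I. f i x) has_sum (\<Sum>i\<in>I. s i)) A"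
  using assms by (induction I rule: infinite_finite_induct) (auto intro!: has_sum_add)

lemma summable_on_finite_sum:
  fixes f :: "'i \<Rightarrow> 'x \<Rightarrow> 'c::topological_comm_monoid_add"
  assumes "\<And>i. i \<in> I \<Longrightarrow> f i summable_on A"
  shows "(\<lambda>x. \<Sum>i\<in>I. f i x) summable_on A"
  using assms by (induction I rule: infinite_finite_induct) (auto intro!: summable_on_add)

lemma infsum_finite_sum:
  fixes f :: "'i \<Rightarrow> 'x \<Rightarrow> 'c::{topological_comm_monoid_add,t2_space}"
  assumes "\<And>i. i \<in> I \<Longrightarrow> f i summable_on A"
  shows "(\<Sum>\<^sub>\<infinity>x\<in>A. \<Sum>i\<in>I. f i x) = (\<Sum>i\<in>I. \<Sum>\<^sub>\<infinity>x\<in>A. f i x)"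
  using assms by (intro infsumI has_sum_finite_sum has_sum_infsum)


section \<open>Local kernels of a group action\<close>

text \<open>V plays the role of the coset space. Distances are replaced by finite subsets of the
  group: y is near x when a member of the subset moves x to y.\<close>

locale left_action = group G for G :: "('a, 'b) monoid_scheme" (structure) +
  fixes V :: "'v set" and act :: "'a \<Rightarrow> 'v \<Rightarrow> 'v" (infixr "\<cdot>" 75)
  assumes act_closed [simp, intro]: "g \<in> carrier G \<Longrightarrow> x \<in> V \<Longrightarrow> g \<cdot> x \<in> V"
    and act_one [simp]: "x \<in> V \<Longrightarrow> \<one> \<cdot> x = x"
    and act_mult: "g \<in> carrier G \<Longrightarrow> h \<in> carrier G \<Longrightarrow> x \<in> V \<Longrightarrow> (g \<otimes> h) \<cdot> x = g \<cdot> h \<cdot> x"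
begin

lemma act_inv [simp]:
  assumes "g \<in> carrier G" "x \<in> V"
  shows "inv g \<cdot> g \<cdot> x = x" "g \<cdot> inv g \<cdot> x = x"
  using assms act_mult[of "inv g" g x] act_mult[of g "inv g" x] by auto

lemma act_eq_iff:
  assumes "g \<in> carrier G" "x \<in> V" "y \<in> V"
  shows "g \<cdot> x = y \<longleftrightarrow> x = inv g \<cdot> y"
  using assms by auto

lemma act_bij: "g \<in> carrier G \<Longrightarrow> bij_betw ((\<cdot>) g) V V"
  by (rule bij_betw_byWitness[where f'="(\<cdot>) (inv g)"]) auto

text \<open>The points g x and h x coincide iff \<open>inv h \<otimes> g\<close> fixes x, so
  finitely many stabiliser conditions capture the shape of a labelled ball. The value type is left
  free because sets of group elements, labels and representatives must be local too, not only
  numbers.\<close>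

definition stab_local :: "('v \<Rightarrow> 'c) \<Rightarrow> bool" where
  "stab_local a \<longleftrightarrow> (\<exists>F. finite F \<and> F \<subseteq> carrier G \<and>
     (\<forall>x\<in>V. \<forall>y\<in>V. (\<forall>g\<in>F. g \<cdot> x = x \<longleftrightarrow> g \<cdot> y = y) \<longrightarrow> a x = a y))"

lemma stab_localI:
  assumes "finite F" "F \<subseteq> carrier G"
    and "\<And>x y. x \<in> V \<Longrightarrow> y \<in> V \<Longrightarrow> (\<And>g. g \<in> F \<Longrightarrow> g \<cdot> x = x \<longleftrightarrow> g \<cdot> y = y) \<Longrightarrow> a x = a y"
  shows "stab_local a"
  unfolding stab_local_def
proof (intro exI[of _ F] conjI ballI impI)
  fix x y assume "x \<in> V" "y \<in> V" "\<forall>g\<in>F. (g \<cdot> x = x) = (g \<cdot> y = y)"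
  then show "a x = a y" by (intro assms(3)) auto
qed (use assms in auto)

lemma stab_local_const: "stab_local (\<lambda>_. c)"
  by (rule stab_localI[of "{}"]) auto

lemma stab_local_comp: "stab_local a \<Longrightarrow> stab_local (\<lambda>x. k (a x))"
  unfolding stab_local_def by metis

lemma stab_local_cong:
  assumes "stab_local a" "\<And>x. x \<in> V \<Longrightarrow> a x = b x"
  shows "stab_local b"
  using assms unfolding stab_local_def by metis

text \<open>The finite test sets of the members are united, which is where finiteness of I enters.
  Packing the family into one restricted function lets sums and set comprehensions follow by
  postcomposition.\<close>

lemma stab_local_family:
  assumes "finite I" "\<And>i. i \<in> I \<Longrightarrow> stab_local (a i)"
  shows "stab_local (\<lambda>x. \<lambda>i\<in>I. a i x)"
proof -
  have "\<forall>i\<in>I. \<exists>F. finite F \<and> F \<subseteq> carrier G \<and>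
     (\<forall>x\<in>V. \<forall>y\<in>V. (\<forall>g\<in>F. g \<cdot> x = x \<longleftrightarrow> g \<cdot> y = y) \<longrightarrow> a i x = a i y)"
    using assms(2) unfolding stab_local_def by blast
  then obtain F where F: "\<And>i. i \<in> I \<Longrightarrow> finite (F i) \<and> F i \<subseteq> carrier G \<and>
     (\<forall>x\<in>V. \<forall>y\<in>V. (\<forall>g\<in>F i. g \<cdot> x = x \<longleftrightarrow> g \<cdot> y = y) \<longrightarrow> a i x = a i y)"
    by metis
  show ?thesis
  proof (rule stab_localI[of "\<Union>i\<in>I. F i"])
    fix x y assume "x \<in> V" "y \<in> V"
      "\<And>g. g \<in> (\<Union>i\<in>I. F i) \<Longrightarrow> g \<cdot> x = x \<longleftrightarrow> g \<cdot> y = y"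
    then have "a i x = a i y" if "i \<in> I" for i using F[OF that] that by blast
    then show "(\<lambda>i\<in>I. a i x) = (\<lambda>i\<in>I. a i y)" by (simp add: restrict_def fun_eq_iff)
  qed (use assms F in auto)
qed

lemma stab_local_comp2:
  assumes "stab_local a" "stab_local b"
  shows "stab_local (\<lambda>x. k (a x) (b x))"
proof -
  obtain F where F: "finite F" "F \<subseteq> carrier G"
    "\<forall>x\<in>V. \<forall>y\<in>V. (\<forall>g\<in>F. g \<cdot> x = x \<longleftrightarrow> g \<cdot> y = y) \<longrightarrow> a x = a y"
    using assms(1) unfolding stab_local_def by blast
  obtain F' where F': "finite F'" "F' \<subseteq> carrier G"
    "\<forall>x\<in>V. \<forall>y\<in>V. (\<forall>g\<in>F'. g \<cdot> x = x \<longleftrightarrow> g \<cdot> y = y) \<longrightarrow> b x = b y"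
    using assms(2) unfolding stab_local_def by blast
  show ?thesis
  proof (rule stab_localI[of "F \<union> F'"])
    fix x y assume xy: "x \<in> V" "y \<in> V" "\<And>g. g \<in> F \<union> F' \<Longrightarrow> g \<cdot> x = x \<longleftrightarrow> g \<cdot> y = y"
    have "a x = a y" by (intro F(3)[rule_format] xy) simp
    moreover have "b x = b y" by (intro F'(3)[rule_format] xy) simp
    ultimately show "k (a x) (b x) = k (a y) (b y)" by simp
  qed (use F F' in auto)
qed

lemma stab_local_sum:
  assumes "finite I" "\<And>i. i \<in> I \<Longrightarrow> stab_local (a i)"
  shows "stab_local (\<lambda>x. \<Sum>i\<in>I. a i x)"
  by (rule stab_local_cong[OF stab_local_comp[OF stab_local_family[OF assms], where k="\<lambda>f. sum f I"]])
    (auto intro: sum.cong)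

lemma stab_local_Collect:
  assumes "finite I" "\<And>i. i \<in> I \<Longrightarrow> stab_local (P i)"
  shows "stab_local (\<lambda>x. {i \<in> I. P i x})"
  by (rule stab_local_cong[OF stab_local_comp[OF stab_local_family[OF assms], where k="\<lambda>f. {i \<in> I. f i}"]])
    auto

text \<open>Stabilisers are conjugated along orbits: f fixes g x iff
  \<open>inv g \<otimes> f \<otimes> g\<close> fixes x, so conjugating the test set
  suffices.\<close>

lemma stab_local_act:
  assumes "stab_local a" "g \<in> carrier G"
  shows "stab_local (\<lambda>x. a (g \<cdot> x))"
proof -
  obtain F where F: "finite F" "F \<subseteq> carrier G"
    "\<forall>x\<in>V. \<forall>y\<in>V. (\<forall>g\<in>F. g \<cdot> x = x \<longleftrightarrow> g \<cdot> y = y) \<longrightarrow> a x = a y"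
    using assms(1) unfolding stab_local_def by blast
  show ?thesis
  proof (rule stab_localI[of "(\<lambda>f. inv g \<otimes> f \<otimes> g) ` F"])
    fix x y assume xy: "x \<in> V" "y \<in> V"
      and eq: "\<And>k. k \<in> (\<lambda>f. inv g \<otimes> f \<otimes> g) ` F \<Longrightarrow> k \<cdot> x = x \<longleftrightarrow> k \<cdot> y = y"
    have "(inv g \<otimes> f \<otimes> g) \<cdot> z = z \<longleftrightarrow> f \<cdot> g \<cdot> z = g \<cdot> z" if "f \<in> F" "z \<in> V" for f z
    proof -
      have "(inv g \<otimes> f \<otimes> g) \<cdot> z = inv g \<cdot> f \<cdot> g \<cdot> z"
        using that F assms(2) by (simp add: act_mult subset_iff)
      then show ?thesis using that F assms(2) act_eq_iff[of "inv g" "f \<cdot> g \<cdot> z" z] by auto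
    qed
    then have "f \<cdot> g \<cdot> x = g \<cdot> x \<longleftrightarrow> f \<cdot> g \<cdot> y = g \<cdot> y" if "f \<in> F" for f
      using eq[of "inv g \<otimes> f \<otimes> g"] xy that by blast
    then show "a (g \<cdot> x) = a (g \<cdot> y)"
      using xy assms(2) by (intro F(3)[rule_format]) auto
  qed (use F assms(2) in auto)
qed

text \<open>The pair (g x, h x) has base point g x and displacement
  \<open>h \<otimes> inv g\<close>. Locality at the base x for every displacement therefore gives
  locality when both arguments move with x.\<close>

lemma stab_local_pair:
  assumes "\<And>g. g \<in> carrier G \<Longrightarrow> stab_local (\<lambda>x. \<Xi> x (g \<cdot> x))" "g \<in> carrier G" "h \<in> carrier G"
  shows "stab_local (\<lambda>x. \<Xi> (g \<cdot> x) (h \<cdot> x))"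
proof -
  have "stab_local (\<lambda>x. \<Xi> x ((h \<otimes> inv g) \<cdot> x))" using assms by simp
  from stab_local_act[OF this assms(2)] show ?thesis
    by (rule stab_local_cong) (use assms in \<open>simp add: act_mult\<close>)
qed

lemma stab_local_eq:
  assumes "g \<in> carrier G" "h \<in> carrier G"
  shows "stab_local (\<lambda>x. g \<cdot> x = h \<cdot> x)"
proof (rule stab_localI[of "{inv h \<otimes> g}"])
  fix x y assume xy: "x \<in> V" "y \<in> V"
    and eq: "\<And>k. k \<in> {inv h \<otimes> g} \<Longrightarrow> k \<cdot> x = x \<longleftrightarrow> k \<cdot> y = y"
  have "g \<cdot> z = h \<cdot> z \<longleftrightarrow> (inv h \<otimes> g) \<cdot> z = z" if "z \<in> V" for z
    using assms that act_eq_iff[of "inv h" "g \<cdot> z" z] by (simp add: act_mult)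
  then show "(g \<cdot> x = h \<cdot> x) = (g \<cdot> y = h \<cdot> y)" using eq xy by auto
qed (use assms in auto)

text \<open>A labelled ball shows which of its points g x coincide; this rule accepts that form of
  the hypothesis and converts it into stabiliser conditions.\<close>

lemma stab_local_pairsI:
  assumes A: "finite A" "A \<subseteq> carrier G"
    and eq: "\<And>x y. x \<in> V \<Longrightarrow> y \<in> V \<Longrightarrow>
      (\<And>g h. g \<in> A \<Longrightarrow> h \<in> A \<Longrightarrow> g \<cdot> x = h \<cdot> x \<longleftrightarrow> g \<cdot> y = h \<cdot> y) \<Longrightarrow> a x = a y"
  shows "stab_local a"
proof (rule stab_localI[of "(\<lambda>(g, h). inv g \<otimes> h) ` (A \<times> A)"])
  fix x y assume xy: "x \<in> V" "y \<in> V"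
    and F: "\<And>k. k \<in> (\<lambda>(g, h). inv g \<otimes> h) ` (A \<times> A) \<Longrightarrow> k \<cdot> x = x \<longleftrightarrow> k \<cdot> y = y"
  have *: "g \<cdot> z = h \<cdot> z \<longleftrightarrow> (inv g \<otimes> h) \<cdot> z = z" if "g \<in> A" "h \<in> A" "z \<in> V" for g h z
    using that A(2) act_eq_iff[of g z "h \<cdot> z"] by (auto simp: act_mult subset_iff)
  show "a x = a y"
  proof (rule eq[OF xy])
    fix g h assume gh: "g \<in> A" "h \<in> A"
    have "inv g \<otimes> h \<in> (\<lambda>(g, h). inv g \<otimes> h) ` (A \<times> A)" using gh by force
    then show "g \<cdot> x = h \<cdot> x \<longleftrightarrow> g \<cdot> y = h \<cdot> y"
      using F *[OF gh xy(1)] *[OF gh xy(2)] by simp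
  qed
qed (use A in auto)

text \<open>The function factors through the set of members of F fixing x, and F has finitely many
  subsets. This makes local kernels bounded and leaves only finitely many representatives.\<close>

lemma stab_local_finite_range:
  assumes "stab_local a"
  shows "finite (a ` V)"
proof -
  obtain F where F: "finite F" "F \<subseteq> carrier G"
    "\<forall>x\<in>V. \<forall>y\<in>V. (\<forall>g\<in>F. g \<cdot> x = x \<longleftrightarrow> g \<cdot> y = y) \<longrightarrow> a x = a y"
    using assms(1) unfolding stab_local_def by blast
  let ?t = "\<lambda>x. {g \<in> F. g \<cdot> x = x}"
  have "a x = a (inv_into V ?t (?t x))" if x: "x \<in> V" for x
  proof (rule F(3)[rule_format])
    have *: "?t x \<in> ?t ` V" using x by blast
    show "inv_into V ?t (?t x) \<in> V" by (rule inv_into_into[OF *])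
    show "(g \<cdot> x = x) = (g \<cdot> inv_into V ?t (?t x) = inv_into V ?t (?t x))" if "g \<in> F" for g
      using f_inv_into_f[OF *] that by blast
  qed (rule x)
  then have "a ` V \<subseteq> (\<lambda>s. a (inv_into V ?t s)) ` ?t ` V" by blast
  moreover have "finite (?t ` V)" by (rule finite_subset[of _ "Pow F"]) (use F in auto)
  ultimately show ?thesis using finite_subset by blast
qed

section \<open>Finite symmetric sets as radii, and sums over neighbourhoods\<close>

definition sym_fin :: "'a set \<Rightarrow> bool" where
  "sym_fin P \<longleftrightarrow> finite P \<and> P \<subseteq> carrier G \<and> \<one> \<in> P \<and> (\<forall>g\<in>P. inv g \<in> P)"

lemma sym_finD:
  assumes "sym_fin P"
  shows "finite P" "g \<in> P \<Longrightarrow> g \<in> carrier G" "\<one> \<in> P" "g \<in> P \<Longrightarrow> inv g \<in> P"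
  using assms by (auto simp: sym_fin_def)

lemma sym_fin_exists:
  assumes "finite P" "P \<subseteq> carrier G"
  obtains P' where "sym_fin P'" "P \<subseteq> P'"
proof -
  have "sym_fin (insert \<one> (P \<union> m_inv G ` P))"
    using assms unfolding sym_fin_def by (auto simp: subset_iff)
  then show ?thesis using that by blast
qed

text \<open>The ball around x with the group subset P in place of a radius; symmetry of P makes
  nearness a symmetric relation.\<close>

definition nbhd :: "'a set \<Rightarrow> 'v \<Rightarrow> 'v set" where
  "nbhd P x = (\<lambda>g. g \<cdot> x) ` P"

lemma nbhd_finite: "sym_fin P \<Longrightarrow> finite (nbhd P x)"
  by (simp add: nbhd_def sym_finD)

lemma nbhd_subset: "sym_fin P \<Longrightarrow> x \<in> V \<Longrightarrow> y \<in> nbhd P x \<Longrightarrow> y \<in> V"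
  by (auto simp: nbhd_def sym_finD)

lemma nbhd_sym:
  assumes "sym_fin P" "x \<in> V" "y \<in> nbhd P x"
  shows "x \<in> nbhd P y"
proof -
  obtain g where "g \<in> P" "y = g \<cdot> x" using assms(3) by (auto simp: nbhd_def)
  then show ?thesis using sym_finD[OF assms(1)] assms(2)
    by (auto simp: nbhd_def intro!: image_eqI[of _ _ "inv g"])
qed

definition orbit_mult :: "'a set \<Rightarrow> 'v \<Rightarrow> 'v \<Rightarrow> nat" where
  "orbit_mult P x y = card {h \<in> P. h \<cdot> x = y}"

lemma orbit_mult_pos:
  assumes "sym_fin P" "g \<in> P"
  shows "orbit_mult P x (g \<cdot> x) \<ge> 1"
proof -
  have "{h \<in> P. h \<cdot> x = g \<cdot> x} \<noteq> {}" using assms by auto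
  then show ?thesis using assms unfolding orbit_mult_def by (simp add: Suc_le_eq card_gt_0_iff sym_finD(1))
qed

lemma orbit_mult_commute:
  assumes P: "sym_fin P" and "x \<in> V" "y \<in> V"
  shows "orbit_mult P x y = orbit_mult P y x"
  unfolding orbit_mult_def
proof (rule bij_betw_same_card)
  show "bij_betw (m_inv G) {h \<in> P. h \<cdot> x = y} {h \<in> P. h \<cdot> y = x}"
    by (rule bij_betw_byWitness[where f'="m_inv G"]) (use assms in \<open>auto simp: sym_finD[OF P]\<close>)
qed

text \<open>The right-hand side has an index set independent of x, so that locality and summability
  can be treated one group element at a time. The weights correct for several group elements hitting
  the same neighbour.\<close>

lemma nbhd_sum:
  fixes \<Psi> :: "'v \<Rightarrow> 'c::real_normed_field"
  assumes P: "sym_fin P"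
  shows "(\<Sum>y\<in>nbhd P x. \<Psi> y) = (\<Sum>g\<in>P. \<Psi> (g \<cdot> x) / of_nat (orbit_mult P x (g \<cdot> x)))"
proof -
  have "(\<Sum>g\<in>P. \<Psi> (g \<cdot> x) / of_nat (orbit_mult P x (g \<cdot> x)))
      = (\<Sum>y\<in>nbhd P x. \<Sum>g\<in>{g \<in> P. g \<cdot> x = y}. \<Psi> (g \<cdot> x) / of_nat (orbit_mult P x (g \<cdot> x)))"
    unfolding nbhd_def by (rule sum.image_gen) (rule sym_finD[OF P])
  also have "\<dots> = (\<Sum>y\<in>nbhd P x. \<Psi> y)"
  proof (rule sum.cong[OF refl])
    fix y assume y: "y \<in> nbhd P x"
    then have "orbit_mult P x y \<ge> 1" using orbit_mult_pos[OF P] by (auto simp: nbhd_def)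
    moreover have "(\<Sum>g\<in>{g \<in> P. g \<cdot> x = y}. \<Psi> (g \<cdot> x) / of_nat (orbit_mult P x (g \<cdot> x)))
        = (\<Sum>g\<in>{g \<in> P. g \<cdot> x = y}. \<Psi> y / of_nat (orbit_mult P x y))"
      by (rule sum.cong) auto
    ultimately show "(\<Sum>g\<in>{g \<in> P. g \<cdot> x = y}. \<Psi> (g \<cdot> x) / of_nat (orbit_mult P x (g \<cdot> x))) = \<Psi> y"
      by (simp add: orbit_mult_def)
  qed
  finally show ?thesis by simp
qed

lemma weighted_summable:
  fixes \<Phi> :: "'v \<Rightarrow> 'v \<Rightarrow> 'c::{real_normed_field,banach}"
  assumes P: "sym_fin P" and "g \<in> P" "(\<lambda>x. norm (\<Phi> x (g \<cdot> x))) summable_on V"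
  shows "(\<lambda>x. norm (\<Phi> x (g \<cdot> x) / of_nat (orbit_mult P x (g \<cdot> x)))) summable_on V"
proof (rule summable_on_comparison_test[OF assms(3)])
  fix x
  have "norm (\<Phi> x (g \<cdot> x)) / real (orbit_mult P x (g \<cdot> x)) \<le> norm (\<Phi> x (g \<cdot> x)) / 1"
    using orbit_mult_pos[OF P assms(2), of x] by (intro divide_left_mono) auto
  then show "norm (\<Phi> x (g \<cdot> x) / of_nat (orbit_mult P x (g \<cdot> x))) \<le> norm (\<Phi> x (g \<cdot> x))"
    by (simp add: norm_divide)
qed auto

lemma nbhd_sum_summable:
  fixes \<Phi> :: "'v \<Rightarrow> 'v \<Rightarrow> 'c::{real_normed_field,banach}"
  assumes P: "sym_fin P" and sm: "\<And>g. g \<in> P \<Longrightarrow> (\<lambda>x. norm (\<Phi> x (g \<cdot> x))) summable_on V"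
  shows "(\<lambda>x. \<Sum>y\<in>nbhd P x. \<Phi> x y) summable_on V"
  unfolding nbhd_sum[OF P]
  by (rule summable_on_finite_sum, rule abs_summable_summable, rule weighted_summable[where \<Phi>=\<Phi>, OF P])
    (use sm in auto)

text \<open>Every neighbour \<open>y\<close> of \<open>x\<close> is counted \<open>orbit_mult P x y = orbit_mult P y x\<close> times in the orbit
  parametrisation, so dividing by the multiplicity reduces Fubini to the bijections \<open>x \<mapsto> g \<cdot> x\<close>.\<close>

lemma nbhd_sum_swap:
  fixes \<Phi> :: "'v \<Rightarrow> 'v \<Rightarrow> 'c::{real_normed_field,banach}"
  assumes P: "sym_fin P" and sm: "\<And>g. g \<in> P \<Longrightarrow> (\<lambda>x. norm (\<Phi> x (g \<cdot> x))) summable_on V"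
  shows "(\<Sum>\<^sub>\<infinity>x\<in>V. \<Sum>y\<in>nbhd P x. \<Phi> x y) = (\<Sum>\<^sub>\<infinity>y\<in>V. \<Sum>x\<in>nbhd P y. \<Phi> x y)"
proof -
  let ?w = "\<lambda>x y. \<Phi> x y / of_nat (orbit_mult P x y)"
  note Pc = sym_finD(2)[OF P] and Pi = sym_finD(4)[OF P]
  have ws: "(\<lambda>x. ?w x (g \<cdot> x)) summable_on V" if "g \<in> P" for g
    by (rule abs_summable_summable, rule weighted_summable[where \<Phi>=\<Phi>, OF P that sm[OF that]])
  have re: "(\<lambda>y. ?w (g \<cdot> y) y) summable_on V"
    "(\<Sum>\<^sub>\<infinity>y\<in>V. ?w (g \<cdot> y) y) = (\<Sum>\<^sub>\<infinity>x\<in>V. ?w x (inv g \<cdot> x))" if g: "g \<in> P" for g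
  proof -
    have eq: "?w (g \<cdot> y) (inv g \<cdot> g \<cdot> y) = ?w (g \<cdot> y) y" if "y \<in> V" for y
      using g that Pc by simp
    have "(\<lambda>y. ?w (g \<cdot> y) (inv g \<cdot> g \<cdot> y)) summable_on V"
      using summable_on_reindex_bij_betw[OF act_bij[OF Pc[OF g]], of "\<lambda>x. ?w x (inv g \<cdot> x)"] ws[OF Pi[OF g]]
      by blast
    then show "(\<lambda>y. ?w (g \<cdot> y) y) summable_on V"
      using summable_on_cong[of V "\<lambda>y. ?w (g \<cdot> y) (inv g \<cdot> g \<cdot> y)", OF eq] by blast
    have "(\<Sum>\<^sub>\<infinity>y\<in>V. ?w (g \<cdot> y) (inv g \<cdot> g \<cdot> y)) = (\<Sum>\<^sub>\<infinity>x\<in>V. ?w x (inv g \<cdot> x))"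
      using infsum_reindex_bij_betw[OF act_bij[OF Pc[OF g]], of "\<lambda>x. ?w x (inv g \<cdot> x)"] by blast
    then show "(\<Sum>\<^sub>\<infinity>y\<in>V. ?w (g \<cdot> y) y) = (\<Sum>\<^sub>\<infinity>x\<in>V. ?w x (inv g \<cdot> x))"
      using infsum_cong[of V "\<lambda>y. ?w (g \<cdot> y) (inv g \<cdot> g \<cdot> y)", OF eq] by metis
  qed
  have "(\<Sum>\<^sub>\<infinity>x\<in>V. \<Sum>y\<in>nbhd P x. \<Phi> x y) = (\<Sum>g\<in>P. \<Sum>\<^sub>\<infinity>x\<in>V. ?w x (g \<cdot> x))"
    unfolding nbhd_sum[OF P] by (intro infsum_finite_sum ws)
  also have "\<dots> = (\<Sum>g\<in>P. \<Sum>\<^sub>\<infinity>x\<in>V. ?w x (inv g \<cdot> x))"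
    by (rule sum.reindex_bij_witness[where i="m_inv G" and j="m_inv G"]) (use Pc Pi in auto)
  also have "\<dots> = (\<Sum>g\<in>P. \<Sum>\<^sub>\<infinity>y\<in>V. ?w (g \<cdot> y) y)"
    using re(2) by simp
  also have "\<dots> = (\<Sum>\<^sub>\<infinity>y\<in>V. \<Sum>g\<in>P. ?w (g \<cdot> y) y)"
    by (intro infsum_finite_sum[symmetric] re)
  also have "\<dots> = (\<Sum>\<^sub>\<infinity>y\<in>V. \<Sum>x\<in>nbhd P y. \<Phi> x y)"
    unfolding nbhd_sum[OF P, where \<Psi>="\<lambda>x. \<Phi> x _"]
    by (intro infsum_cong sum.cong refl) (use Pc orbit_mult_commute[OF P] in auto)
  finally show ?thesis .
qed

section \<open>Kernels of finite range and their operators\<close>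

definition finite_range :: "'a set \<Rightarrow> ('v \<Rightarrow> 'v \<Rightarrow> complex) \<Rightarrow> bool" where
  "finite_range P K \<longleftrightarrow> (\<forall>x y. K x y \<noteq> 0 \<longrightarrow> x \<in> V \<and> y \<in> nbhd P x)"

lemma finite_range_mono: "finite_range P K \<Longrightarrow> P \<subseteq> P' \<Longrightarrow> finite_range P' K"
  unfolding finite_range_def nbhd_def by blast

lemma kernel_op_summable:
  assumes "sym_fin P" "finite_range P K"
  shows "(\<lambda>y. K x y * f y) summable_on V"
  by (rule finite_nonzero_values_imp_summable_on, rule finite_subset[OF _ nbhd_finite[OF assms(1), of x]])
    (use assms(2) in \<open>auto simp: finite_range_def\<close>)

lemma kernel_op_apply:
  assumes "sym_fin P" "finite_range P K" "x \<in> V" "f \<in> ell2 V"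
  shows "kernel_op V K f x = (\<Sum>y\<in>nbhd P x. K x y * f y)"
proof -
  have "(\<Sum>\<^sub>\<infinity>y\<in>V. K x y * f y) = (\<Sum>\<^sub>\<infinity>y\<in>nbhd P x. K x y * f y)"
    using assms nbhd_subset[OF assms(1)] by (intro infsum_cong_neutral) (auto simp: finite_range_def)
  then show ?thesis using assms nbhd_finite[OF assms(1)] by (simp add: kernel_op_def)
qed

lemma translate_ell2:
  assumes "g \<in> carrier G" "f \<in> ell2 V"
  shows "(\<lambda>x. if x \<in> V then f (g \<cdot> x) else 0) \<in> ell2 V"
    and "ell2_norm V (\<lambda>x. if x \<in> V then f (g \<cdot> x) else 0) = ell2_norm V f"
  using ell2_reindex[OF act_bij[OF assms(1)] assms(2)] by auto

lemma translate_product_summable: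
  assumes "g \<in> carrier G" "h \<in> carrier G" "f \<in> ell2 V" "f' \<in> ell2 V"
  shows "(\<lambda>x. cmod (f (g \<cdot> x)) * cmod (f' (h \<cdot> x))) summable_on V"
proof -
  have "(\<lambda>x. cmod (if x \<in> V then f (g \<cdot> x) else 0) * cmod (if x \<in> V then f' (h \<cdot> x) else 0)) summable_on V"
    using assms by (intro ell2_product_summable translate_ell2)
  then show ?thesis by (rule summable_on_cong[THEN iffD1, rotated]) auto
qed

text \<open>Pointwise, the image of f is dominated by c times the sum of the translates of |f| by
  members of P, and each translate has the norm of f because group elements permute V.\<close>

lemma finite_range_op_norm:
  assumes P: "sym_fin P" and K: "finite_range P K" "\<And>x y. cmod (K x y) \<le> c"
  shows "kernel_op V K \<in> bounded_ops V" "op_norm V (kernel_op V K) \<le> c * real (card P)"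
proof -
  have c: "0 \<le> c" using K(2) norm_ge_zero order_trans by blast
  have *: "kernel_op V K f \<in> ell2 V \<and> ell2_norm V (kernel_op V K f) \<le> (c * card P) * ell2_norm V f"
    if f: "f \<in> ell2 V" for f
  proof -
    define t where "t g = (\<lambda>x. complex_of_real (cmod (if x \<in> V then f (g \<cdot> x) else 0)))" for g
    have t: "t g \<in> ell2 V \<and> ell2_norm V (t g) \<le> ell2_norm V f" if g: "g \<in> P" for g
    proof -
      note tr = translate_ell2[OF sym_finD(2)[OF P g] f]
      have "t g \<in> ell2 V" "ell2_norm V (t g) \<le> ell2_norm V (\<lambda>x. if x \<in> V then f (g \<cdot> x) else 0)"
        by (rule ell2_dominated[OF tr(1)]; simp add: t_def)+
      then show ?thesis using tr(2) by simp
    qed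
    define s where "s = (\<lambda>x. complex_of_real c * (\<Sum>g\<in>P. t g x))"
    have s: "s \<in> ell2 V" "ell2_norm V s \<le> c * (\<Sum>g\<in>P. ell2_norm V f)"
    proof -
      have "(\<lambda>x. \<Sum>g\<in>P. t g x) \<in> ell2 V \<and> ell2_norm V (\<lambda>x. \<Sum>g\<in>P. t g x) \<le> (\<Sum>g\<in>P. ell2_norm V (t g))"
        by (rule ell2_sum) (use t in auto)
      moreover have "(\<Sum>g\<in>P. ell2_norm V (t g)) \<le> (\<Sum>g\<in>P. ell2_norm V f)"
        by (rule sum_mono) (use t in auto)
      ultimately show "s \<in> ell2 V" "ell2_norm V s \<le> c * (\<Sum>g\<in>P. ell2_norm V f)"
        unfolding s_def ell2_norm_scale using c by (auto intro!: ell2_scale mult_left_mono)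
    qed
    have dom: "cmod (kernel_op V K f x) \<le> cmod (s x)" if x: "x \<in> V" for x
    proof -
      have "cmod (kernel_op V K f x) \<le> (\<Sum>y\<in>nbhd P x. cmod (K x y * f y))"
        unfolding kernel_op_apply[OF P K(1) x f] by (rule norm_sum)
      also have "\<dots> \<le> (\<Sum>y\<in>nbhd P x. c * cmod (f y))"
        using K(2) by (intro sum_mono) (auto simp: norm_mult intro!: mult_right_mono)
      also have "\<dots> \<le> (\<Sum>g\<in>P. c * cmod (f (g \<cdot> x)))"
        unfolding nbhd_def using c sum_image_le[of P "\<lambda>y. c * cmod (f y)" "\<lambda>g. g \<cdot> x"]
        by (simp add: sym_finD[OF P] comp_def)
      also have "\<dots> = c * (\<Sum>g\<in>P. cmod (f (g \<cdot> x)))" by (simp add: sum_distrib_left)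
      also have "\<dots> = cmod (s x)"
        using c x by (simp add: s_def t_def norm_mult sum_nonneg flip: of_real_sum)
      finally show ?thesis .
    qed
    have "kernel_op V K f \<in> ell2 V" "ell2_norm V (kernel_op V K f) \<le> ell2_norm V s"
      by (rule ell2_dominated[OF s(1)]; use dom in \<open>auto simp: kernel_op_def\<close>)+
    then show ?thesis using s(2) by simp
  qed
  show "kernel_op V K \<in> bounded_ops V"
  proof (rule bounded_opsI)
    fix f g :: "'v \<Rightarrow> complex" and a assume f: "f \<in> ell2 V"
    show "kernel_op V K f \<in> ell2 V" "ell2_norm V (kernel_op V K f) \<le> (c * card P) * ell2_norm V f"
      using *[OF f] by auto
    show "kernel_op V K (\<lambda>x. a * f x) = (\<lambda>x. a * kernel_op V K f x)"
      using f by (auto simp: kernel_op_def ell2_scale mult.left_commute[of _ a] infsum_cmult_right')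
    assume g: "g \<in> ell2 V"
    show "kernel_op V K (\<lambda>x. f x + g x) = (\<lambda>x. kernel_op V K f x + kernel_op V K g x)"
      using f g
      by (auto simp: kernel_op_def ell2_add distrib_left infsum_add kernel_op_summable[OF P K(1)])
  qed (auto simp: kernel_op_def)
  show "op_norm V (kernel_op V K) \<le> c * card P"
    using c * by (intro op_norm_le) auto
qed

lemma kernel_op_inner:
  assumes P: "sym_fin P" and K: "finite_range P K" "\<And>x y. cmod (K x y) \<le> c"
    and f: "f \<in> ell2 V" and g: "g \<in> ell2 V"
  shows "ell2_inner V (kernel_op V K f) g = (\<Sum>\<^sub>\<infinity>x\<in>V. \<Sum>y\<in>nbhd P x. K x y * f y * cnj (g x))"
  unfolding ell2_inner_def
  by (intro infsum_cong) (simp add: kernel_op_apply[OF P K(1) _ f] sum_distrib_right)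

lemma kernel_op_adjoint:
  assumes P: "sym_fin P" and K: "finite_range P K" "\<And>x y. cmod (K x y) \<le> c"
  shows "is_op_adjoint V (kernel_op V K) (kernel_op V (\<lambda>x y. cnj (K y x)))"
    and "finite_range P (\<lambda>x y. cnj (K y x))"
proof -
  show fr: "finite_range P (\<lambda>x y. cnj (K y x))"
    using K(1) nbhd_sym[OF P] nbhd_subset[OF P] unfolding finite_range_def complex_cnj_zero_iff by blast
  show "is_op_adjoint V (kernel_op V K) (kernel_op V (\<lambda>x y. cnj (K y x)))"
    unfolding is_op_adjoint_def
  proof (intro ballI)
    fix f g assume f: "f \<in> ell2 V" and g: "g \<in> ell2 V"
    have "ell2_inner V (kernel_op V K f) g = (\<Sum>\<^sub>\<infinity>x\<in>V. \<Sum>y\<in>nbhd P x. K x y * f y * cnj (g x))"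
      by (rule kernel_op_inner[OF P K f g])
    also have "\<dots> = (\<Sum>\<^sub>\<infinity>y\<in>V. \<Sum>x\<in>nbhd P y. K x y * f y * cnj (g x))"
    proof (rule nbhd_sum_swap[OF P])
      fix h assume h: "h \<in> P"
      \<comment> \<open>The untranslated factor is written as a translate by the unit to match
        \<open>translate_product_summable\<close>.\<close>
      have "(\<lambda>x. c * (cmod (f (h \<cdot> x)) * cmod (g (\<one> \<cdot> x)))) summable_on V"
        using sym_finD[OF P] h f g by (intro summable_on_cmult_right translate_product_summable) auto
      then show "(\<lambda>x. cmod (K x (h \<cdot> x) * f (h \<cdot> x) * cnj (g x))) summable_on V"
        by (rule summable_on_comparison_test)
          (auto simp: norm_mult mult.assoc intro!: mult_right_mono K(2))
    qed
    also have "\<dots> = ell2_inner V f (kernel_op V (\<lambda>x y. cnj (K y x)) g)"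
      unfolding ell2_inner_def
      by (intro infsum_cong) (simp add: kernel_op_apply[OF P fr _ g] sum_distrib_left algebra_simps)
    finally show "ell2_inner V (kernel_op V K f) g = ell2_inner V f (kernel_op V (\<lambda>x y. cnj (K y x)) g)" .
  qed
qed

section \<open>The algebra of local kernels and its norm closure\<close>

definition local_ker :: "('v \<Rightarrow> 'v \<Rightarrow> complex) \<Rightarrow> bool" where
  "local_ker K \<longleftrightarrow> (\<exists>P. sym_fin P \<and> finite_range P K) \<and>
     (\<forall>g\<in>carrier G. stab_local (\<lambda>x. K x (g \<cdot> x)))"

lemma local_kerD:
  assumes "local_ker K" "g \<in> carrier G" "h \<in> carrier G"
  shows "stab_local (\<lambda>x. K (g \<cdot> x) (h \<cdot> x))"
  by (rule stab_local_pair[where \<Xi>=K]) (use assms in \<open>auto simp: local_ker_def\<close>)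

text \<open>A local kernel has finitely many values: finitely many displacements occur, each
  contributes a finite set by \<open>stab_local_finite_range\<close>, and all other entries are
  zero.\<close>

lemma local_ker_bounded:
  assumes "local_ker K"
  obtains c where "\<And>x y. cmod (K x y) \<le> c"
proof -
  obtain P where P: "sym_fin P" "finite_range P K" using assms by (auto simp: local_ker_def)
  let ?A = "\<Union>g\<in>P. (\<lambda>x. cmod (K x (g \<cdot> x))) ` V"
  have "finite ((\<lambda>x. cmod (K x (g \<cdot> x))) ` V)" if "g \<in> P" for g
    using assms that sym_finD[OF P(1)]
    by (intro stab_local_finite_range stab_local_comp[where k=cmod]) (auto simp: local_ker_def)
  then have fin: "finite (insert 0 ?A)" using sym_finD(1)[OF P(1)] by blast
  have "cmod (K x y) \<in> insert 0 ?A" for x y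
    using P(2) by (cases "K x y = 0") (fastforce simp: finite_range_def nbhd_def)+
  then show ?thesis using that[of "Max (insert 0 ?A)"] fin by (meson Max_ge)
qed

lemma local_ker_bounded_ops:
  assumes "local_ker K"
  shows "kernel_op V K \<in> bounded_ops V"
proof -
  obtain P where P: "sym_fin P" "finite_range P K" using assms by (auto simp: local_ker_def)
  obtain c where "\<And>x y. cmod (K x y) \<le> c" using local_ker_bounded[OF assms] by blast
  then show ?thesis by (rule finite_range_op_norm(1)[OF P])
qed

lemma common_range:
  assumes "finite \<K>" "\<And>K. K \<in> \<K> \<Longrightarrow> local_ker K"
  obtains P where "sym_fin P" "\<And>K. K \<in> \<K> \<Longrightarrow> finite_range P K"
proof -
  have "\<forall>K\<in>\<K>. \<exists>P. sym_fin P \<and> finite_range P K" using assms(2) by (simp add: local_ker_def)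
  then obtain p where p: "\<And>K. K \<in> \<K> \<Longrightarrow> sym_fin (p K) \<and> finite_range (p K) K" by metis
  have "finite (\<Union>K\<in>\<K>. p K)" "(\<Union>K\<in>\<K>. p K) \<subseteq> carrier G"
    using assms(1) p by (auto simp: sym_fin_def)
  from sym_fin_exists[OF this] obtain P where P: "sym_fin P" "(\<Union>K\<in>\<K>. p K) \<subseteq> P" by blast
  then show ?thesis using that p finite_range_mono by (metis UN_subset_iff)
qed

text \<open>After the rewriting by \<open>nbhd_sum\<close> the new ingredient is the multiplicity,
  which is local because it counts the coincidences h x = g x.\<close>

lemma nbhd_sum_stab_local:
  fixes \<Psi> :: "'v \<Rightarrow> 'v \<Rightarrow> 'c::real_normed_field"
  assumes P: "sym_fin P" and loc: "\<And>g. g \<in> P \<Longrightarrow> stab_local (\<lambda>x. \<Psi> x (g \<cdot> x))"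
  shows "stab_local (\<lambda>x. \<Sum>y\<in>nbhd P x. \<Psi> x y)"
  unfolding nbhd_sum[OF P]
proof (rule stab_local_sum)
  fix g assume g: "g \<in> P"
  have "stab_local (\<lambda>x. orbit_mult P x (g \<cdot> x))"
    unfolding orbit_mult_def
    by (intro stab_local_comp[where k=card] stab_local_Collect stab_local_eq) (use g sym_finD[OF P] in auto)
  with loc[OF g] show "stab_local (\<lambda>x. \<Psi> x (g \<cdot> x) / of_nat (orbit_mult P x (g \<cdot> x)))"
    by (rule stab_local_comp2)
qed (rule sym_finD[OF P])

lemma local_ker_add:
  assumes K: "local_ker K" and L: "local_ker L"
  shows "local_ker (\<lambda>x y. K x y + L x y)"
    and "op_add (kernel_op V K) (kernel_op V L) = kernel_op V (\<lambda>x y. K x y + L x y)"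
proof -
  obtain P where P: "sym_fin P" "finite_range P K" "finite_range P L"
    using common_range[of "{K, L}"] K L by (metis finite.emptyI finite.insertI insertCI insertE singletonD)
  have "finite_range P (\<lambda>x y. K x y + L x y)"
    using P(2,3) unfolding finite_range_def by (metis add_0)
  then show "local_ker (\<lambda>x y. K x y + L x y)"
    using P(1) K L unfolding local_ker_def
    by (auto intro: stab_local_comp2[where k="(+)"])
  show "op_add (kernel_op V K) (kernel_op V L) = kernel_op V (\<lambda>x y. K x y + L x y)"
    unfolding op_add_def kernel_op_def
    by (auto simp: fun_eq_iff distrib_right infsum_add kernel_op_summable[OF P(1,2)] kernel_op_summable[OF P(1,3)])
qed

lemma local_ker_scale:
  assumes K: "local_ker K"
  shows "local_ker (\<lambda>x y. c * K x y)"
    and "op_scale c (kernel_op V K) = kernel_op V (\<lambda>x y. c * K x y)"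
proof -
  show "local_ker (\<lambda>x y. c * K x y)"
    using K unfolding local_ker_def finite_range_def
    by (auto intro: stab_local_comp[where k="\<lambda>a. c * a"])
  show "op_scale c (kernel_op V K) = kernel_op V (\<lambda>x y. c * K x y)"
    unfolding op_scale_def kernel_op_def by (auto simp: fun_eq_iff mult.assoc infsum_cmult_right')
qed

lemma local_ker_adjoint:
  assumes K: "local_ker K"
  shows "local_ker (\<lambda>x y. cnj (K y x))"
    and "is_op_adjoint V (kernel_op V K) (kernel_op V (\<lambda>x y. cnj (K y x)))"
proof -
  obtain P where P: "sym_fin P" "finite_range P K" using assms by (auto simp: local_ker_def)
  obtain c where c: "\<And>x y. cmod (K x y) \<le> c" using local_ker_bounded[OF assms] by blast
  show "is_op_adjoint V (kernel_op V K) (kernel_op V (\<lambda>x y. cnj (K y x)))"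
    by (rule kernel_op_adjoint(1)[OF P c])
  have "stab_local (\<lambda>x. cnj (K (g \<cdot> x) x))" if "g \<in> carrier G" for g
    using local_kerD[OF K that one_closed]
    by (rule stab_local_cong[OF stab_local_comp]) auto
  then show "local_ker (\<lambda>x y. cnj (K y x))"
    using kernel_op_adjoint(2)[OF P c] P(1) unfolding local_ker_def by blast
qed

lemma local_ker_comp:
  assumes K: "local_ker K" and L: "local_ker L"
  shows "\<exists>M. local_ker M \<and> kernel_op V K \<circ> kernel_op V L = kernel_op V M"
proof -
  obtain P where P: "sym_fin P" "finite_range P K" "finite_range P L"
    using common_range[of "{K, L}"] K L by (metis finite.emptyI finite.insertI insertCI insertE singletonD)
  note Pc = sym_finD(2)[OF P(1)]
  define M where "M x y = (\<Sum>z\<in>nbhd P x. K x z * L z y)" for x y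
  \<comment> \<open>Two moves by members of P amount to one move by a product, so the composite
    kernel has its range in a symmetric set containing all these products.\<close>
  have "finite ((\<lambda>(g, h). g \<otimes> h) ` (P \<times> P))" "(\<lambda>(g, h). g \<otimes> h) ` (P \<times> P) \<subseteq> carrier G"
    using sym_finD(1)[OF P(1)] Pc by auto
  from sym_fin_exists[OF this] obtain P2 where P2: "sym_fin P2" "(\<lambda>(g, h). g \<otimes> h) ` (P \<times> P) \<subseteq> P2" by blast
  have "finite_range P2 M"
    unfolding finite_range_def
  proof (intro allI impI)
    fix x y assume "M x y \<noteq> 0"
    then obtain z where z: "K x z \<noteq> 0" "L z y \<noteq> 0"
      unfolding M_def by (auto elim!: sum.not_neutral_contains_not_neutral)
    then obtain g h where *: "x \<in> V" "g \<in> P" "h \<in> P" "y = h \<cdot> g \<cdot> x"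
      using P(2,3) by (fastforce simp: finite_range_def nbhd_def)
    then have "y = (h \<otimes> g) \<cdot> x" using Pc by (simp add: act_mult)
    then show "x \<in> V \<and> y \<in> nbhd P2 x" using * P2(2) by (force simp: nbhd_def)
  qed
  moreover have "stab_local (\<lambda>x. M x (g \<cdot> x))" if g: "g \<in> carrier G" for g
    unfolding M_def
  proof (rule nbhd_sum_stab_local[OF P(1)])
    fix h assume "h \<in> P"
    then show "stab_local (\<lambda>x. K x (h \<cdot> x) * L (h \<cdot> x) (g \<cdot> x))"
      using K Pc g by (intro stab_local_comp2[where k="(*)"] local_kerD[OF L]) (auto simp: local_ker_def)
  qed
  ultimately have M: "local_ker M" using P2(1) unfolding local_ker_def by blast
  have "(kernel_op V K \<circ> kernel_op V L) f = kernel_op V M f" for f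
  proof (cases "f \<in> ell2 V")
    case True
    note Lf = bounded_opsD(1)[OF local_ker_bounded_ops[OF L] True]
    have "kernel_op V K (kernel_op V L f) x = kernel_op V M f x" if x: "x \<in> V" for x
    proof -
      have "kernel_op V K (kernel_op V L f) x = (\<Sum>z\<in>nbhd P x. K x z * (\<Sum>\<^sub>\<infinity>y\<in>V. L z y * f y))"
        unfolding kernel_op_apply[OF P(1,2) x Lf]
        using True nbhd_subset[OF P(1) x] by (intro sum.cong refl) (simp add: kernel_op_def)
      also have "\<dots> = (\<Sum>z\<in>nbhd P x. \<Sum>\<^sub>\<infinity>y\<in>V. K x z * (L z y * f y))"
        by (simp add: infsum_cmult_right')
      also have "\<dots> = (\<Sum>\<^sub>\<infinity>y\<in>V. \<Sum>z\<in>nbhd P x. K x z * (L z y * f y))"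
        by (intro infsum_finite_sum[symmetric] summable_on_cmult_right kernel_op_summable[OF P(1,3)])
      also have "\<dots> = kernel_op V M f x"
        using x True by (simp add: kernel_op_def M_def sum_distrib_right mult.assoc)
      finally show ?thesis .
    qed
    then show ?thesis by (auto simp: fun_eq_iff kernel_op_def)
  next
    case False
    then show ?thesis by (auto simp: kernel_op_def fun_eq_iff)
  qed
  then show ?thesis using M by blast
qed

lemma local_ker_zero: "local_ker (\<lambda>_ _. 0)"
  using sym_fin_exists[of "{}"] by (force simp: local_ker_def finite_range_def stab_local_const)

definition local_alg :: "'v operator set" where
  "local_alg = op_closure V (kernel_op V ` {K. local_ker K})"

lemma local_alg_cstar: "cstar_subalgebra V local_alg"
  unfolding local_alg_def
proof (rule op_closure_cstar_subalgebra)
  show "kernel_op V ` {K. local_ker K} \<noteq> {}" using local_ker_zero by blast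
  fix S assume "S \<in> kernel_op V ` {K. local_ker K}"
  then obtain K where K: "local_ker K" "S = kernel_op V K" by blast
  show "op_scale c S \<in> kernel_op V ` {K. local_ker K}" for c
    unfolding K(2) local_ker_scale(2)[OF K(1)] using local_ker_scale(1)[OF K(1)] by blast
  show "\<exists>R\<in>kernel_op V ` {K. local_ker K}. is_op_adjoint V S R"
    unfolding K(2) using local_ker_adjoint[OF K(1)] by blast
  fix T assume "T \<in> kernel_op V ` {K. local_ker K}"
  then obtain L where L: "local_ker L" "T = kernel_op V L" by blast
  show "op_add S T \<in> kernel_op V ` {K. local_ker K}"
    unfolding K(2) L(2) local_ker_add(2)[OF K(1) L(1)] using local_ker_add(1)[OF K(1) L(1)] by blast
  show "S \<circ> T \<in> kernel_op V ` {K. local_ker K}"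
    unfolding K(2) L(2) using local_ker_comp[OF K(1) L(1)] by blast
qed (use local_ker_bounded_ops in auto)

end


section \<open>Completely positive approximations\<close>

definition compress_emb :: "'v set \<Rightarrow> ('v \<Rightarrow> 'w) \<Rightarrow> ('w \<Rightarrow> complex) \<Rightarrow> 'v \<Rightarrow> complex" where
  "compress_emb E e h = (\<lambda>v. if v \<in> E then h (e v) else 0)"

text \<open>This is U* T U, where U = \<open>compress_emb E e\<close> identifies functions on I with
  functions supported on E. The relabelling by e is there because the matrix algebras in
  \<open>nuclear\<close> act on initial segments of the natural numbers.\<close>

definition compress :: "'v set \<Rightarrow> ('v \<Rightarrow> 'w) \<Rightarrow> 'w set \<Rightarrow> 'v operator \<Rightarrow> 'w operator" where
  "compress E e I T = (\<lambda>h i. if h \<in> ell2 I \<and> i \<in> I then T (compress_emb E e h) (inv_into E e i) else 0)"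

lemma compress_ccp:
  assumes E: "finite E" "E \<subseteq> V" and e: "bij_betw e E I" and A: "A \<subseteq> bounded_ops V"
  shows "ccp_map V A I (bounded_ops I) (compress E e I)"
proof -
  let ?U = "compress_emb E e"
  have I: "finite I" using E(1) e bij_betw_finite by blast
  have ei: "inv_into E e i \<in> E" "e (inv_into E e i) = i" if "i \<in> I" for i
    using that e by (auto simp: bij_betw_def inv_into_into f_inv_into_f)
  have ie: "inv_into E e (e v) = v" "e v \<in> I" if "v \<in> E" for v
    using that e by (auto simp: bij_betw_def)
  have U: "?U h \<in> ell2 V" for h
    unfolding compress_emb_def by (rule ell2_restrict_finite(1)[OF E, of "\<lambda>v. h (e v)"])
  have nU: "ell2_norm V (?U h) = ell2_norm I h" for h
    unfolding compress_emb_def ell2_restrict_finite(2)[OF E, of "\<lambda>v. h (e v)"]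
    by (simp add: ell2_norm_finite[OF I] L2_set_def sum.reindex_bij_betw[OF e, of "\<lambda>i. (cmod (h i))\<^sup>2"])
  have W: "ell2_norm I (\<lambda>i. if i \<in> I then f (inv_into E e i) else 0) \<le> ell2_norm V f" if "f \<in> ell2 V" for f
  proof -
    have "(\<Sum>i\<in>I. (cmod (f (inv_into E e i)))\<^sup>2) = (\<Sum>v\<in>E. (cmod (f v))\<^sup>2)"
      by (subst sum.reindex_bij_betw[OF e, symmetric]) (simp add: ie)
    then show ?thesis
      using ell2_finite_L2_le[OF that E] by (simp add: ell2_norm_finite[OF I] L2_set_def)
  qed
  \<comment> \<open>Complete positivity follows from this identity alone: positivity of the
    compressed matrix at the vectors \<open>\<xi> i\<close> is positivity of the original one at
    their images under \<open>?U\<close>.\<close>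
  have inner: "ell2_inner I (compress E e I T h) h' = ell2_inner V (T (?U h)) (?U h')"
    if h: "h \<in> ell2 I" for T h h'
  proof -
    have "ell2_inner I (compress E e I T h) h' = (\<Sum>i\<in>I. T (?U h) (inv_into E e i) * cnj (h' i))"
      using h by (simp add: ell2_inner_finite[OF I] compress_def cong: sum.cong)
    also have "\<dots> = (\<Sum>v\<in>E. T (?U h) v * cnj (h' (e v)))"
      by (subst sum.reindex_bij_betw[OF e, symmetric]) (simp add: ie)
    also have "\<dots> = (\<Sum>\<^sub>\<infinity>v\<in>E. T (?U h) v * cnj (h' (e v)))" using E(1) by simp
    also have "\<dots> = ell2_inner V (T (?U h)) (?U h')"
      unfolding ell2_inner_def using E(2) by (intro infsum_cong_neutral) (auto simp: compress_emb_def)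
    finally show ?thesis .
  qed
  have norm: "ell2_norm I (compress E e I T h) \<le> op_norm V T * ell2_norm I h"
    if T: "T \<in> bounded_ops V" and h: "h \<in> ell2 I" for T h
  proof -
    have "ell2_norm I (compress E e I T h) \<le> ell2_norm V (T (?U h))"
      using W[OF bounded_opsD(1)[OF T U]] h unfolding compress_def by simp
    also have "\<dots> \<le> op_norm V T * ell2_norm V (?U h)"
      by (rule op_norm_bound[OF T U])
    finally show ?thesis by (simp add: nU)
  qed
  have lin: "?U (\<lambda>x. f x + g x) = (\<lambda>x. ?U f x + ?U g x)" "?U (\<lambda>x. c * f x) = (\<lambda>x. c * ?U f x)" for f g c
    by (auto simp: compress_emb_def)
  have bd: "compress E e I T \<in> bounded_ops I" if T: "T \<in> bounded_ops V" for T
    by (rule bounded_opsI[OF _ _ _ _ norm[OF T]])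
      (auto simp: compress_def I lin bounded_opsD(3)[OF T U U] bounded_opsD(4)[OF T U] ell2_add ell2_scale fun_eq_iff)
  show ?thesis
    unfolding ccp_map_def
  proof (intro conjI ballI allI)
    show "compress E e I ` A \<subseteq> bounded_ops I" using bd A by blast
    show "completely_positive V A I (compress E e I)"
      unfolding completely_positive_def positive_op_matrix_def
      by (auto simp: inner U)
  qed (use A norm in \<open>auto simp: compress_def op_add_def op_scale_def fun_eq_iff subset_iff
      intro!: op_norm_le op_norm_nonneg\<close>)
qed

lemma compress_kernel_op_ket:
  assumes "E \<subseteq> V" "bij_betw e E I" "i \<in> E" "j \<in> E"
  shows "compress E e I (kernel_op V K) (ket (e i)) (e j) = K j i"
proof -
  have "compress_emb E e (ket (e i)) = ket i"
    using assms by (auto simp: compress_emb_def ket_def bij_betw_def inj_on_def fun_eq_iff)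
  moreover have "e i \<in> I" "e j \<in> I" "inv_into E e (e j) = j"
    using assms by (auto simp: bij_betw_def)
  ultimately show ?thesis
    using assms by (simp add: compress_def ket_ell2 kernel_op_ket subset_iff)
qed

text \<open>The data fixed for one finite set of kernels. \<open>rep_act\<close> makes u x \<mapsto>
  u (\<open>rep x\<close>), for u in R, a well-defined injection of balls. \<open>rep_local\<close>
  keeps the operators built from matrices inside the algebra. The numbering e covers the balls of
  all representatives at once, so a single matrix size k serves every vertex.\<close>

locale local_partition = left_action G V act
  for G :: "('a, 'b) monoid_scheme" (structure) and V :: "'v set"
    and act :: "'a \<Rightarrow> 'v \<Rightarrow> 'v" (infixr "\<cdot>" 75) +
  fixes R :: "'a set" and \<sigma> :: "'v \<Rightarrow> 'v \<Rightarrow> complex" and rep :: "'v \<Rightarrow> 'v" and e :: "'v \<Rightarrow> nat" and k :: nat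
  assumes R: "sym_fin R"
    and \<sigma>_ell2: "x \<in> V \<Longrightarrow> \<sigma> x \<in> ell2 V" and \<sigma>_norm: "x \<in> V \<Longrightarrow> ell2_norm V (\<sigma> x) = 1"
    and \<sigma>_supp: "x \<in> V \<Longrightarrow> \<sigma> x v \<noteq> 0 \<Longrightarrow> v \<in> nbhd R x"
    and \<sigma>_local: "g \<in> carrier G \<Longrightarrow> stab_local (\<lambda>x. \<sigma> x (g \<cdot> x))"
    and rep_closed: "x \<in> V \<Longrightarrow> rep x \<in> V" and rep_local: "stab_local rep"
    and rep_act: "g \<in> R \<Longrightarrow> h \<in> R \<Longrightarrow> x \<in> V \<Longrightarrow> g \<cdot> x = h \<cdot> x \<longleftrightarrow> g \<cdot> rep x = h \<cdot> rep x"
    and e_bij: "bij_betw e (\<Union>x\<in>V. nbhd R (rep x)) {..<k}"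
begin

lemmas Rc = sym_finD(2)[OF R]

text \<open>This is the ball isomorphism \<open>\<theta>\<^sub>x\<close> of the overview. Choosing u
  from an explicitly named set makes the choice a function of that set, which is local data as
  \<open>label_local\<close> requires; by \<open>rep_act\<close> the resulting point is the same for
  every choice.\<close>

definition to_rep :: "'v \<Rightarrow> 'v \<Rightarrow> 'v" where
  "to_rep x y = (SOME u. u \<in> {u \<in> R. u \<cdot> x = y}) \<cdot> rep x"

definition label :: "'v \<Rightarrow> 'v \<Rightarrow> nat" where
  "label x y = e (to_rep x y)"

lemma to_rep_act:
  assumes "u \<in> R" "x \<in> V"
  shows "to_rep x (u \<cdot> x) = u \<cdot> rep x"
proof -
  have "(SOME v. v \<in> {v \<in> R. v \<cdot> x = u \<cdot> x}) \<in> {v \<in> R. v \<cdot> x = u \<cdot> x}"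
    by (rule someI[of _ u]) (use assms in auto)
  then show ?thesis unfolding to_rep_def using rep_act[OF _ assms] by auto
qed

lemma to_rep_mem:
  assumes "x \<in> V" "y \<in> nbhd R x"
  shows "to_rep x y \<in> (\<Union>x\<in>V. nbhd R (rep x))"
  using assms to_rep_act by (auto simp: nbhd_def)

lemma label_less: "x \<in> V \<Longrightarrow> y \<in> nbhd R x \<Longrightarrow> label x y < k"
  using bij_betw_apply[OF e_bij to_rep_mem] unfolding label_def by simp

lemma label_inj: "x \<in> V \<Longrightarrow> inj_on (label x) (nbhd R x)"
proof (rule inj_onI)
  fix y w assume x: "x \<in> V" and yw: "y \<in> nbhd R x" "w \<in> nbhd R x" "label x y = label x w"
  then have "to_rep x y = to_rep x w"
    using to_rep_mem e_bij unfolding label_def bij_betw_def inj_on_def by metis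
  moreover obtain u v where "u \<in> R" "y = u \<cdot> x" "v \<in> R" "w = v \<cdot> x"
    using yw by (auto simp: nbhd_def)
  ultimately show "y = w" using to_rep_act rep_act x by simp
qed

lemma label_local:
  assumes "g \<in> carrier G"
  shows "stab_local (\<lambda>x. label x (g \<cdot> x))"
proof -
  have "stab_local (\<lambda>x. {u \<in> R. u \<cdot> x = g \<cdot> x})"
    by (intro stab_local_Collect stab_local_eq sym_finD(1)[OF R] Rc assms)
  from stab_local_comp2[OF this rep_local, of "\<lambda>U r. e ((SOME u. u \<in> U) \<cdot> r)"]
  show ?thesis by (simp add: label_def to_rep_def)
qed

lemma \<sigma>_le_1:
  assumes "y \<in> V"
  shows "cmod (\<sigma> y x) \<le> 1"
proof (cases "x \<in> V")
  case True
  then show ?thesis using ell2_point_le[OF \<sigma>_ell2[OF assms]] \<sigma>_norm[OF assms] by metis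
next
  case False
  then show ?thesis using \<sigma>_ell2[OF assms] by (simp add: ell2_def)
qed

lemma \<sigma>_sum:
  assumes "y \<in> V"
  shows "(\<Sum>x\<in>nbhd R y. (cmod (\<sigma> y x))\<^sup>2) = 1"
proof -
  have "(\<Sum>\<^sub>\<infinity>x\<in>V. (cmod (\<sigma> y x))\<^sup>2) = (\<Sum>\<^sub>\<infinity>x\<in>nbhd R y. (cmod (\<sigma> y x))\<^sup>2)"
    using \<sigma>_supp[OF assms] nbhd_subset[OF R assms] by (intro infsum_cong_neutral) auto
  then show ?thesis
    using ell2_norm_square[of V "\<sigma> y"] \<sigma>_norm[OF assms] nbhd_finite[OF R] by simp
qed

text \<open>The maps \<open>slice x\<close> assemble to an isometry of \<open>ell2 V\<close> into the direct sum of copies of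
  \<open>ell2 {..<k}\<close> indexed by \<open>V\<close>; compressing the diagonal operator \<open>M\<close> by it gives \<open>expand M\<close>.\<close>

definition slice :: "'v \<Rightarrow> ('v \<Rightarrow> complex) \<Rightarrow> nat \<Rightarrow> complex" where
  "slice x f = (\<lambda>i. \<Sum>w\<in>nbhd R x. cnj (\<sigma> w x) * f w * ket (label x w) i)"

lemma slice_ell2: "x \<in> V \<Longrightarrow> slice x f \<in> ell2 {..<k}"
  using label_less unfolding slice_def by (auto simp: ket_def intro!: sum.neutral)

text \<open>Distinct neighbours of x carry distinct labels, so the kets in \<open>slice x f\<close>
  are orthonormal and no cross terms appear.\<close>

lemma slice_norm:
  assumes x: "x \<in> V"
  shows "(ell2_norm {..<k} (slice x f))\<^sup>2 = (\<Sum>w\<in>nbhd R x. (cmod (\<sigma> w x))\<^sup>2 * (cmod (f w))\<^sup>2)"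
proof -
  have Cw: "slice x f (label x w) = cnj (\<sigma> w x) * f w" if w: "w \<in> nbhd R x" for w
  proof -
    have "slice x f (label x w) = (\<Sum>w'\<in>nbhd R x. if w' = w then cnj (\<sigma> w x) * f w else 0)"
      unfolding slice_def using w label_inj[OF x] by (intro sum.cong) (auto simp: ket_def inj_on_def)
    then show ?thesis using w nbhd_finite[OF R] by simp
  qed
  have "(ell2_norm {..<k} (slice x f))\<^sup>2 = (\<Sum>i<k. (cmod (slice x f i))\<^sup>2)"
    by (simp add: ell2_norm_finite L2_set_def sum_nonneg)
  also have "\<dots> = (\<Sum>i\<in>label x ` nbhd R x. (cmod (slice x f i))\<^sup>2)"
    using label_less[OF x] by (intro sum.mono_neutral_right) (auto simp: slice_def ket_def intro!: sum.neutral)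
  also have "\<dots> = (\<Sum>w\<in>nbhd R x. (cmod (slice x f (label x w)))\<^sup>2)"
    by (simp add: sum.reindex[OF label_inj[OF x]])
  also have "\<dots> = (\<Sum>w\<in>nbhd R x. (cmod (\<sigma> w x))\<^sup>2 * (cmod (f w))\<^sup>2)"
    by (intro sum.cong refl) (simp add: Cw norm_mult power_mult_distrib)
  finally show ?thesis .
qed

text \<open>Exchanging the sums over x and w leaves, at each w, the squared modulus of f w times the
  sum in \<open>\<sigma>_sum\<close>, which is 1. The slice norms are packaged as a vector of
  \<open>ell2 V\<close> so that Cauchy-Schwarz over V is available in
  \<open>expand_norm\<close>.\<close>

lemma slice_isometry:
  assumes f: "f \<in> ell2 V"
  shows "(\<lambda>x. if x \<in> V then complex_of_real (ell2_norm {..<k} (slice x f)) else 0) \<in> ell2 V"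
    and "ell2_norm V (\<lambda>x. if x \<in> V then complex_of_real (ell2_norm {..<k} (slice x f)) else 0) = ell2_norm V f"
proof -
  let ?F = "\<lambda>x. if x \<in> V then complex_of_real (ell2_norm {..<k} (slice x f)) else 0"
  define \<Phi> where "\<Phi> x y = (cmod (\<sigma> y x))\<^sup>2 * (cmod (f y))\<^sup>2" for x y
  have eq: "(cmod (?F x))\<^sup>2 = (\<Sum>y\<in>nbhd R x. \<Phi> x y)" if "x \<in> V" for x
    using slice_norm[OF that] that by (simp add: \<Phi>_def)
  have sm: "(\<lambda>x. norm (\<Phi> x (g \<cdot> x))) summable_on V" if g: "g \<in> R" for g
  proof (rule summable_on_comparison_test[OF translate_product_summable[OF Rc[OF g] Rc[OF g] f f]])
    fix x assume x: "x \<in> V"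
    have "(cmod (\<sigma> (g \<cdot> x) x))\<^sup>2 \<le> 1" using \<sigma>_le_1 Rc[OF g] x by (simp add: power_le_one)
    then show "norm (\<Phi> x (g \<cdot> x)) \<le> cmod (f (g \<cdot> x)) * cmod (f (g \<cdot> x))"
      unfolding \<Phi>_def by (simp add: power2_eq_square[of "cmod (f _)"] mult_left_le_one_le)
  qed auto
  have "(\<lambda>x. \<Sum>y\<in>nbhd R x. \<Phi> x y) summable_on V" by (rule nbhd_sum_summable[where \<Phi>=\<Phi>, OF R sm])
  then have "(\<lambda>x. (cmod (?F x))\<^sup>2) summable_on V" by (subst summable_on_cong[OF eq]) auto
  then show "?F \<in> ell2 V" by (simp add: ell2_def)
  have "(\<Sum>\<^sub>\<infinity>x\<in>V. (cmod (?F x))\<^sup>2) = (\<Sum>\<^sub>\<infinity>x\<in>V. \<Sum>y\<in>nbhd R x. \<Phi> x y)"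
    by (rule infsum_cong[OF eq])
  also have "\<dots> = (\<Sum>\<^sub>\<infinity>y\<in>V. \<Sum>x\<in>nbhd R y. \<Phi> x y)" by (rule nbhd_sum_swap[where \<Phi>=\<Phi>, OF R sm])
  also have "\<dots> = (\<Sum>\<^sub>\<infinity>y\<in>V. (cmod (f y))\<^sup>2)"
    by (intro infsum_cong) (simp add: \<Phi>_def \<sigma>_sum flip: sum_distrib_right)
  finally show "ell2_norm V ?F = ell2_norm V f" unfolding ell2_norm_def by simp
qed

text \<open>\<open>M (ket j) i\<close> is the matrix entry in row i and column j. The guard on w is
  there because \<open>label x w\<close> is meaningful only for neighbours of x; the guard on y
  makes the kernel vanish off V.\<close>

definition expand_ker :: "nat operator \<Rightarrow> 'v \<Rightarrow> 'v \<Rightarrow> complex" where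
  "expand_ker M y w = (\<Sum>x\<in>nbhd R y. if y \<in> V \<and> w \<in> nbhd R x
     then \<sigma> y x * cnj (\<sigma> w x) * M (ket (label x w)) (label x y) else 0)"

definition expand :: "nat operator \<Rightarrow> 'v operator" where
  "expand M = kernel_op V (expand_ker M)"

definition R2 :: "'a set" where
  "R2 = (SOME P. sym_fin P \<and> (\<forall>g\<in>R. \<forall>h\<in>R. g \<otimes> h \<in> P))"

lemma R2: "sym_fin R2" "g \<in> R \<Longrightarrow> h \<in> R \<Longrightarrow> g \<otimes> h \<in> R2"
proof -
  have "finite ((\<lambda>(g, h). g \<otimes> h) ` (R \<times> R))" "(\<lambda>(g, h). g \<otimes> h) ` (R \<times> R) \<subseteq> carrier G"
    using sym_finD(1)[OF R] Rc by auto
  from sym_fin_exists[OF this] obtain P where "sym_fin P" "(\<lambda>(g, h). g \<otimes> h) ` (R \<times> R) \<subseteq> P" by blast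
  then have "sym_fin P \<and> (\<forall>g\<in>R. \<forall>h\<in>R. g \<otimes> h \<in> P)" by auto
  then have "\<exists>P. sym_fin P \<and> (\<forall>g\<in>R. \<forall>h\<in>R. g \<otimes> h \<in> P)" by blast
  then have "sym_fin R2 \<and> (\<forall>g\<in>R. \<forall>h\<in>R. g \<otimes> h \<in> R2)" unfolding R2_def by (rule someI_ex)
  then show "sym_fin R2" "g \<in> R \<Longrightarrow> h \<in> R \<Longrightarrow> g \<otimes> h \<in> R2" by auto
qed

lemma nbhd_R2:
  assumes "y \<in> V" "x \<in> nbhd R y" "w \<in> nbhd R x"
  shows "w \<in> nbhd R2 y"
proof -
  obtain g h where "g \<in> R" "x = g \<cdot> y" "h \<in> R" "w = h \<cdot> x" using assms by (auto simp: nbhd_def)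
  then show ?thesis using R2(2)[of h g] Rc assms(1)
    by (auto simp: nbhd_def act_mult intro!: image_eqI[of _ _ "h \<otimes> g"])
qed

lemma expand_ker_range: "finite_range R2 (expand_ker M)"
  unfolding finite_range_def expand_ker_def
  by (auto elim!: sum.not_neutral_contains_not_neutral split: if_splits intro: nbhd_R2)

text \<open>This places the image of \<open>expand\<close> in the algebra. Each summand is built
  from local ingredients: the factors \<open>\<sigma>\<close> by assumption, the labels by
  \<open>label_local\<close>, and the neighbourhood guard as nonemptiness of a local set of group
  elements.\<close>

lemma expand_ker_local: "local_ker (expand_ker M)"
  unfolding local_ker_def
proof (intro conjI ballI)
  show "\<exists>P. sym_fin P \<and> finite_range P (expand_ker M)" using expand_ker_range R2 by blast
  fix g assume g: "g \<in> carrier G"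
  show "stab_local (\<lambda>y. expand_ker M y (g \<cdot> y))"
    unfolding expand_ker_def
  proof (rule nbhd_sum_stab_local[OF R])
    fix h assume "h \<in> R"
    then have h: "h \<in> carrier G" using Rc by simp
    have "stab_local (\<lambda>y. u \<cdot> h \<cdot> y = g \<cdot> y)" if "u \<in> R" for u
      by (rule stab_local_cong[OF stab_local_eq[of "u \<otimes> h" g]]) (use Rc[OF that] g h in \<open>auto simp: act_mult\<close>)
    then have 1: "stab_local (\<lambda>y. {u \<in> R. u \<cdot> h \<cdot> y = g \<cdot> y})"
      by (rule stab_local_Collect[OF sym_finD(1)[OF R]])
    have nb: "g \<cdot> y \<in> nbhd R (h \<cdot> y) \<longleftrightarrow> {u \<in> R. u \<cdot> h \<cdot> y = g \<cdot> y} \<noteq> {}" for y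
      unfolding nbhd_def by (simp add: image_iff) metis
    have 2: "stab_local (\<lambda>y. label (h \<cdot> y) y)"
      by (rule stab_local_cong[OF stab_local_pair[where \<Xi>=label, OF label_local h one_closed]]) auto
    have 3: "stab_local (\<lambda>y. \<sigma> y (h \<cdot> y) * cnj (\<sigma> (g \<cdot> y) (h \<cdot> y)))"
      by (intro stab_local_comp2[where k="\<lambda>a b. a * cnj b"] stab_local_pair[where \<Xi>=\<sigma>, OF \<sigma>_local] \<sigma>_local g h)
    have 4: "stab_local (\<lambda>y. M (ket (label (h \<cdot> y) (g \<cdot> y))) (label (h \<cdot> y) y))"
      by (intro stab_local_comp2[where k="\<lambda>a b. M (ket a) b"] stab_local_pair[where \<Xi>=label, OF label_local] g h 2)
    have "stab_local (\<lambda>y. if {u \<in> R. u \<cdot> h \<cdot> y = g \<cdot> y} \<noteq> {}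
        then \<sigma> y (h \<cdot> y) * cnj (\<sigma> (g \<cdot> y) (h \<cdot> y)) * M (ket (label (h \<cdot> y) (g \<cdot> y))) (label (h \<cdot> y) y) else 0)"
      by (rule stab_local_comp2[OF 1 stab_local_comp2[OF 3 4, of "(*)"], of "\<lambda>U a. if U \<noteq> {} then a else 0"])
    then show "stab_local (\<lambda>y. if y \<in> V \<and> g \<cdot> y \<in> nbhd R (h \<cdot> y)
        then \<sigma> y (h \<cdot> y) * cnj (\<sigma> (g \<cdot> y) (h \<cdot> y)) * M (ket (label (h \<cdot> y) (g \<cdot> y))) (label (h \<cdot> y) y) else 0)"
      by (rule stab_local_cong) (simp add: nb)
  qed
qed

text \<open>The weak form of \<open>expand M\<close> = W* D W, where W sends f to the family of its
  slices and D applies M in every coordinate. Complete positivity and contractivity are both read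
  off from it. The proof sums over w first and then exchanges x and y by
  \<open>nbhd_sum_swap\<close>.\<close>

lemma expand_inner:
  assumes M: "M \<in> bounded_ops {..<k}" and f: "f \<in> ell2 V" and g: "g \<in> ell2 V"
  shows "((\<lambda>x. ell2_inner {..<k} (M (slice x f)) (slice x g)) has_sum ell2_inner V (expand M f) g) V"
proof -
  define F where "F x y w = \<sigma> y x * cnj (\<sigma> w x) * M (ket (label x w)) (label x y) * f w * cnj (g y)" for x y w
  define \<Phi> where "\<Phi> x y = (\<Sum>w\<in>nbhd R x. F x y w)" for x y
  obtain c where c: "\<And>x y. cmod (expand_ker M x y) \<le> c" using local_ker_bounded[OF expand_ker_local] by blast
  have inner: "ell2_inner {..<k} (M (slice x f)) (slice x g) = (\<Sum>y\<in>nbhd R x. \<Phi> x y)" if x: "x \<in> V" for x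
  proof -
    have kt: "ket (label x w) \<in> ell2 {..<k}" if "w \<in> nbhd R x" for w
      using label_less[OF x that] by (intro ket_ell2) simp
    have "M (slice x f) = (\<lambda>i. \<Sum>w\<in>nbhd R x. M (\<lambda>i. (cnj (\<sigma> w x) * f w) * ket (label x w) i) i)"
      unfolding slice_def by (rule bounded_ops_sum[OF M]) (intro ell2_scale kt)
    also have "\<dots> = (\<lambda>i. \<Sum>w\<in>nbhd R x. (cnj (\<sigma> w x) * f w) * M (ket (label x w)) i)"
      by (intro ext sum.cong refl) (simp only: bounded_opsD(4)[OF M kt])
    finally have MC: "M (slice x f) = (\<lambda>i. \<Sum>w\<in>nbhd R x. (cnj (\<sigma> w x) * f w) * M (ket (label x w)) i)" .
    have "ell2_inner {..<k} (slice x g) h = (\<Sum>y\<in>nbhd R x. cnj (\<sigma> y x) * g y * cnj (h (label x y)))" for h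
    proof -
      have "ell2_inner {..<k} (slice x g) h
          = (\<Sum>y\<in>nbhd R x. ell2_inner {..<k} (\<lambda>i. (cnj (\<sigma> y x) * g y) * ket (label x y) i) h)"
        if "h \<in> ell2 {..<k}" for h
        unfolding slice_def using that by (intro ell2_inner_sum_left ell2_scale kt)
      moreover have "ell2_inner {..<k} (\<lambda>i. (cnj (\<sigma> y x) * g y) * ket (label x y) i) h
          = cnj (\<sigma> y x) * g y * cnj (h (label x y))" if "y \<in> nbhd R x" for y h
        using ell2_inner_ket[of "label x y" "{..<k}" h] label_less[OF x that] ell2_inner_commute[of _ "ket (label x y)" h]
        by (simp add: ell2_inner_scale_left)
      moreover have "ell2_inner {..<k} (slice x g) h = ell2_inner {..<k} (slice x g) (\<lambda>i. if i < k then h i else 0)"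
        by (simp add: ell2_inner_finite)
      ultimately show ?thesis using label_less[OF x] by simp
    qed
    then have "ell2_inner {..<k} (M (slice x f)) (slice x g)
        = (\<Sum>y\<in>nbhd R x. \<sigma> y x * cnj (g y) * M (slice x f) (label x y))"
      by (subst ell2_inner_commute) simp
    also have "\<dots> = (\<Sum>y\<in>nbhd R x. \<Phi> x y)"
      unfolding MC \<Phi>_def F_def by (simp add: sum_distrib_left algebra_simps)
    finally show ?thesis .
  qed
  have Mb: "cmod (M (ket i) j) \<le> op_norm {..<k} M" if "i < k" "j < k" for i j
  proof -
    have i: "ket i \<in> ell2 {..<k}" using that by (intro ket_ell2) simp
    have "cmod (M (ket i) j) \<le> ell2_norm {..<k} (M (ket i))"
      using that by (intro ell2_point_le bounded_opsD(1)[OF M i]) simp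
    also have "\<dots> \<le> op_norm {..<k} M" using op_norm_bound[OF M i] that by (simp add: ell2_norm_ket)
    finally show ?thesis .
  qed
  \<comment> \<open>Matrix entries are bounded by the operator norm and the \<open>\<sigma>\<close>
    by 1, so \<open>\<Phi>\<close> is dominated by finitely many products of translates of f and
    g.\<close>
  have sm: "(\<lambda>x. norm (\<Phi> x (h \<cdot> x))) summable_on V" if h: "h \<in> R" for h
  proof (rule summable_on_comparison_test)
    let ?B = "\<lambda>x. \<Sum>u\<in>R. op_norm {..<k} M * (cmod (f (u \<cdot> x)) * cmod (g (h \<cdot> x)))"
    show "?B summable_on V"
      by (intro summable_on_finite_sum summable_on_cmult_right translate_product_summable Rc f g h)
    fix x assume x: "x \<in> V"
    have hx: "h \<cdot> x \<in> nbhd R x" using h by (auto simp: nbhd_def)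
    have "norm (\<Phi> x (h \<cdot> x)) \<le> (\<Sum>w\<in>nbhd R x. cmod (F x (h \<cdot> x) w))"
      unfolding \<Phi>_def by (rule norm_sum)
    also have "\<dots> \<le> (\<Sum>w\<in>nbhd R x. op_norm {..<k} M * (cmod (f w) * cmod (g (h \<cdot> x))))"
    proof (rule sum_mono)
      fix w assume w: "w \<in> nbhd R x"
      have "cmod (\<sigma> (h \<cdot> x) x) * cmod (\<sigma> w x) * cmod (M (ket (label x w)) (label x (h \<cdot> x))) \<le> 1 * 1 * op_norm {..<k} M"
        using w hx x nbhd_subset[OF R x] by (intro mult_mono \<sigma>_le_1 Mb label_less) auto
      then show "cmod (F x (h \<cdot> x) w) \<le> op_norm {..<k} M * (cmod (f w) * cmod (g (h \<cdot> x)))"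
        unfolding F_def by (simp add: norm_mult mult.assoc[of _ "cmod (f w)"] mult_right_mono)
    qed
    also have "\<dots> \<le> ?B x"
      unfolding nbhd_def
      using sum_image_le[of R "\<lambda>w. op_norm {..<k} M * (cmod (f w) * cmod (g (h \<cdot> x)))" "\<lambda>u. u \<cdot> x"]
        sym_finD(1)[OF R] op_norm_nonneg[OF M] by (simp add: comp_def)
    finally show "norm (\<Phi> x (h \<cdot> x)) \<le> ?B x" .
  qed auto
  have "ell2_inner V (expand M f) g = (\<Sum>\<^sub>\<infinity>y\<in>V. \<Sum>w\<in>nbhd R2 y. expand_ker M y w * f w * cnj (g y))"
    unfolding expand_def by (rule kernel_op_inner[OF R2(1) expand_ker_range c f g])
  also have "\<dots> = (\<Sum>\<^sub>\<infinity>y\<in>V. \<Sum>x\<in>nbhd R y. \<Phi> x y)"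
  proof (rule infsum_cong)
    fix y assume y: "y \<in> V"
    have "(\<Sum>w\<in>nbhd R2 y. expand_ker M y w * f w * cnj (g y))
        = (\<Sum>w\<in>nbhd R2 y. \<Sum>x\<in>nbhd R y. if w \<in> nbhd R x then F x y w else 0)"
      unfolding expand_ker_def F_def using y by (auto simp: sum_distrib_right intro!: sum.cong)
    also have "\<dots> = (\<Sum>x\<in>nbhd R y. \<Sum>w\<in>nbhd R2 y. if w \<in> nbhd R x then F x y w else 0)"
      by (rule sum.swap)
    also have "\<dots> = (\<Sum>x\<in>nbhd R y. \<Phi> x y)"
      unfolding \<Phi>_def
    proof (rule sum.cong[OF refl])
      fix x assume x: "x \<in> nbhd R y"
      \<comment> \<open>The R-ball of x lies inside the R2-ball of y, so the guarded sum over the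
        latter is the full sum over the former.\<close>
      have "nbhd R2 y \<inter> nbhd R x = nbhd R x" using nbhd_R2[OF y x] by blast
      then show "(\<Sum>w\<in>nbhd R2 y. if w \<in> nbhd R x then F x y w else 0) = sum (F x y) (nbhd R x)"
        by (simp add: nbhd_finite[OF R2(1)] flip: sum.inter_restrict)
    qed
    finally show "(\<Sum>w\<in>nbhd R2 y. expand_ker M y w * f w * cnj (g y)) = (\<Sum>x\<in>nbhd R y. \<Phi> x y)" .
  qed
  also have "\<dots> = (\<Sum>\<^sub>\<infinity>x\<in>V. \<Sum>y\<in>nbhd R x. \<Phi> x y)" by (rule nbhd_sum_swap[where \<Phi>=\<Phi>, OF R sm, symmetric])
  finally have "((\<lambda>x. \<Sum>y\<in>nbhd R x. \<Phi> x y) has_sum ell2_inner V (expand M f) g) V"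
    using has_sum_infsum[OF nbhd_sum_summable[where \<Phi>=\<Phi>, OF R sm]] by simp
  then show ?thesis by (subst has_sum_cong[OF inner])
qed

lemma expand_bounded: "expand M \<in> bounded_ops V"
  unfolding expand_def by (rule local_ker_bounded_ops[OF expand_ker_local])

text \<open>\<open>expand M f\<close> is tested against itself: the coordinatewise bound by the norm
  of M, Cauchy-Schwarz over V and \<open>slice_isometry\<close> bound its squared norm, and one
  factor cancels.\<close>

lemma expand_norm:
  assumes M: "M \<in> bounded_ops {..<k}"
  shows "op_norm V (expand M) \<le> op_norm {..<k} M"
proof (rule op_norm_le[OF op_norm_nonneg[OF M]])
  fix f assume f: "f \<in> ell2 V"
  define g where "g = expand M f"
  have g: "g \<in> ell2 V" unfolding g_def by (rule bounded_opsD(1)[OF expand_bounded f])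
  let ?m = "op_norm {..<k} M" and ?F = "\<lambda>f x. if x \<in> V then complex_of_real (ell2_norm {..<k} (slice x f)) else 0"
  note Ff = slice_isometry[OF f] and Fg = slice_isometry[OF g]
  have le: "cmod (ell2_inner {..<k} (M (slice x f)) (slice x g)) \<le> ?m * (cmod (?F f x) * cmod (?F g x))"
    if x: "x \<in> V" for x
  proof -
    have "cmod (ell2_inner {..<k} (M (slice x f)) (slice x g)) \<le> ell2_norm {..<k} (M (slice x f)) * ell2_norm {..<k} (slice x g)"
      by (intro ell2_Cauchy_Schwarz bounded_opsD(1)[OF M] slice_ell2 x)
    also have "\<dots> \<le> (?m * ell2_norm {..<k} (slice x f)) * ell2_norm {..<k} (slice x g)"
      by (intro mult_right_mono op_norm_bound[OF M] slice_ell2 x) auto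
    finally show ?thesis using x by (simp add: mult.assoc)
  qed
  have sm: "(\<lambda>x. ?m * (cmod (?F f x) * cmod (?F g x))) summable_on V"
    by (intro summable_on_cmult_right ell2_product_summable(1) Ff Fg)
  have sm': "(\<lambda>x. cmod (ell2_inner {..<k} (M (slice x f)) (slice x g))) summable_on V"
    by (rule summable_on_comparison_test[OF sm le]) auto
  have "(ell2_norm V g)\<^sup>2 = cmod (ell2_inner V (expand M f) g)"
    using ell2_inner_self[OF g] unfolding g_def by (metis abs_of_nonneg norm_of_real zero_le_power2)
  also have "\<dots> = cmod (\<Sum>\<^sub>\<infinity>x\<in>V. ell2_inner {..<k} (M (slice x f)) (slice x g))"
    using expand_inner[OF M f g] by (simp add: infsumI)
  also have "\<dots> \<le> (\<Sum>\<^sub>\<infinity>x\<in>V. cmod (ell2_inner {..<k} (M (slice x f)) (slice x g)))"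
    by (rule norm_infsum_bound[OF sm'])
  also have "\<dots> \<le> (\<Sum>\<^sub>\<infinity>x\<in>V. ?m * (cmod (?F f x) * cmod (?F g x)))"
    by (rule infsum_mono[OF sm' sm le])
  also have "\<dots> = ?m * (\<Sum>\<^sub>\<infinity>x\<in>V. cmod (?F f x) * cmod (?F g x))"
    by (rule infsum_cmult_right')
  also have "\<dots> \<le> ?m * (ell2_norm V (?F f) * ell2_norm V (?F g))"
    by (intro mult_left_mono ell2_product_summable(2) op_norm_nonneg[OF M] Ff Fg)
  also have "\<dots> = ?m * (ell2_norm V f * ell2_norm V g)" by (simp only: Ff(2) Fg(2))
  finally have "ell2_norm V g * ell2_norm V g \<le> ell2_norm V g * (?m * ell2_norm V f)"
    by (simp add: power2_eq_square algebra_simps)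
  then have "ell2_norm V g \<le> ?m * ell2_norm V f"
    using op_norm_nonneg[OF M] ell2_norm_nonneg[of V g]
    by (cases "ell2_norm V g = 0") (auto simp: mult_le_cancel_left)
  then show "ell2_norm V (expand M f) \<le> ?m * ell2_norm V f" by (simp add: g_def)
qed

lemma expand_add: "expand (op_add S T) = op_add (expand S) (expand T)"
proof -
  have "expand_ker (op_add S T) = (\<lambda>x y. expand_ker S x y + expand_ker T x y)"
    by (auto simp: expand_ker_def op_add_def fun_eq_iff distrib_left simp flip: sum.distrib intro!: sum.cong)
  then show ?thesis unfolding expand_def using local_ker_add(2)[OF expand_ker_local expand_ker_local] by simp
qed

lemma expand_scale: "expand (op_scale c T) = op_scale c (expand T)"
proof -
  have "expand_ker (op_scale c T) = (\<lambda>x y. c * expand_ker T x y)"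
    by (auto simp: expand_ker_def op_scale_def fun_eq_iff sum_distrib_left intro!: sum.cong)
  then show ?thesis unfolding expand_def using local_ker_scale(2)[OF expand_ker_local] by simp
qed

text \<open>At each x the given matrix is positive on the slices of the vectors
  \<open>\<xi> i\<close>; summing over x by \<open>expand_inner\<close> preserves
  nonnegativity.\<close>

lemma expand_cp: "completely_positive {..<k} (bounded_ops {..<k}) V expand"
  unfolding completely_positive_def
proof (intro allI impI)
  fix n :: nat and a :: "nat \<Rightarrow> nat \<Rightarrow> nat operator"
  assume a: "\<forall>i<n. \<forall>j<n. a i j \<in> bounded_ops {..<k}" and pos: "positive_op_matrix {..<k} n a"
  show "positive_op_matrix V n (\<lambda>i j. expand (a i j))"
    unfolding positive_op_matrix_def
  proof (intro allI impI)
    fix \<xi> :: "nat \<Rightarrow> 'v \<Rightarrow> complex" assume \<xi>: "\<forall>i<n. \<xi> i \<in> ell2 V"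
    have hs: "((\<lambda>x. \<Sum>i<n. \<Sum>j<n. ell2_inner {..<k} (a i j (slice x (\<xi> j))) (slice x (\<xi> i))) has_sum
        (\<Sum>i<n. \<Sum>j<n. ell2_inner V (expand (a i j) (\<xi> j)) (\<xi> i))) V"
      by (intro has_sum_finite_sum expand_inner) (use a \<xi> in auto)
    have "(\<Sum>i<n. \<Sum>j<n. ell2_inner {..<k} (a i j (slice x (\<xi> j))) (slice x (\<xi> i))) \<in> \<real>\<^sub>\<ge>\<^sub>0" if "x \<in> V" for x
      using pos[unfolded positive_op_matrix_def, rule_format, of "\<lambda>i. slice x (\<xi> i)"] slice_ell2[OF that] by simp
    then show "(\<Sum>i<n. \<Sum>j<n. ell2_inner V (expand (a i j) (\<xi> j)) (\<xi> i)) \<in> \<real>\<^sub>\<ge>\<^sub>0"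
      using infsum_nonneg_Reals[OF has_sum_imp_summable[OF hs]] infsumI[OF hs] by simp
  qed
qed

lemma expand_ccp: "ccp_map {..<k} (bounded_ops {..<k}) V local_alg expand"
proof -
  have "expand M \<in> local_alg" for M
    unfolding expand_def local_alg_def
    using op_closure_subset[of "kernel_op V ` {K. local_ker K}" V] local_ker_bounded_ops expand_ker_local by blast
  then show ?thesis
    unfolding ccp_map_def using expand_add expand_scale expand_cp expand_norm by auto
qed

text \<open>For x near both y and w, passing to the representative leaves the entry of K unchanged
  by assumption \<open>rep\<close>. So K y w factors out of the sum over x, and the remaining sum is
  the inner product of \<open>\<sigma> y\<close> and \<open>\<sigma> w\<close>.\<close>

lemma expand_compress_ker:
  assumes K: "local_ker K"
    and rep: "\<And>u v x. u \<in> R \<Longrightarrow> v \<in> R \<Longrightarrow> x \<in> V \<Longrightarrow> K (u \<cdot> x) (v \<cdot> x) = K (u \<cdot> rep x) (v \<cdot> rep x)"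
    and y: "y \<in> V" and w: "w \<in> V"
  shows "expand_ker (compress (\<Union>x\<in>V. nbhd R (rep x)) e {..<k} (kernel_op V K)) y w
    = K y w * ell2_inner V (\<sigma> y) (\<sigma> w)"
proof -
  let ?E = "\<Union>x\<in>V. nbhd R (rep x)"
  have E: "?E \<subseteq> V" using nbhd_subset[OF R] rep_closed by blast
  have *: "compress ?E e {..<k} (kernel_op V K) (ket (label x w)) (label x y) = K y w"
    if x: "x \<in> nbhd R y" "w \<in> nbhd R x" for x
  proof -
    have xV: "x \<in> V" using nbhd_subset[OF R y x(1)] .
    have yx: "y \<in> nbhd R x" using nbhd_sym[OF R y x(1)] .
    obtain u v where uv: "u \<in> R" "y = u \<cdot> x" "v \<in> R" "w = v \<cdot> x" using x yx by (auto simp: nbhd_def)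
    have "compress ?E e {..<k} (kernel_op V K) (ket (label x w)) (label x y) = K (to_rep x y) (to_rep x w)"
      unfolding label_def by (rule compress_kernel_op_ket[OF E e_bij to_rep_mem[OF xV x(2)] to_rep_mem[OF xV yx]])
    then show ?thesis using uv xV to_rep_act rep by simp
  qed
  have "expand_ker (compress ?E e {..<k} (kernel_op V K)) y w
      = (\<Sum>x\<in>nbhd R y. K y w * (\<sigma> y x * cnj (\<sigma> w x)))"
    unfolding expand_ker_def
  proof (intro sum.cong refl)
    fix x assume x: "x \<in> nbhd R y"
    \<comment> \<open>Hence the guard in \<open>expand_ker\<close> discards only terms that vanish
      anyway.\<close>
    have "\<sigma> w x = 0" if "w \<notin> nbhd R x"
      using \<sigma>_supp[OF w, of x] nbhd_sym[OF R w, of x] that by blast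
    then show "(if y \<in> V \<and> w \<in> nbhd R x then \<sigma> y x * cnj (\<sigma> w x) *
        compress ?E e {..<k} (kernel_op V K) (ket (label x w)) (label x y) else 0) = K y w * (\<sigma> y x * cnj (\<sigma> w x))"
      using *[OF x] y by simp
  qed
  also have "\<dots> = K y w * (\<Sum>\<^sub>\<infinity>x\<in>nbhd R y. \<sigma> y x * cnj (\<sigma> w x))"
    using nbhd_finite[OF R] by (simp add: sum_distrib_left)
  also have "(\<Sum>\<^sub>\<infinity>x\<in>nbhd R y. \<sigma> y x * cnj (\<sigma> w x)) = ell2_inner V (\<sigma> y) (\<sigma> w)"
    unfolding ell2_inner_def
    using \<sigma>_supp[OF y] nbhd_subset[OF R y] by (intro infsum_cong_neutral) auto
  finally show ?thesis .
qed

lemma expand_compress_norm: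
  assumes K: "local_ker K" "sym_fin P" "finite_range P K" "\<And>x y. cmod (K x y) \<le> c"
    and rep: "\<And>u v x. u \<in> R \<Longrightarrow> v \<in> R \<Longrightarrow> x \<in> V \<Longrightarrow> K (u \<cdot> x) (v \<cdot> x) = K (u \<cdot> rep x) (v \<cdot> rep x)"
    and \<sigma>: "\<And>g x. g \<in> P \<Longrightarrow> x \<in> V \<Longrightarrow> ell2_norm V (\<lambda>v. \<sigma> x v - \<sigma> (g \<cdot> x) v) \<le> \<epsilon>"
    and "0 \<le> \<epsilon>"
  shows "op_norm V (op_diff (expand (compress (\<Union>x\<in>V. nbhd R (rep x)) e {..<k} (kernel_op V K)))
    (kernel_op V K)) \<le> c * \<epsilon> * card P"
proof -
  let ?L = "expand_ker (compress (\<Union>x\<in>V. nbhd R (rep x)) e {..<k} (kernel_op V K))"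
  \<comment> \<open>The difference is written as a sum with the multiple -1 so that
    \<open>op_diff_eq\<close> and \<open>local_ker_add\<close> apply.\<close>
  define D where "D = (\<lambda>x y. ?L x y + - 1 * K x y)"
  have c: "0 \<le> c" using K(4) norm_ge_zero order_trans by blast
  have L0: "x \<in> V \<and> y \<in> V" if "?L x y \<noteq> 0" for x y
    using expand_ker_range nbhd_subset[OF R2(1)] that unfolding finite_range_def by blast
  have K0: "x \<in> V \<and> y \<in> V" if "K x y \<noteq> 0" for x y
    using K(3) nbhd_subset[OF K(2)] that unfolding finite_range_def by blast
  have D: "D x y = K x y * (ell2_inner V (\<sigma> x) (\<sigma> y) - 1)" for x y
  proof (cases "x \<in> V \<and> y \<in> V")
    case True
    then show ?thesis unfolding D_def using expand_compress_ker[OF K(1) rep] by (simp add: algebra_simps)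
  next
    case False
    then have "?L x y = 0" "K x y = 0" using L0[of x y] K0[of x y] by blast+
    then show ?thesis by (simp add: D_def)
  qed
  have "cmod (D x y) \<le> c * \<epsilon>" for x y
  proof (cases "K x y = 0")
    case True
    then show ?thesis using c \<open>0 \<le> \<epsilon>\<close> by (simp add: D)
  next
    case False
    then obtain g where g: "g \<in> P" "y = g \<cdot> x" and x: "x \<in> V"
      using K(3) by (auto simp: finite_range_def nbhd_def)
    then have y: "y \<in> V" using sym_finD(2)[OF K(2)] by simp
    note d = ell2_diff(1)[OF \<sigma>_ell2[OF y] \<sigma>_ell2[OF x]]
    \<comment> \<open>The number 1 is the inner product of the unit vector \<open>\<sigma> x\<close>
      with itself, so the multiplier error becomes a pairing with \<open>\<sigma> y\<close> -
      \<open>\<sigma> x\<close>.\<close>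
    have "ell2_inner V (\<sigma> x) (\<sigma> y) - 1 = ell2_inner V (\<sigma> x) (\<lambda>v. \<sigma> y v - \<sigma> x v)"
      using ell2_inner_diff_right[OF \<sigma>_ell2[OF y] \<sigma>_ell2[OF x] \<sigma>_ell2[OF x]]
        ell2_inner_self[OF \<sigma>_ell2[OF x]] \<sigma>_norm[OF x] by simp
    then have "cmod (ell2_inner V (\<sigma> x) (\<sigma> y) - 1) \<le> ell2_norm V (\<sigma> x) * ell2_norm V (\<lambda>v. \<sigma> y v - \<sigma> x v)"
      using ell2_Cauchy_Schwarz[OF \<sigma>_ell2[OF x] d] by simp
    also have "\<dots> \<le> \<epsilon>"
      using \<sigma>[OF g(1) x] \<sigma>_norm[OF x] g(2) ell2_norm_minus_commute[of V "\<sigma> y" "\<sigma> x"] by simp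
    finally show ?thesis unfolding D norm_mult using K(4) c by (intro mult_mono) auto
  qed
  moreover have "finite_range P D" using K(3) by (auto simp: D finite_range_def)
  ultimately have "op_norm V (kernel_op V D) \<le> c * \<epsilon> * card P"
    by (intro finite_range_op_norm(2)[OF K(2)])
  moreover have "op_diff (kernel_op V ?L) (kernel_op V K) = kernel_op V D"
    unfolding op_diff_eq D_def local_ker_scale(2)[OF K(1)]
    by (rule local_ker_add(2)[OF expand_ker_local local_ker_scale(1)[OF K(1)]])
  ultimately show ?thesis by (simp add: expand_def)
qed

end

section \<open>From almost invariant local unit vectors to nuclearity\<close>

context left_action
begin

text \<open>Local Property A restated for the action: P is the prescribed scale of near invariance,
  \<open>\<epsilon>\<close> the tolerance and R the resulting support radius.\<close>

definition local_unit_vectors :: bool where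
  "local_unit_vectors \<longleftrightarrow> (\<forall>P \<epsilon>. sym_fin P \<longrightarrow> 0 < \<epsilon> \<longrightarrow> (\<exists>\<sigma> R. sym_fin R \<and>
      (\<forall>x\<in>V. \<sigma> x \<in> ell2 V \<and> ell2_norm V (\<sigma> x) = 1 \<and> (\<forall>v. \<sigma> x v \<noteq> 0 \<longrightarrow> v \<in> nbhd R x)) \<and>
      (\<forall>g\<in>P. \<forall>x\<in>V. ell2_norm V (\<lambda>v. \<sigma> x v - \<sigma> (g \<cdot> x) v) \<le> \<epsilon>) \<and>
      (\<forall>g\<in>carrier G. stab_local (\<lambda>x. \<sigma> x (g \<cdot> x)))))"

lemma local_alg_bounded: "local_alg \<subseteq> bounded_ops V"
  using local_alg_cstar by (simp add: cstar_subalgebra_def)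

lemma local_alg_approx:
  assumes "finite \<K>" and loc: "\<And>K. K \<in> \<K> \<Longrightarrow> local_ker K" and "0 < \<delta>"
    and A: local_unit_vectors
  shows "\<exists>(k::nat) \<phi> \<psi>. ccp_map V local_alg {..<k} (bounded_ops {..<k}) \<phi> \<and>
    ccp_map {..<k} (bounded_ops {..<k}) V local_alg \<psi> \<and>
    (\<forall>K\<in>\<K>. op_norm V (op_diff (\<psi> (\<phi> (kernel_op V K))) (kernel_op V K)) < \<delta>)"
proof -
  obtain P where P: "sym_fin P" "\<And>K. K \<in> \<K> \<Longrightarrow> finite_range P K"
    using common_range[OF assms(1) loc] by blast
  have "\<forall>K\<in>\<K>. \<exists>c. \<forall>x y. cmod (K x y) \<le> c" using local_ker_bounded loc by metis
  then obtain c0 where c0: "\<And>K x y. K \<in> \<K> \<Longrightarrow> cmod (K x y) \<le> c0 K" by metis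
  define c where "c = (\<Sum>K\<in>\<K>. \<bar>c0 K\<bar>)"
  have c: "cmod (K x y) \<le> c" if "K \<in> \<K>" for K x y
  proof -
    have "\<bar>c0 K\<bar> \<le> c" unfolding c_def by (rule member_le_sum) (use assms(1) that in auto)
    then show ?thesis using c0[OF that, of x y] by linarith
  qed
  have "0 \<le> c" unfolding c_def by (simp add: sum_nonneg)
  \<comment> \<open>Chosen so that the bound \<open>c * \<epsilon> * card P\<close> of
    \<open>expand_compress_norm\<close> is strictly below \<open>\<delta>\<close>; the summand 1
    covers a vanishing product of c and \<open>card P\<close>.\<close>
  define \<epsilon> where "\<epsilon> = \<delta> / (c * card P + 1)"
  have pos: "0 < c * card P + 1" using \<open>0 \<le> c\<close> by (simp add: add_nonneg_pos)
  then have \<epsilon>: "0 < \<epsilon>" "c * \<epsilon> * card P < \<delta>"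
    using \<open>0 < \<delta>\<close> by (auto simp: \<epsilon>_def field_simps)
  obtain \<sigma> R where R: "sym_fin R"
    and \<sigma>: "\<forall>x\<in>V. \<sigma> x \<in> ell2 V \<and> ell2_norm V (\<sigma> x) = 1 \<and> (\<forall>v. \<sigma> x v \<noteq> 0 \<longrightarrow> v \<in> nbhd R x)"
      "\<forall>g\<in>P. \<forall>x\<in>V. ell2_norm V (\<lambda>v. \<sigma> x v - \<sigma> (g \<cdot> x) v) \<le> \<epsilon>"
      "\<forall>g\<in>carrier G. stab_local (\<lambda>x. \<sigma> x (g \<cdot> x))"
    using A P(1) \<epsilon>(1) unfolding local_unit_vectors_def by blast
  note Rf = sym_finD(1)[OF R] and Rc = sym_finD(2)[OF R]
  \<comment> \<open>The type of x records what a representative has to share with x: the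
    coincidences among its R-translates, for \<open>rep_act\<close>, and the entries of the given
    kernels between them, for \<open>expand_compress_norm\<close>.\<close>
  define \<tau> where "\<tau> x = (\<lambda>p\<in>R \<times> R. (fst p \<cdot> x = snd p \<cdot> x, \<lambda>K\<in>\<K>. K (fst p \<cdot> x) (snd p \<cdot> x)))" for x
  have \<tau>: "stab_local \<tau>"
    unfolding \<tau>_def
    by (intro stab_local_family stab_local_comp2[where k=Pair] stab_local_eq local_kerD loc finite_cartesian_product)
      (use assms(1) Rf Rc in auto)
  \<comment> \<open>Choosing the representative through the type makes it a function of local data,
    so it is local and takes finitely many values.\<close>
  define rep where "rep x = inv_into V \<tau> (\<tau> x)" for x
  have rep: "rep x \<in> V" "\<tau> (rep x) = \<tau> x" if "x \<in> V" for x
    using that unfolding rep_def by (auto intro: inv_into_into f_inv_into_f)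
  have rep_local: "stab_local rep" unfolding rep_def by (rule stab_local_comp[OF \<tau>])
  have rep_pair: "u \<cdot> x = v \<cdot> x \<longleftrightarrow> u \<cdot> rep x = v \<cdot> rep x"
    "K \<in> \<K> \<Longrightarrow> K (u \<cdot> x) (v \<cdot> x) = K (u \<cdot> rep x) (v \<cdot> rep x)"
    if "x \<in> V" "u \<in> R" "v \<in> R" for u v x K
    using fun_cong[OF rep(2)[OF that(1)], of "(u, v)"] that
    by (auto simp: \<tau>_def dest: fun_cong[of _ _ K])
  define E where "E = (\<Union>x\<in>V. nbhd R (rep x))"
  \<comment> \<open>Indexing by the finite set of representatives, rather than by V, exhibits the
    union as finite.\<close>
  have "finite (\<Union>r\<in>rep ` V. nbhd R r)"
    using stab_local_finite_range[OF rep_local] nbhd_finite[OF R] by blast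
  then have E: "finite E" "E \<subseteq> V"
    using nbhd_subset[OF R] rep(1) by (auto simp: E_def)
  obtain e where e: "bij_betw e E {..<card E}"
    using ex_bij_betw_finite_nat[OF E(1)] by (auto simp: atLeast0LessThan)
  interpret local_partition G V act R \<sigma> rep e "card E"
    by unfold_locales (use R \<sigma> rep rep_local rep_pair e in \<open>auto simp: E_def\<close>)
  have "op_norm V (op_diff (expand (compress E e {..<card E} (kernel_op V K))) (kernel_op V K)) < \<delta>"
    if K: "K \<in> \<K>" for K
    using expand_compress_norm[OF loc[OF K] P(1) P(2)[OF K] c[OF K], of \<epsilon>] rep_pair(2)[OF _ _ _ K] \<sigma>(2) \<epsilon>
    by (fastforce simp: E_def)
  then show ?thesis
    using compress_ccp[OF E e local_alg_bounded] expand_ccp by blast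
qed

text \<open>An argument by thirds: T is within \<open>\<epsilon> / 3\<close> of a kernel operator S,
  contractivity of both maps carries this distance to their images, and
  \<open>local_alg_approx\<close> handles S.\<close>

theorem nuclear_local_alg:
  assumes A: local_unit_vectors
  shows "nuclear V local_alg"
  unfolding nuclear_def
proof (intro conjI allI impI local_alg_cstar)
  fix F :: "'v operator set" and \<epsilon> :: real
  assume F: "finite F" "F \<subseteq> local_alg" and \<epsilon>: "0 < \<epsilon>"
  have "\<forall>T\<in>F. \<exists>K. local_ker K \<and> op_norm V (op_diff T (kernel_op V K)) < \<epsilon> / 3"
  proof
    fix T assume "T \<in> F"
    then have "\<forall>e>0. \<exists>S\<in>kernel_op V ` {K. local_ker K}. op_norm V (op_diff T S) < e"
      using F(2) unfolding local_alg_def op_closure_def by blast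
    moreover have "\<epsilon> / 3 > 0" using \<epsilon> by simp
    ultimately show "\<exists>K. local_ker K \<and> op_norm V (op_diff T (kernel_op V K)) < \<epsilon> / 3" by blast
  qed
  then obtain \<kappa> where \<kappa>: "\<And>T. T \<in> F \<Longrightarrow> local_ker (\<kappa> T) \<and> op_norm V (op_diff T (kernel_op V (\<kappa> T))) < \<epsilon> / 3"
    by metis
  have "\<exists>(k::nat) \<phi> \<psi>. ccp_map V local_alg {..<k} (bounded_ops {..<k}) \<phi> \<and>
    ccp_map {..<k} (bounded_ops {..<k}) V local_alg \<psi> \<and>
    (\<forall>K\<in>\<kappa> ` F. op_norm V (op_diff (\<psi> (\<phi> (kernel_op V K))) (kernel_op V K)) < \<epsilon> / 3)"
    by (rule local_alg_approx[OF _ _ _ A]) (use F \<kappa> \<epsilon> in auto)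
  then obtain k :: nat and \<phi> \<psi> where \<phi>: "ccp_map V local_alg {..<k} (bounded_ops {..<k}) \<phi>"
    and \<psi>: "ccp_map {..<k} (bounded_ops {..<k}) V local_alg \<psi>"
    and *: "\<And>T. T \<in> F \<Longrightarrow> op_norm V (op_diff (\<psi> (\<phi> (kernel_op V (\<kappa> T)))) (kernel_op V (\<kappa> T))) < \<epsilon> / 3"
    by blast
  have "op_norm V (op_diff (\<psi> (\<phi> T)) T) < \<epsilon>" if T: "T \<in> F" for T
  proof -
    define S where "S = kernel_op V (\<kappa> T)"
    have TA: "T \<in> local_alg" using F(2) T by blast
    have SA: "S \<in> local_alg"
      using op_closure_subset[of "kernel_op V ` {K. local_ker K}" V] local_ker_bounded_ops \<kappa>[OF T]
      unfolding S_def local_alg_def by blast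
    have scA: "op_scale (- 1) S \<in> local_alg" and DA: "op_diff T S \<in> local_alg"
      using local_alg_cstar TA SA unfolding op_diff_eq cstar_subalgebra_def by blast+
    have mem\<phi>: "\<phi> R \<in> bounded_ops {..<k}" if "R \<in> local_alg" for R
      using \<phi> that unfolding ccp_map_def by blast
    have mem\<psi>: "\<psi> R \<in> bounded_ops V" if "R \<in> bounded_ops {..<k}" for R
      using \<psi> that local_alg_bounded unfolding ccp_map_def by blast
    \<comment> \<open>Linearity in \<open>ccp_map\<close> is phrased with sums and multiples, so the
      difference is treated as a sum with the multiple -1 of S, which lies in the algebra.\<close>
    have "\<phi> (op_diff T S) = op_diff (\<phi> T) (\<phi> S)"
      using \<phi> TA SA scA unfolding op_diff_eq ccp_map_def by metis
    moreover have "\<psi> (op_diff (\<phi> T) (\<phi> S)) = op_diff (\<psi> (\<phi> T)) (\<psi> (\<phi> S))"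
      using \<psi> mem\<phi>[OF TA] mem\<phi>[OF SA] op_scale_bounded(1)[OF mem\<phi>[OF SA]] unfolding op_diff_eq ccp_map_def
      by metis
    ultimately have "op_norm V (op_diff (\<psi> (\<phi> T)) (\<psi> (\<phi> S))) = op_norm V (\<psi> (\<phi> (op_diff T S)))"
      by simp
    also have "\<dots> \<le> op_norm {..<k} (\<phi> (op_diff T S))"
      using \<psi> mem\<phi>[OF DA] unfolding ccp_map_def by blast
    also have "\<dots> \<le> op_norm V (op_diff T S)"
      using \<phi> DA unfolding ccp_map_def by blast
    also have "\<dots> < \<epsilon> / 3" using \<kappa>[OF T] by (simp add: S_def)
    finally have 1: "op_norm V (op_diff (\<psi> (\<phi> T)) (\<psi> (\<phi> S))) < \<epsilon> / 3" .
    have Tb: "T \<in> bounded_ops V" and Sb: "S \<in> bounded_ops V" using TA SA local_alg_bounded by auto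
    note \<psi>T = mem\<psi>[OF mem\<phi>[OF TA]] and \<psi>S = mem\<psi>[OF mem\<phi>[OF SA]]
    have "op_norm V (op_diff (\<psi> (\<phi> T)) T)
        \<le> op_norm V (op_diff (\<psi> (\<phi> T)) (\<psi> (\<phi> S))) + op_norm V (op_diff (\<psi> (\<phi> S)) T)"
      by (rule op_norm_diff_triangle[OF \<psi>T \<psi>S Tb])
    also have "op_norm V (op_diff (\<psi> (\<phi> S)) T) \<le> op_norm V (op_diff (\<psi> (\<phi> S)) S) + op_norm V (op_diff S T)"
      by (rule op_norm_diff_triangle[OF \<psi>S Sb Tb])
    also have "op_norm V (op_diff S T) = op_norm V (op_diff T S)" by (rule op_norm_diff_commute)
    finally show ?thesis using 1 *[OF T] \<kappa>[OF T] by (simp add: S_def)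
  qed
  then show "\<exists>(k::nat) \<phi> \<psi>. ccp_map V local_alg {..<k} (bounded_ops {..<k}) \<phi> \<and>
      ccp_map {..<k} (bounded_ops {..<k}) V local_alg \<psi> \<and> (\<forall>T\<in>F. op_norm V (op_diff (\<psi> (\<phi> T)) T) < \<epsilon>)"
    using \<phi> \<psi> by blast
qed

end


section \<open>Schreier graphs\<close>

locale schreier_graph = group G for G :: "('a, 'b) monoid_scheme" (structure) +
  fixes Q H :: "'a set"
  assumes Q: "finite Q" "Q \<subseteq> carrier G" "generate G Q = carrier G" and H: "subgroup H G"
begin

abbreviation coset_act :: "'a \<Rightarrow> 'a set \<Rightarrow> 'a set" (infixr "\<cdot>" 75) where
  "g \<cdot> x \<equiv> g <# x"

lemma coset_subset: "x \<in> lcosets H \<Longrightarrow> x \<subseteq> carrier G"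
  using subgroup.subset[OF H] l_coset_subset_G by (auto simp: LCOSETS_def)

sublocale left_action G "lcosets H" "l_coset G"
proof
  fix g x assume g: "g \<in> carrier G" and x: "x \<in> lcosets H"
  then obtain a where a: "a \<in> carrier G" "x = a \<cdot> H" by (auto simp: LCOSETS_def)
  then show "g \<cdot> x \<in> lcosets H"
    using g lcos_m_assoc[OF subgroup.subset[OF H] g a(1)] by (auto simp: LCOSETS_def)
  fix h assume "h \<in> carrier G"
  then show "(g \<otimes> h) \<cdot> x = g \<cdot> h \<cdot> x" using lcos_m_assoc[OF coset_subset[OF x] g] by simp
next
  fix x assume "x \<in> lcosets H"
  then show "\<one> \<cdot> x = x" by (intro lcos_mult_one coset_subset)
qed

lemma act_transitive:
  assumes "x \<in> lcosets H" "y \<in> lcosets H"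
  obtains g where "g \<in> carrier G" "y = g \<cdot> x"
proof -
  obtain a b where ab: "a \<in> carrier G" "x = a \<cdot> H" "b \<in> carrier G" "y = b \<cdot> H"
    using assms by (auto simp: LCOSETS_def)
  then have "y = (b \<otimes> inv a) \<cdot> x"
    by (simp add: lcos_m_assoc[OF subgroup.subset[OF H]] m_assoc)
  then show ?thesis using that[of "b \<otimes> inv a"] ab by simp
qed

abbreviation V :: "'a set set" where "V \<equiv> lcosets H"

section \<open>Words in the generators and the graph metric\<close>

primrec words :: "nat \<Rightarrow> 'a set" where
  "words 0 = {\<one>}"
| "words (Suc n) = (\<lambda>(s, g). s \<otimes> g) ` ((Q \<union> m_inv G ` Q) \<times> words n)"

lemma words: "finite (words n)" "words n \<subseteq> carrier G"
  using Q by (induction n) auto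

lemma words_exhaust: "(\<Union>n. words n) = carrier G"
proof
  show "(\<Union>n. words n) \<subseteq> carrier G" using words(2) by blast
  have step: "s \<otimes> g \<in> (\<Union>n. words n)" if s: "s \<in> Q \<union> m_inv G ` Q" and g: "g \<in> (\<Union>n. words n)" for s g
  proof -
    obtain n where "g \<in> words n" using g by blast
    then have "s \<otimes> g \<in> words (Suc n)" using s by force
    then show ?thesis by blast
  qed
  \<comment> \<open>The claim is strengthened to products with an arbitrary word g:
    \<open>generate\<close> multiplies two generated elements, whereas words grow by one letter on
    the left, and associativity mediates between the two.\<close>
  have "h \<otimes> g \<in> (\<Union>n. words n)" if "h \<in> generate G Q" "g \<in> (\<Union>n. words n)" for h g
    using that
  proof (induction arbitrary: g)
    case one
    then have "g \<in> carrier G" using words(2) by blast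
    then show ?case using one by simp
  next
    case (eng h1 h2)
    then have "h1 \<in> carrier G" "h2 \<in> carrier G" "g \<in> carrier G"
      using Q(3) words(2) by blast+
    then show ?case using eng by (simp add: m_assoc)
  qed (use step in auto)
  moreover have "\<one> \<in> (\<Union>n. words n)" using UN_I[of 0 UNIV \<one> words] by simp
  ultimately have "h \<otimes> \<one> \<in> (\<Union>n. words n)" if "h \<in> carrier G" for h using that Q(3) by blast
  then show "carrier G \<subseteq> (\<Union>n. words n)" by (metis r_one subsetI)
qed

text \<open>\<open>words n\<close> matches the n-th power of the adjacency relation, that is, walks
  of length exactly n; \<open>wball n\<close> matches distance at most n and is monotone in
  n.\<close>

definition wball :: "nat \<Rightarrow> 'a set" where
  "wball n = (\<Union>m\<le>n. words m)"

lemma wball: "finite (wball n)" "wball n \<subseteq> carrier G" "\<one> \<in> wball n"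
  using words by (auto simp: wball_def intro!: bexI[of _ 0])

lemma wball_mono: "m \<le> n \<Longrightarrow> wball m \<subseteq> wball n"
  unfolding wball_def by (rule UN_mono) auto

lemma finite_subset_wball:
  assumes "finite F" "F \<subseteq> carrier G"
  obtains n where "F \<subseteq> wball n"
proof -
  have "\<exists>n. F \<subseteq> wball n"
    using assms
  proof (induction F)
    case (insert g F)
    then obtain n where n: "F \<subseteq> wball n" by auto
    obtain m where "g \<in> words m" using insert.prems words_exhaust by blast
    then have "g \<in> wball m" by (auto simp: wball_def)
    then have "insert g F \<subseteq> wball (max m n)"
      using n wball_mono[of m "max m n"] wball_mono[of n "max m n"] by auto
    then show ?case by blast
  qed auto
  then show ?thesis using that by blast
qed

lemma adj_iff:
  "(x, y) \<in> schreier_adj G Q H \<longleftrightarrow> x \<in> V \<and> (\<exists>s\<in>Q \<union> m_inv G ` Q. y = s \<cdot> x)"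
proof
  assume "(x, y) \<in> schreier_adj G Q H"
  then obtain \<gamma> where \<gamma>: "\<gamma> \<in> Q" "x \<in> V" "y \<in> V" "\<gamma> \<cdot> x = y \<or> \<gamma> \<cdot> y = x"
    by (auto simp: schreier_adj_def schreier_edge_def)
  then have "y = \<gamma> \<cdot> x \<or> y = inv \<gamma> \<cdot> x" using act_eq_iff[of \<gamma> y x] Q(2) by auto
  then show "x \<in> V \<and> (\<exists>s\<in>Q \<union> m_inv G ` Q. y = s \<cdot> x)" using \<gamma> by blast
next
  assume "x \<in> V \<and> (\<exists>s\<in>Q \<union> m_inv G ` Q. y = s \<cdot> x)"
  then obtain \<gamma> where \<gamma>: "\<gamma> \<in> Q" "x \<in> V" "y = \<gamma> \<cdot> x \<or> y = inv \<gamma> \<cdot> x" by blast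
  then have "\<gamma> \<in> carrier G" using Q(2) by blast
  then have "schreier_edge G H \<gamma> x y \<or> schreier_edge G H \<gamma> y x"
    using \<gamma> by (auto simp: schreier_edge_def)
  then show "(x, y) \<in> schreier_adj G Q H"
    using \<gamma>(1) by (auto simp: schreier_adj_def)
qed

lemma adj_power_iff:
  assumes "x \<in> V"
  shows "(x, y) \<in> schreier_adj G Q H ^^ n \<longleftrightarrow> (\<exists>g\<in>words n. y = g \<cdot> x)"
proof (induction n arbitrary: y)
  case 0
  then show ?case using assms by auto
next
  case (Suc n)
  have gx: "g \<cdot> x \<in> V" if "g \<in> words n" for g using that words(2) assms by blast
  have "(x, y) \<in> schreier_adj G Q H ^^ Suc n \<longleftrightarrow>
      (\<exists>z. (\<exists>g\<in>words n. z = g \<cdot> x) \<and> (z, y) \<in> schreier_adj G Q H)"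
    by (auto simp: relcomp_unfold Suc)
  also have "\<dots> \<longleftrightarrow> (\<exists>g\<in>words n. (g \<cdot> x, y) \<in> schreier_adj G Q H)" by blast
  also have "\<dots> \<longleftrightarrow> (\<exists>g\<in>words n. \<exists>s\<in>Q \<union> m_inv G ` Q. y = s \<cdot> g \<cdot> x)"
    by (intro bex_cong refl) (simp only: adj_iff gx simp_thms)
  also have "\<dots> \<longleftrightarrow> (\<exists>g\<in>words n. \<exists>s\<in>Q \<union> m_inv G ` Q. y = (s \<otimes> g) \<cdot> x)"
  proof -
    have "s \<cdot> g \<cdot> x = (s \<otimes> g) \<cdot> x" if "g \<in> words n" "s \<in> Q \<union> m_inv G ` Q" for g s
      using that words(2)[of n] Q(2) assms by (subst act_mult) auto
    then show ?thesis by (intro bex_cong refl) simp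
  qed
  finally show ?case by auto
qed

lemma dist_le_iff:
  assumes x: "x \<in> V" and y: "y \<in> V"
  shows "schreier_dist G Q H x y \<le> n \<longleftrightarrow> y \<in> nbhd (wball n) x"
proof
  \<comment> \<open>Transitivity of the action and generation by Q provide a walk from x to y, so
    the minimum defining the distance is attained.\<close>
  obtain g where "g \<in> carrier G" "y = g \<cdot> x" using act_transitive[OF x y] .
  then obtain m where "(x, y) \<in> schreier_adj G Q H ^^ m"
    using words_exhaust adj_power_iff[OF x] by blast
  then have "(x, y) \<in> schreier_adj G Q H ^^ schreier_dist G Q H x y"
    unfolding schreier_dist_def by (rule LeastI)
  then obtain h where "h \<in> words (schreier_dist G Q H x y)" "y = h \<cdot> x"
    using adj_power_iff[OF x] by blast
  moreover assume "schreier_dist G Q H x y \<le> n"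
  ultimately show "y \<in> nbhd (wball n) x" by (auto simp: nbhd_def wball_def)
next
  assume "y \<in> nbhd (wball n) x"
  then obtain m g where "m \<le> n" "g \<in> words m" "y = g \<cdot> x" by (auto simp: nbhd_def wball_def)
  then have "schreier_dist G Q H x y \<le> m"
    unfolding schreier_dist_def using adj_power_iff[OF x] by (intro Least_le) blast
  then show "schreier_dist G Q H x y \<le> n" using \<open>m \<le> n\<close> by simp
qed

section \<open>Balls and their rooted labelled isomorphisms\<close>

lemma ball_eq: "x \<in> V \<Longrightarrow> schreier_ball G Q H n x = nbhd (wball n) x"
  using dist_le_iff wball(2)[of n] by (auto simp: schreier_ball_def nbhd_def)

text \<open>Rigidity: a vertex has one outgoing and one incoming edge per label, so an isomorphism
  fixing the roots is forced along every word. The induction can follow the word because the points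
  reached by its shorter right-hand parts stay in the ball.\<close>

lemma ball_iso_act:
  assumes x: "x \<in> V" and y: "y \<in> V" and iso: "ball_iso G Q H n x y \<theta>" and g: "g \<in> wball n"
  shows "\<theta> (g \<cdot> x) = g \<cdot> y"
proof -
  have "\<theta> (g \<cdot> x) = g \<cdot> y" if "m \<le> n" "g \<in> words m" for m g
    using that
  proof (induction m arbitrary: g)
    case 0
    then show ?case using iso x y by (simp add: ball_iso_def)
  next
    case (Suc m)
    then obtain s h where sh: "s \<in> Q \<union> m_inv G ` Q" "h \<in> words m" "g = s \<otimes> h" by auto
    have IH: "\<theta> (h \<cdot> x) = h \<cdot> y" using Suc sh by simp
    have c: "s \<in> carrier G" "h \<in> carrier G" "g \<in> carrier G" using sh Q(2) words(2) by auto
    have "h \<in> wball n" "g \<in> wball n" using sh Suc.prems by (force simp: wball_def)+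
    then have ball: "h \<cdot> x \<in> schreier_ball G Q H n x" "g \<cdot> x \<in> schreier_ball G Q H n x"
      using ball_eq[OF x] by (auto simp: nbhd_def)
    then have \<theta>V: "\<theta> (g \<cdot> x) \<in> V"
      using iso by (auto simp: ball_iso_def schreier_ball_def dest!: bij_betwE)
    have gx: "g \<cdot> z = s \<cdot> h \<cdot> z" if "z \<in> V" for z using sh c that by (simp add: act_mult)
    have edge: "schreier_edge G H \<gamma> u v \<longleftrightarrow> schreier_edge G H \<gamma> (\<theta> u) (\<theta> v)"
      if "\<gamma> \<in> Q" "u \<in> schreier_ball G Q H n x" "v \<in> schreier_ball G Q H n x" for \<gamma> u v
      using iso that unfolding ball_iso_def by blast
    show ?case
    proof (cases "s \<in> Q")
      case True
      have "schreier_edge G H s (h \<cdot> x) (g \<cdot> x)"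
        using c x gx by (simp add: schreier_edge_def)
      then show ?thesis using edge[OF True ball] IH gx y by (simp add: schreier_edge_def)
    next
      case False
      then obtain \<gamma> where \<gamma>: "\<gamma> \<in> Q" "s = inv \<gamma>" using sh by blast
      then have \<gamma>c: "\<gamma> \<in> carrier G" using Q(2) by blast
      \<comment> \<open>Only edges labelled by members of Q are recorded, so an inverse letter is
        followed along the reversed edge.\<close>
      have "schreier_edge G H \<gamma> (g \<cdot> x) (h \<cdot> x)"
        using c x gx \<gamma> \<gamma>c by (simp add: schreier_edge_def)
      then have "\<gamma> \<cdot> \<theta> (g \<cdot> x) = h \<cdot> y"
        using edge[OF \<gamma>(1) ball(2,1)] IH by (simp add: schreier_edge_def)
      then show ?thesis using act_eq_iff[OF \<gamma>c \<theta>V] c y gx \<gamma> by simp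
    qed
  qed
  then show ?thesis using g by (auto simp: wball_def)
qed

lemma ball_iso_eq_iff:
  assumes "x \<in> V" "y \<in> V" "ball_iso G Q H n x y \<theta>" "g \<in> wball n" "h \<in> wball n"
  shows "g \<cdot> x = h \<cdot> x \<longleftrightarrow> g \<cdot> y = h \<cdot> y"
proof -
  have "inj_on \<theta> (nbhd (wball n) x)"
    using assms(3) ball_eq[OF assms(1)] by (simp add: ball_iso_def bij_betw_def)
  then have "\<theta> (g \<cdot> x) = \<theta> (h \<cdot> x) \<longleftrightarrow> g \<cdot> x = h \<cdot> x"
    using assms(4,5) by (intro inj_on_eq_iff) (auto simp: nbhd_def)
  then show ?thesis using ball_iso_act[OF assms(1-3)] assms(4,5) by simp
qed

text \<open>The map sends g x to g y; equal coincidence patterns make it well defined and injective.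
  Length n + 1 enters through the edges: an edge \<open>\<gamma>\<close> from g x to h x says that
  \<open>\<gamma> \<otimes> g\<close> and h agree at x, and the former word may have one letter
  more.\<close>

lemma ball_iso_exists:
  assumes x: "x \<in> V" and y: "y \<in> V"
    and eq: "\<And>g h. g \<in> wball (Suc n) \<Longrightarrow> h \<in> wball (Suc n) \<Longrightarrow> g \<cdot> x = h \<cdot> x \<longleftrightarrow> g \<cdot> y = h \<cdot> y"
  obtains \<theta> where "ball_iso G Q H n x y \<theta>"
proof -
  define \<theta> where "\<theta> z = (SOME g. g \<in> wball n \<and> g \<cdot> x = z) \<cdot> y" for z
  have mono: "wball n \<subseteq> wball (Suc n)" by (rule wball_mono) simp
  have \<theta>: "\<theta> (g \<cdot> x) = g \<cdot> y" if g: "g \<in> wball n" for g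
  proof -
    have "(SOME h. h \<in> wball n \<and> h \<cdot> x = g \<cdot> x) \<in> wball n \<and> (SOME h. h \<in> wball n \<and> h \<cdot> x = g \<cdot> x) \<cdot> x = g \<cdot> x"
      by (rule someI[of _ g]) (use g in simp)
    then show ?thesis unfolding \<theta>_def using eq mono g by blast
  qed
  have "bij_betw \<theta> (nbhd (wball n) x) (nbhd (wball n) y)"
    unfolding bij_betw_def
  proof
    show "inj_on \<theta> (nbhd (wball n) x)"
      using eq mono by (auto simp: inj_on_def nbhd_def \<theta> subset_iff)
    show "\<theta> ` nbhd (wball n) x = nbhd (wball n) y"
      by (auto simp: nbhd_def \<theta> image_iff)
  qed
  moreover have "\<theta> x = y" using \<theta>[OF wball(3)] x y by simp
  moreover have "schreier_edge G H \<gamma> u v \<longleftrightarrow> schreier_edge G H \<gamma> (\<theta> u) (\<theta> v)"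
    if uv: "u \<in> nbhd (wball n) x" "v \<in> nbhd (wball n) x" and \<gamma>: "\<gamma> \<in> Q" for u v \<gamma>
  proof -
    obtain g h where gh: "g \<in> wball n" "u = g \<cdot> x" "h \<in> wball n" "v = h \<cdot> x"
      using uv by (auto simp: nbhd_def)
    have c: "\<gamma> \<in> carrier G" "g \<in> carrier G" "h \<in> carrier G" using \<gamma> gh Q(2) wball(2) by blast+
    obtain m where "m \<le> n" "g \<in> words m" using gh(1) by (auto simp: wball_def)
    then have "\<gamma> \<otimes> g \<in> words (Suc m)" "Suc m \<le> Suc n" using \<gamma> by force+
    then have "\<gamma> \<otimes> g \<in> wball (Suc n)" unfolding wball_def by blast
    then have "(\<gamma> \<otimes> g) \<cdot> x = h \<cdot> x \<longleftrightarrow> (\<gamma> \<otimes> g) \<cdot> y = h \<cdot> y"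
      using eq gh(3) mono by blast
    then show ?thesis using gh c x y \<theta> by (simp add: schreier_edge_def act_mult)
  qed
  ultimately show ?thesis
    using that[of \<theta>] unfolding ball_iso_def ball_eq[OF x] ball_eq[OF y] by blast
qed

text \<open>The bridge from invariance under ball isomorphisms to stabiliser locality, used for
  kernels and for \<open>\<sigma>\<close>. The element g joins the test set so that x and y agree on
  whether their g-translate lies in the ball and on which of its vertices it is.\<close>

lemma stab_local_ball_isoI:
  assumes g: "g \<in> carrier G"
    and iso: "\<And>x y \<theta>. x \<in> V \<Longrightarrow> y \<in> V \<Longrightarrow> ball_iso G Q H n x y \<theta> \<Longrightarrow>
      g \<cdot> x \<in> schreier_ball G Q H n x \<Longrightarrow> \<theta> (g \<cdot> x) = g \<cdot> y \<Longrightarrow> \<Xi> y (g \<cdot> y) = \<Xi> x (g \<cdot> x)"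
    and outside: "\<And>x. x \<in> V \<Longrightarrow> g \<cdot> x \<notin> schreier_ball G Q H n x \<Longrightarrow> \<Xi> x (g \<cdot> x) = c"
  shows "stab_local (\<lambda>x. \<Xi> x (g \<cdot> x))"
proof (rule stab_local_pairsI[of "insert g (wball (Suc n))"])
  fix x y assume x: "x \<in> V" and y: "y \<in> V"
    and eq: "\<And>h k. h \<in> insert g (wball (Suc n)) \<Longrightarrow> k \<in> insert g (wball (Suc n)) \<Longrightarrow>
      h \<cdot> x = k \<cdot> x \<longleftrightarrow> h \<cdot> y = k \<cdot> y"
  have mono: "wball n \<subseteq> wball (Suc n)" by (rule wball_mono) simp
  show "\<Xi> x (g \<cdot> x) = \<Xi> y (g \<cdot> y)"
  proof (cases "g \<cdot> x \<in> schreier_ball G Q H n x")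
    case True
    obtain \<theta> where \<theta>: "ball_iso G Q H n x y \<theta>"
      by (rule ball_iso_exists[OF x y, of n]) (use eq in auto)
    obtain h where h: "h \<in> wball n" "g \<cdot> x = h \<cdot> x"
      using True ball_eq[OF x] by (auto simp: nbhd_def)
    then have "g \<cdot> y = h \<cdot> y" using eq[of g h] mono by blast
    then have "\<theta> (g \<cdot> x) = g \<cdot> y" using h ball_iso_act[OF x y \<theta> h(1)] by simp
    then show ?thesis using iso[OF x y \<theta> True] by simp
  next
    case False
    have "g \<cdot> y \<notin> schreier_ball G Q H n y"
    proof
      assume "g \<cdot> y \<in> schreier_ball G Q H n y"
      then obtain h where "h \<in> wball n" "g \<cdot> y = h \<cdot> y" using ball_eq[OF y] by (auto simp: nbhd_def)
      then show False using eq[of g h] mono False ball_eq[OF x] by (auto simp: nbhd_def)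
    qed
    then show ?thesis using False outside x y by simp
  qed
qed (use g wball in auto)

text \<open>Forwards, this is \<open>stab_local_ball_isoI\<close>. Backwards, a radius is taken so
  large that the words cover both the range P and a test set F for all displacements in P;
  isomorphisms of such balls preserve the coincidences tested by F.\<close>

lemma local_kernel_iff: "local_kernel G Q H K \<longleftrightarrow> local_ker K"
proof
  assume K: "local_kernel G Q H K"
  then have K_V: "K x y = 0" if "x \<notin> V \<or> y \<notin> V" for x y
    using that unfolding local_kernel_def by metis
  from K obtain r where r: "\<forall>x\<in>V. \<forall>y\<in>V. schreier_dist G Q H x y > r \<longrightarrow> K x y = 0"
    and iso: "\<forall>y\<in>V. \<forall>z\<in>V. \<forall>\<theta>. ball_iso G Q H r y z \<theta> \<longrightarrow>
      (\<forall>w\<in>schreier_ball G Q H r y. K y w = K z (\<theta> w))"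
    unfolding local_kernel_def by (elim conjE exE) (rule that)
  have K0: "x \<in> V \<and> y \<in> schreier_ball G Q H r x" if "K x y \<noteq> 0" for x y
  proof -
    have "x \<in> V" "y \<in> V" using K_V[of x y] that by blast+
    then show ?thesis using r that by (auto simp: schreier_ball_def not_less[symmetric])
  qed
  obtain P where P: "sym_fin P" "wball r \<subseteq> P" using sym_fin_exists[OF wball(1,2)] by blast
  have "finite_range (wball r) K"
    unfolding finite_range_def using K0 ball_eq by blast
  then have "finite_range P K" by (rule finite_range_mono[OF _ P(2)])
  moreover have "stab_local (\<lambda>x. K x (g \<cdot> x))" if "g \<in> carrier G" for g
  proof (rule stab_local_ball_isoI[OF that, where n=r and c=0])
    fix x y \<theta> assume "x \<in> V" "y \<in> V" "ball_iso G Q H r x y \<theta>"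
      "g \<cdot> x \<in> schreier_ball G Q H r x" "\<theta> (g \<cdot> x) = g \<cdot> y"
    then show "K y (g \<cdot> y) = K x (g \<cdot> x)" using iso by metis
  qed (use K0 in blast)
  ultimately show "local_ker K" unfolding local_ker_def using P(1) by blast
next
  assume K: "local_ker K"
  then obtain P where P: "sym_fin P" "finite_range P K" by (auto simp: local_ker_def)
  obtain m where m: "P \<subseteq> wball m" by (rule finite_subset_wball[of P]) (use P(1) in \<open>auto simp: sym_fin_def\<close>)
  have "stab_local (\<lambda>x. \<lambda>g\<in>P. K x (g \<cdot> x))"
    using K sym_finD[OF P(1)] by (intro stab_local_family) (auto simp: local_ker_def)
  then obtain F where F: "finite F" "F \<subseteq> carrier G"
    "\<forall>x\<in>V. \<forall>y\<in>V. (\<forall>g\<in>F. g \<cdot> x = x \<longleftrightarrow> g \<cdot> y = y) \<longrightarrow> (\<lambda>g\<in>P. K x (g \<cdot> x)) = (\<lambda>g\<in>P. K y (g \<cdot> y))"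
    unfolding stab_local_def by blast
  obtain l where l: "F \<subseteq> wball l" using finite_subset_wball[OF F(1,2)] .
  \<comment> \<open>The maximum covers the range and the test set; the successor gives the
    positivity demanded by \<open>local_kernel\<close>.\<close>
  define r where "r = Suc (max m l)"
  have r: "P \<subseteq> wball r" "F \<subseteq> wball r"
    using order_trans[OF m wball_mono] order_trans[OF l wball_mono] by (auto simp: r_def)
  have K0: "x \<in> V \<and> y \<in> nbhd (wball r) x" if "K x y \<noteq> 0" for x y
    using finite_range_mono[OF P(2) r(1)] that by (auto simp: finite_range_def)
  have outside: "K x y = 0" if "x \<notin> V \<or> y \<notin> V" for x y
    using that K0[of x y] wball(2)[of r] by (auto simp: nbhd_def)
  have far: "K x y = 0" if "x \<in> V" "y \<in> V" "schreier_dist G Q H x y > r" for x y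
    using that K0[of x y] dist_le_iff[of x y r] by auto
  have iso: "K y w = K z (\<theta> w)"
    if y: "y \<in> V" and z: "z \<in> V" and \<theta>: "ball_iso G Q H r y z \<theta>" and w: "w \<in> schreier_ball G Q H r y"
    for y z \<theta> w
  proof -
    obtain h where h: "h \<in> wball r" "w = h \<cdot> y" using w ball_eq[OF y] by (auto simp: nbhd_def)
    have \<theta>w: "\<theta> w = h \<cdot> z" using ball_iso_act[OF y z \<theta> h(1)] h(2) by simp
    have "g \<cdot> y = y \<longleftrightarrow> g \<cdot> z = z" if "g \<in> F" for g
      using ball_iso_eq_iff[OF y z \<theta>, of g \<one>] that r(2) wball(3) y z by auto
    then have "(\<lambda>g\<in>P. K y (g \<cdot> y)) = (\<lambda>g\<in>P. K z (g \<cdot> z))"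
      by (intro F(3)[rule_format, OF y z])
    then have eq: "K y (g \<cdot> y) = K z (g \<cdot> z)" if "g \<in> P" for g
      using that by (metis restrict_apply')
    show ?thesis
    \<comment> \<open>A vertex of the ball may lie outside the range P; the isomorphism preserves
      this, and then both entries vanish.\<close>
    proof (cases "\<exists>g\<in>P. h \<cdot> y = g \<cdot> y")
      case True
      then show ?thesis using ball_iso_eq_iff[OF y z \<theta> h(1)] r(1) eq h(2) \<theta>w by (metis subsetD)
    next
      case False
      then have "\<not> (\<exists>g\<in>P. h \<cdot> z = g \<cdot> z)" using ball_iso_eq_iff[OF y z \<theta> h(1)] r(1) by blast
      then have "K z (h \<cdot> z) = 0" "K y (h \<cdot> y) = 0"
        using P(2) False unfolding finite_range_def nbhd_def by blast+
      then show ?thesis using h(2) \<theta>w by simp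
    qed
  qed
  have "r > 0" by (simp add: r_def)
  then show "local_kernel G Q H K"
    unfolding local_kernel_def
  proof (intro conjI allI impI ballI exI[of _ r])
    show "K x y = 0" if "x \<notin> V \<or> y \<notin> V" for x y by (rule outside[OF that])
    show "K x y = 0" if "x \<in> V" "y \<in> V" "schreier_dist G Q H x y > r" for x y by (rule far[OF that])
    show "K y w = K z (\<theta> w)" if "y \<in> V" "z \<in> V" "ball_iso G Q H r y z \<theta>" "w \<in> schreier_ball G Q H r y"
      for y z \<theta> w by (rule iso[OF that])
  qed
qed

section \<open>The reduced algebra and Local Property A in terms of the action\<close>

lemma reduced_cstar_eq: "reduced_cstar G Q H = local_alg"
  unfolding reduced_cstar_def local_alg_def local_kernel_iff ..

lemma local_property_A_unit_vectors:
  assumes "local_property_A G Q H"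
  shows local_unit_vectors
  unfolding local_unit_vectors_def
proof (intro allI impI)
  fix P and \<epsilon> :: real
  assume P: "sym_fin P" and "0 < \<epsilon>"
  obtain m where m: "P \<subseteq> wball m" by (rule finite_subset_wball[of P]) (use P in \<open>auto simp: sym_fin_def\<close>)
  obtain l :: nat where l: "1 / \<epsilon> < real l" using reals_Archimedean2 by blast
  \<comment> \<open>The index is large enough for the n-ball to absorb the translations in P and for
    1 / n to be at most \<open>\<epsilon>\<close>; the successor gives n \<ge> 1.\<close>
  define n where "n = Suc (max m l)"
  have "1 / \<epsilon> < real n" using l by (simp add: n_def)
  then have n: "n \<ge> 1" "P \<subseteq> wball n" "1 / real n \<le> \<epsilon>"
    using order_trans[OF m wball_mono, of n] \<open>0 < \<epsilon>\<close> by (simp_all add: n_def field_simps)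
  from assms obtain \<sigma> :: "nat \<Rightarrow> 'a set \<Rightarrow> 'a set \<Rightarrow> complex" where \<sigma>: "\<forall>n\<ge>1.
        (\<forall>x\<in>V. \<sigma> n x \<in> ell2 V \<and> ell2_norm V (\<sigma> n x) = 1) \<and>
        (\<forall>x\<in>V. \<forall>y\<in>V. schreier_dist G Q H x y \<le> n \<longrightarrow> ell2_norm V (\<lambda>v. \<sigma> n x v - \<sigma> n y v) \<le> 1 / real n) \<and>
        (\<exists>R>0. (\<forall>x\<in>V. \<forall>v. v \<notin> schreier_ball G Q H R x \<longrightarrow> \<sigma> n x v = 0) \<and>
           (\<exists>S>R. \<forall>x\<in>V. \<forall>y\<in>V. \<forall>\<theta>. ball_iso G Q H S x y \<theta> \<longrightarrow>
              \<sigma> n y = transport \<theta> (schreier_ball G Q H S x) (\<sigma> n x)))"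
    unfolding local_property_A_def by (elim exE) (rule that)
  from \<sigma>[rule_format, OF n(1)] obtain r s where
    unit: "\<forall>x\<in>V. \<sigma> n x \<in> ell2 V \<and> ell2_norm V (\<sigma> n x) = 1"
    and close: "\<forall>x\<in>V. \<forall>y\<in>V. schreier_dist G Q H x y \<le> n \<longrightarrow>
      ell2_norm V (\<lambda>v. \<sigma> n x v - \<sigma> n y v) \<le> 1 / real n"
    and supp: "\<forall>x\<in>V. \<forall>v. v \<notin> schreier_ball G Q H r x \<longrightarrow> \<sigma> n x v = 0"
    and "r < s" and iso: "\<forall>x\<in>V. \<forall>y\<in>V. \<forall>\<theta>. ball_iso G Q H s x y \<theta> \<longrightarrow>
      \<sigma> n y = transport \<theta> (schreier_ball G Q H s x) (\<sigma> n x)"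
    by (elim conjE exE) (rule that)
  obtain R where R: "sym_fin R" "wball r \<subseteq> R" using sym_fin_exists[OF wball(1,2)] by blast
  have "v \<in> nbhd R x" if "x \<in> V" "\<sigma> n x v \<noteq> 0" for x v
  proof -
    have "v \<in> schreier_ball G Q H r x" using supp[rule_format, OF that(1)] that(2) by metis
    then show ?thesis unfolding ball_eq[OF that(1)] using R(2) by (auto simp: nbhd_def)
  qed
  moreover have "ell2_norm V (\<lambda>v. \<sigma> n x v - \<sigma> n (g \<cdot> x) v) \<le> \<epsilon>" if g: "g \<in> P" and x: "x \<in> V" for g x
  proof -
    have gx: "g \<cdot> x \<in> V" using sym_finD(2)[OF P g] x by (rule act_closed)
    have "g \<cdot> x \<in> nbhd (wball n) x" using g n(2) by (auto simp: nbhd_def)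
    then show ?thesis using close[rule_format, OF x gx] dist_le_iff[OF x gx, of n] n(3) by simp
  qed
  moreover have "stab_local (\<lambda>x. \<sigma> n x (g \<cdot> x))" if g: "g \<in> carrier G" for g
  proof (rule stab_local_ball_isoI[OF g, where n=s and c=0])
    fix x y \<theta> assume x: "x \<in> V" and y: "y \<in> V" and \<theta>: "ball_iso G Q H s x y \<theta>"
      and gx: "g \<cdot> x \<in> schreier_ball G Q H s x" and eq: "\<theta> (g \<cdot> x) = g \<cdot> y"
    have inj: "inj_on \<theta> (schreier_ball G Q H s x)" using \<theta> by (simp add: ball_iso_def bij_betw_def)
    \<comment> \<open>By injectivity of \<open>\<theta>\<close> on the ball, the transported vector
      takes at \<open>\<theta> (g \<cdot> x)\<close> the value of the original one at
      \<open>g \<cdot> x\<close>.\<close>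
    have "\<sigma> n y (\<theta> (g \<cdot> x)) = \<sigma> n x (g \<cdot> x)"
      unfolding iso[rule_format, OF x y \<theta>] transport_def using gx inj by simp
    then show "\<sigma> n y (g \<cdot> y) = \<sigma> n x (g \<cdot> x)" using eq by simp
  next
    fix x assume x: "x \<in> V" and "g \<cdot> x \<notin> schreier_ball G Q H s x"
    \<comment> \<open>Since r < s, a point outside the isomorphism ball is outside the support, so
      both vectors have the default value 0 there.\<close>
    then have "g \<cdot> x \<notin> schreier_ball G Q H r x" using \<open>r < s\<close> by (auto simp: schreier_ball_def)
    then show "\<sigma> n x (g \<cdot> x) = 0" using supp x by blast
  qed
  ultimately show "\<exists>\<sigma> R. sym_fin R \<and>
        (\<forall>x\<in>V. \<sigma> x \<in> ell2 V \<and> ell2_norm V (\<sigma> x) = 1 \<and> (\<forall>v. \<sigma> x v \<noteq> 0 \<longrightarrow> v \<in> nbhd R x)) \<and>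
        (\<forall>g\<in>P. \<forall>x\<in>V. ell2_norm V (\<lambda>v. \<sigma> x v - \<sigma> (g \<cdot> x) v) \<le> \<epsilon>) \<and>
        (\<forall>g\<in>carrier G. stab_local (\<lambda>x. \<sigma> x (g \<cdot> x)))"
    using unit R(1) by (intro exI[of _ "\<sigma> n"] exI[of _ R]) blast
qed

end

theorem theorem8:
  fixes G :: "('a, 'b) monoid_scheme" and Q :: "'a set" and Z :: "'a set set" and H :: "'a set"
  assumes "group G"
    and "finite Q" and "Q \<subseteq> carrier G" and "generate G Q = carrier G"
    and "URS G Z" and "H \<in> Z"
    and "local_property_A G Q H"
  shows "nuclear (lcosets\<^bsub>G\<^esub> H) (reduced_cstar G Q H)"
proof -
  \<comment> \<open>The points of \<open>Sub G\<close> are subgroups, so membership of H in a closed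
    subset supplies \<open>subgroup H G\<close>, from which the Schreier graph is built.\<close>
  have "closedin (Sub G) Z" using assms(5) by (simp add: URS_def closed_invariant_def)
  then have "H \<in> topspace (Sub G)" using closedin_subset assms(6) by blast
  then have "subgroup H G"
    unfolding Sub_def by (simp add: topspace_pullback_topology)
  then interpret schreier_graph G Q H
    using assms(1-4) by (simp add: schreier_graph_def schreier_graph_axioms_def)
  show ?thesis
    unfolding reduced_cstar_eq
    by (rule nuclear_local_alg[OF local_property_A_unit_vectors[OF assms(7)]])
qed

end
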